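(* Let $G_n=(V_n,E_n)$, $n\in\mathbb{N}$, be finite digraphs with $\lim_{n\to\infty}|V_n|=\infty$. Suppose that for every finite rooted tree $G'=(V',E')$ the limit \[ \beta_{G'}:=\lim_{n\to\infty}\frac{|\mathrm{Hom}(G',G_n)|}{|V_n|^{|V'|}} \] exists. Let $\mu\in\mathcal{P}(\mathbb{R})$ and let $(\mu_n)_{n\in\mathbb{N}}$ be probability measures on $\mathbb{R}$ such that $\mu_n^{\uplus|V_n|}\to\mu$ weakly. Then $\lim_{n\to\infty}\boxplus_{G_n}(\mu_n)$ exists (weakly) in $\mathcal{P}(\mathbb{R})$. Furthermore, this limit depends only on $\mu$ and on the coefficients $\beta_{G'}$ ($G'$ ranging over finite rooted trees): if $(\tilde G_n,\tilde\mu_n)$ is another pair of sequences satisfying the same hypotheses with the same $\mu$ and the same coefficients $\beta_{G'}$ for all finite rooted trees $G'$, then $\lim_n\boxplus_{\tilde G_n}(\tilde\mu_n)=\lim_n\boxplus_{G_n}(\mu_n)$.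
   Context: A digraph is a pair $G=(V,E)$ with $E\subseteq V\times V$ disjoint from the diagonal; write $v\rightsquigarrow w$ if $(v,w)\in E$. A digraph homomorphism $G_1\to G_2$ is a map $\phi:V_1\to V_2$ with $v\rightsquigarrow w\Rightarrow \phi(v)\rightsquigarrow\phi(w)$; $\mathrm{Hom}(G_1,G_2)$ is the set of these. A rooted tree is a digraph with a vertex $r$ (the root) such that every vertex $w$ is reached by a unique directed path from $r$. $\mathcal{P}(\mathbb{R})$ is the space of Borel probability measures on $\mathbb{R}$ with the weak-$*$ topology. For $\mu\in\mathcal{P}(\mathbb{R})$ and $z$ in the upper half-plane $\mathbb{C}^+$, let $G_\mu(z)=\int\frac{1}{z-t}\,d\mu(t)$ and $K_\mu(z)=z-1/G_\mu(z)$. The boolean convolution $\mu\uplus\nu$ is the probability measure with $K_{\mu\uplus\nu}=K_\mu+K_\nu$, and for $t>0$ the boolean power $\mu^{\uplus t}$ is the (known to exist, unique) probability measure with $K_{\mu^{\uplus t}}=tK_\mu$. For a finite digraph $G=(V,E)$ and $(\mu_v)_{v\in V}\subseteq\mathcal{P}(\mathbb{R})$ there is a unique family $(\nu_v)_{v\in V}\subseteq\mathcal{P}(\mathbb{R})$ with $K_{\nu_v}(z)=K_{\mu_v}\big(z-\sum_{w:\,v\rightsquigarrow w}K_{\nu_w}(z)\big)$ for $z\in\mathbb{C}^+$; the $G$-free convolution is $\boxplus_G((\mu_v)_v)=\biguplus_{v\in V}\nu_v$, and $\boxplus_G(\mu)$ denotes the case where all $\mu_v=\mu$. (For compactly supported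 measures this agrees with the distribution of a sum of $G$-freely independent variables with distributions $\mu_v$.) *)

theory Defs
  imports "HOL-Probability.Probability" "HOL-Library.FuncSet"
begin

definition digraph :: "'a set \<Rightarrow> ('a \<times> 'a) set \<Rightarrow> bool" where
  "digraph V E \<longleftrightarrow> E \<subseteq> V \<times> V \<and> (\<forall>v. (v, v) \<notin> E)"

definition finite_digraph :: "'a set \<Rightarrow> ('a \<times> 'a) set \<Rightarrow> bool" where
  "finite_digraph V E \<longleftrightarrow> digraph V E \<and> finite V"

definition Hom :: "'a set \<Rightarrow> ('a \<times> 'a) set \<Rightarrow> 'b set \<Rightarrow> ('b \<times> 'b) set \<Rightarrow> ('a \<Rightarrow> 'b) set" where
  "Hom V1 E1 V2 E2 = {\<phi> \<in> V1 \<rightarrow>\<^sub>E V2. \<forall>v w. (v, w) \<in> E1 \<longrightarrow> (\<phi> v, \<phi> w) \<in> E2}"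

definition dwalk :: "('a \<times> 'a) set \<Rightarrow> 'a list \<Rightarrow> bool" where
  "dwalk E xs \<longleftrightarrow> xs \<noteq> [] \<and> (\<forall>i. Suc i < length xs \<longrightarrow> (xs ! i, xs ! Suc i) \<in> E)"

definition finite_rooted_tree :: "'a set \<Rightarrow> ('a \<times> 'a) set \<Rightarrow> bool" where
  "finite_rooted_tree V E \<longleftrightarrow> finite_digraph V E \<and>
     (\<exists>r\<in>V. \<forall>w\<in>V. \<exists>!xs. dwalk E xs \<and> hd xs = r \<and> last xs = w)"

definition hom_density :: "'b set \<Rightarrow> ('b \<times> 'b) set \<Rightarrow> 'a set \<Rightarrow> ('a \<times> 'a) set \<Rightarrow> real" where
  "hom_density V' E' V E = real (card (Hom V' E' V E)) / real (card V) ^ card V'"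

definition cauchy_transform :: "real measure \<Rightarrow> complex \<Rightarrow> complex" where
  "cauchy_transform M z = integral\<^sup>L M (\<lambda>t. 1 / (z - complex_of_real t))"

definition K_transform :: "real measure \<Rightarrow> complex \<Rightarrow> complex" where
  "K_transform M z = z - 1 / cauchy_transform M z"

definition boolean_power :: "real measure \<Rightarrow> real \<Rightarrow> real measure" where
  "boolean_power M t = (THE N. real_distribution N \<and>
      (\<forall>z. 0 < Im z \<longrightarrow> K_transform N z = complex_of_real t * K_transform M z))"

definition is_boolean_conv :: "'v set \<Rightarrow> ('v \<Rightarrow> real measure) \<Rightarrow> real measure \<Rightarrow> bool" where
  "is_boolean_conv V \<nu> \<rho> \<longleftrightarrow> real_distribution \<rho> \<and>
      (\<forall>z. 0 < Im z \<longrightarrow> K_transform \<rho> z = (\<Sum>v\<in>V. K_transform (\<nu> v) z))"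

definition gfree_family :: "'v set \<Rightarrow> ('v \<times> 'v) set \<Rightarrow> ('v \<Rightarrow> real measure) \<Rightarrow> ('v \<Rightarrow> real measure) \<Rightarrow> bool" where
  "gfree_family V E \<mu> \<nu> \<longleftrightarrow> (\<forall>v\<in>V. real_distribution (\<nu> v)) \<and>
      (\<forall>v\<in>V. \<forall>z. 0 < Im z \<longrightarrow>
         K_transform (\<nu> v) z = K_transform (\<mu> v) (z - (\<Sum>w\<in>{w\<in>V. (v, w) \<in> E}. K_transform (\<nu> w) z)))"

definition gfree_conv :: "'v set \<Rightarrow> ('v \<times> 'v) set \<Rightarrow> ('v \<Rightarrow> real measure) \<Rightarrow> real measure" where
  "gfree_conv V E \<mu> = (THE \<rho>. \<exists>\<nu>. gfree_family V E \<mu> \<nu> \<and> is_boolean_conv V \<nu> \<rho>)"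

end

theory Submission
  imports Defs "HOL-Complex_Analysis.Complex_Analysis" "HOL-Real_Asymp.Real_Asymp"
begin

text \<open>
  Everything happens on the imaginary axis near infinity: there the \<open>K\<close>-transforms of a tight family are
  uniformly small, hence contractions by Cauchy's estimate, and together with tightness their values on
  the axis determine weak limits.  With \<open>N = |V|\<close>, the functions \<open>H\<^sub>v = N K\<^bsub>\<nu>\<^sub>v\<^esub>\<close> solve the fixed point
  equation \<open>H\<^sub>v(z) = k(z - (\<Sum>w. H\<^sub>w(z)) / N)\<close>, the sum ranging over the out-neighbours of \<open>v\<close>, where
  \<open>k = N K\<^sub>\<mu>\<close> is the transform of the boolean power and converges by hypothesis.  Replacing \<open>k\<close> by a
  Taylor polynomial of its limit and iterating finitely often from \<open>0\<close> expresses \<open>H\<close>, up to a small error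
  that is uniform in the graph, as a fixed linear combination of normalised counts of rooted tree
  homomorphisms; its average over \<open>v\<close>, which approximates the transform of the \<open>G\<close>-free convolution, is
  the same linear combination of tree densities.  That the boolean powers and the family \<open>\<nu>\<close> exist follows
  from Nevanlinna's theorem: every analytic \<open>K\<close> from the upper to the closed lower half plane with
  \<open>K(\<i>y) = o(y)\<close> is a \<open>K\<close>-transform.
\<close>

section \<open>Cauchy and K-transforms\<close>

text \<open>General measures have no moments, so trees cannot enter through moment expansions. They
  enter through the Taylor expansion of \<open>K\<close> at \<open>\<i> y\<close>, for each fixed
  large \<open>y\<close> separately. Two constants recur. A bound \<open>y / 20\<close> on the ball
  of radius \<open>y / 2\<close> gives the Lipschitz constant \<open>4 * 1/20 = 1/5\<close> on the
  ball of radius \<open>y / 4\<close>; the same bound keeps arguments displaced by a neighbour sum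
  inside the smaller ball. It is imposed on \<open>N K\<close> and a neighbour sum has at most
  \<open>N\<close> terms, so in the passage to the limit the thresholds on \<open>y\<close> depend
  on the boolean powers and not on the graphs. The limit is never computed: at each height the
  values lie eventually within any given error of a number built from \<mu> and \<beta> alone, which
  yields both convergence and independence of the sequences. As \<open>boolean_power\<close> and
  \<open>gfree_conv\<close> are definite descriptions, existence and uniqueness must precede every
  estimate. Uniqueness of the family is proved on a ray of the axis and spread by the identity
  theorem.\<close>

lemma norm_resolvent_le:
  assumes "0 < Im z"
  shows "norm (1 / (z - complex_of_real t)) \<le> 1 / Im z"
proof -
  have "Im z \<le> norm (z - complex_of_real t)"
    using abs_Im_le_cmod[of "z - complex_of_real t"] by simp
  then show ?thesis
    using assms by (simp add: norm_divide divide_simps)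
qed

lemma upper_minus_real_nz: "0 < Im z \<Longrightarrow> z - complex_of_real t \<noteq> 0"
  by (metis Im_complex_of_real eq_iff_diff_eq_0 less_irrefl)

lemma Im_resolvent: "Im (1 / (z - complex_of_real t)) = - (Im z / ((Re z - t)\<^sup>2 + (Im z)\<^sup>2))"
  by (simp add: Im_divide)

definition upper :: "complex set" where "upper = {z. 0 < Im z}"

lemma open_upper: "open upper"
  unfolding upper_def by (rule open_halfspace_Im_gt)

lemma convex_upper: "convex upper"
  unfolding upper_def by (rule convex_halfspace_Im_gt)

context real_distribution
begin

lemma prob_UNIV [simp]: "measure M UNIV = 1"
  using prob_space by simp

lemma resolvent_measurable [measurable]:
  "(\<lambda>t. 1 / (z - complex_of_real t)) \<in> borel_measurable M"
  by measurable

lemma resolvent_integrable: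
  assumes "0 < Im z"
  shows "integrable M (\<lambda>t. 1 / (z - complex_of_real t))"
  by (rule integrable_const_bound[of _ "1 / Im z"]) (use norm_resolvent_le[OF assms] in auto)

lemma norm_cauchy_le:
  assumes "0 < Im z"
  shows "norm (cauchy_transform M z) \<le> 1 / Im z"
proof -
  have "norm (cauchy_transform M z) \<le> (\<integral>t. 1 / Im z \<partial>M)"
    unfolding cauchy_transform_def
    by (rule Bochner_Integration.integral_norm_bound_integral)
      (use norm_resolvent_le[OF assms] resolvent_integrable[OF assms] in auto)
  then show ?thesis by (simp add: prob_space)
qed

lemma Im_cauchy:
  assumes "0 < Im z"
  shows "Im (cauchy_transform M z) = - (\<integral>t. Im z / ((Re z - t)\<^sup>2 + (Im z)\<^sup>2) \<partial>M)"
    and "integrable M (\<lambda>t. Im z / ((Re z - t)\<^sup>2 + (Im z)\<^sup>2))"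
proof -
  have "Im (cauchy_transform M z) = (\<integral>t. Im (1 / (z - complex_of_real t)) \<partial>M)"
    unfolding cauchy_transform_def
    using resolvent_integrable[OF assms] by simp
  then show "Im (cauchy_transform M z) = - (\<integral>t. Im z / ((Re z - t)\<^sup>2 + (Im z)\<^sup>2) \<partial>M)"
    by (simp only: Im_resolvent integral_minus)
  have "integrable M (\<lambda>t. - Im (1 / (z - complex_of_real t)))"
    using resolvent_integrable[OF assms] by (intro integrable_minus integrable_Im)
  then show "integrable M (\<lambda>t. Im z / ((Re z - t)\<^sup>2 + (Im z)\<^sup>2))"
    by (simp only: Im_resolvent minus_minus)
qed

lemma Im_cauchy_neg:
  assumes "0 < Im z"
  shows "Im (cauchy_transform M z) < 0"
proof -
  let ?f = "\<lambda>t. Im z / ((Re z - t)\<^sup>2 + (Im z)\<^sup>2)"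
  have pos: "0 < ?f t" for t
    using assms by (simp add: add_nonneg_pos)
  have "(\<integral>t. ?f t \<partial>M) \<noteq> 0"
  proof
    assume "(\<integral>t. ?f t \<partial>M) = 0"
    then have "AE t in M. ?f t = 0"
      using integral_nonneg_eq_0_iff_AE[OF Im_cauchy(2)[OF assms]] pos
      by (simp add: less_imp_le)
    then have "AE t in M. False"
      by (rule eventually_mono) (use pos in \<open>metis less_irrefl\<close>)
    then show False by simp
  qed
  moreover have "0 \<le> (\<integral>t. ?f t \<partial>M)"
    by (intro integral_nonneg_AE always_eventually allI less_imp_le pos)
  ultimately show ?thesis by (simp add: Im_cauchy(1)[OF assms])
qed

lemma cauchy_nz: "0 < Im z \<Longrightarrow> cauchy_transform M z \<noteq> 0"
  using Im_cauchy_neg by fastforce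

lemma cauchy_eq_K: "0 < Im z \<Longrightarrow> cauchy_transform M z = 1 / (z - K_transform M z)"
  by (simp add: K_transform_def)

text \<open>Differentiation under the integral by an explicit estimate: the error of the difference
  quotient is the integral of \<open>(w - z) / ((w - t) * (z - t)^2)\<close>, and for
  \<open>w\<close> within \<open>y / 2\<close> of \<open>z\<close> the resolvents are at most
  \<open>2 / y\<close>, \<open>1 / y\<close> and \<open>1 / y\<close>.\<close>

lemma cauchy_has_derivative:
  assumes z: "0 < Im z"
  shows "(cauchy_transform M has_field_derivative (\<integral>t. - (1 / (z - complex_of_real t) ^ 2) \<partial>M)) (at z)"
proof -
  define D where "D = (\<integral>t. - (1 / (z - complex_of_real t) ^ 2) \<partial>M)"
  define y where "y = Im z"
  have y: "0 < y" using z by (simp add: y_def)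
  have intD: "integrable M (\<lambda>t. - (1 / (z - complex_of_real t) ^ 2))"
  proof (rule integrable_const_bound[of _ "(1 / y)\<^sup>2"])
    show "AE t in M. norm (- (1 / (z - complex_of_real t) ^ 2)) \<le> (1 / y)\<^sup>2"
    proof (rule AE_I2)
      fix t
      have "norm (- (1 / (z - complex_of_real t) ^ 2)) = norm (1 / (z - complex_of_real t)) ^ 2"
        by (simp add: norm_divide norm_power power_divide)
      also have "\<dots> \<le> (1 / y)\<^sup>2"
        using norm_resolvent_le[OF z] by (intro power_mono) (auto simp: y_def)
      finally show "norm (- (1 / (z - complex_of_real t) ^ 2)) \<le> (1 / y)\<^sup>2" .
    qed
  qed measurable
  have bound: "norm ((cauchy_transform M w - cauchy_transform M z) / (w - z) - D) \<le> norm (w - z) * (2 / y ^ 3)"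
    if w: "norm (w - z) < y / 2" "w \<noteq> z" for w
  proof -
    have Imw: "y / 2 < Im w"
      using abs_Im_le_cmod[of "w - z"] w by (simp add: y_def)
    then have w0: "0 < Im w" using y by simp
    have "(cauchy_transform M w - cauchy_transform M z) / (w - z) - D =
       (\<integral>t. (1 / (w - complex_of_real t) - 1 / (z - complex_of_real t)) / (w - z)
          - (- (1 / (z - complex_of_real t) ^ 2)) \<partial>M)"
      unfolding cauchy_transform_def D_def
      using resolvent_integrable[OF w0] resolvent_integrable[OF z] intD by simp
    also have "norm \<dots> \<le> (\<integral>t. norm (w - z) * (2 / y ^ 3) \<partial>M)"
    proof (rule Bochner_Integration.integral_norm_bound_integral)
      fix t
      have nz: "w - complex_of_real t \<noteq> 0" "z - complex_of_real t \<noteq> 0"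
        using upper_minus_real_nz w0 z by auto
      have wz: "w - z \<noteq> 0" using w by simp
      have alg: "(1 / a - 1 / b) / (a - b) - (- (1 / b ^ 2)) = (a - b) * (1 / a) * (1 / b)\<^sup>2"
        if "a \<noteq> 0" "b \<noteq> 0" "a - b \<noteq> 0" for a b :: complex
        using that by (simp add: divide_simps) (simp add: algebra_simps power2_eq_square power3_eq_cube)
      have "(1 / (w - complex_of_real t) - 1 / (z - complex_of_real t)) / (w - z)
          - (- (1 / (z - complex_of_real t) ^ 2)) =
          (w - z) * (1 / (w - complex_of_real t)) * (1 / (z - complex_of_real t))\<^sup>2"
        using alg[OF nz] wz by simp
      also have "norm \<dots> = norm (w - z) * norm (1 / (w - complex_of_real t)) * norm (1 / (z - complex_of_real t)) ^ 2"
        by (simp only: norm_mult norm_power)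
      also have "\<dots> \<le> norm (w - z) * (2 / y) * (1 / y)\<^sup>2"
      proof (intro mult_mono power_mono)
        have "1 / Im w \<le> 2 / y" using Imw y w0 by (simp add: divide_simps)
        then show "norm (1 / (w - complex_of_real t)) \<le> 2 / y"
          using norm_resolvent_le[OF w0, of t] by linarith
      qed (use norm_resolvent_le[OF z] y in \<open>auto simp: y_def\<close>)
      also have "\<dots> = norm (w - z) * (2 / y ^ 3)"
        by (simp add: power2_eq_square power3_eq_cube)
      finally show "norm ((1 / (w - complex_of_real t) - 1 / (z - complex_of_real t)) / (w - z)
          - (- (1 / (z - complex_of_real t) ^ 2))) \<le> norm (w - z) * (2 / y ^ 3)" .
    qed (use resolvent_integrable[OF w0] resolvent_integrable[OF z] intD in auto)
    finally show ?thesis by (simp add: prob_space)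
  qed
  have "((\<lambda>w. (cauchy_transform M w - cauchy_transform M z) / (w - z) - D) \<longlongrightarrow> 0) (at z)"
  proof (rule Lim_null_comparison)
    show "\<forall>\<^sub>F w in at z. norm ((cauchy_transform M w - cauchy_transform M z) / (w - z) - D)
        \<le> norm (w - z) * (2 / y ^ 3)"
      unfolding eventually_at using bound y
      by (intro exI[of _ "y / 2"]) (auto simp: dist_norm)
    have "((\<lambda>w. norm (w - z) * (2 / y ^ 3)) \<longlongrightarrow> norm (z - z) * (2 / y ^ 3)) (at z)"
      by (intro tendsto_intros)
    then show "((\<lambda>w. norm (w - z) * (2 / y ^ 3)) \<longlongrightarrow> 0) (at z)" by simp
  qed
  then have "((\<lambda>w. (cauchy_transform M w - cauchy_transform M z) / (w - z)) \<longlongrightarrow> D) (at z)"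
    by (simp add: LIM_zero_iff)
  then show ?thesis
    by (simp add: has_field_derivative_iff D_def)
qed

lemma cauchy_holomorphic: "cauchy_transform M holomorphic_on upper"
  unfolding holomorphic_on_def upper_def
  using cauchy_has_derivative field_differentiable_at_within field_differentiable_def by blast

lemma K_holomorphic: "K_transform M holomorphic_on upper"
  unfolding K_transform_def[abs_def]
  by (intro holomorphic_intros cauchy_holomorphic) (auto simp: upper_def cauchy_nz)

text \<open>Cauchy-Schwarz, in the form of a nonnegative variance, bounds \<open>|G|^2\<close> by
  the integral of the squared resolvent, which is exactly \<open>- Im G / Im z\<close>. Rearranged,
  this is \<open>Im z \<le> Im (1 / G)\<close>.\<close>

lemma Im_K_le:
  assumes z: "0 < Im z"
  shows "Im (K_transform M z) \<le> 0"
proof -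
  define G where "G = cauchy_transform M z"
  let ?f = "\<lambda>t. Im z / ((Re z - t)\<^sup>2 + (Im z)\<^sup>2)"
  have G0: "G \<noteq> 0" using cauchy_nz[OF z] by (simp add: G_def)
  have r2: "norm (1 / (z - complex_of_real t)) ^ 2 = ?f t / Im z" for t
    using z by (simp add: norm_divide power_divide cmod_power2)
  have int2: "integrable M (\<lambda>t. norm (1 / (z - complex_of_real t)) ^ 2)"
    unfolding r2 by (intro integrable_divide Im_cauchy(2)[OF z])
  have "norm G \<le> (\<integral>t. norm (1 / (z - complex_of_real t)) \<partial>M)"
    unfolding G_def cauchy_transform_def by (rule integral_norm_bound)
  then have "norm G ^ 2 \<le> (\<integral>t. norm (1 / (z - complex_of_real t)) \<partial>M) ^ 2"
    by (intro power_mono) auto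
  also have "\<dots> \<le> (\<integral>t. norm (1 / (z - complex_of_real t)) ^ 2 \<partial>M)"
  proof -
    have "0 \<le> variance (\<lambda>t. norm (1 / (z - complex_of_real t)))" by simp
    then show ?thesis
      using variance_eq[of "\<lambda>t. norm (1 / (z - complex_of_real t))"] int2 resolvent_integrable[OF z]
      by simp
  qed
  also have "\<dots> = - Im G / Im z"
    unfolding r2 G_def Im_cauchy(1)[OF z] minus_minus by (rule integral_divide_zero)
  finally have "norm G ^ 2 * Im z \<le> - Im G"
    using z by (simp add: divide_simps)
  then have "Im z \<le> - Im G / norm G ^ 2"
    using G0 by (simp add: divide_simps mult.commute)
  also have "\<dots> = Im (1 / G)"
    by (simp add: Im_divide cmod_power2)
  finally show ?thesis by (simp add: K_transform_def G_def)
qed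

end

section \<open>Weak convergence, tightness and the size of K near the imaginary axis\<close>

lemma weak_conv_cauchy:
  assumes "\<And>n. real_distribution (X n)" "real_distribution L" "weak_conv_m X L" "0 < Im z"
  shows "(\<lambda>n. cauchy_transform (X n) z) \<longlonglongrightarrow> cauchy_transform L z"
  unfolding cauchy_transform_def
proof (rule weak_conv_imp_integral_bdd_continuous_conv[where B = "1 / Im z"])
  show "isCont (\<lambda>t. 1 / (z - complex_of_real t)) x" for x
    using upper_minus_real_nz[OF assms(4)] by (intro continuous_intros) auto
qed (use assms norm_resolvent_le in auto)

lemma weak_conv_K:
  assumes "\<And>n. real_distribution (X n)" "real_distribution L" "weak_conv_m X L" "0 < Im z"
  shows "(\<lambda>n. K_transform (X n) z) \<longlonglongrightarrow> K_transform L z"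
  unfolding K_transform_def
  by (intro tendsto_intros weak_conv_cauchy assms real_distribution.cauchy_nz)

text \<open>The ball of radius \<open>y / 2\<close> about \<open>\<i>y\<close> replaces the usual Stolz angle.\<close>

lemma norm_ratio_le:
  fixes y t :: real
  assumes "0 < y" "norm (w - \<i> * complex_of_real y) \<le> y / 2"
  shows "norm (complex_of_real t / (w - complex_of_real t)) \<le> 4"
    and "norm (complex_of_real t / (w - complex_of_real t)) \<le> 2 * \<bar>t\<bar> / y"
    and "y / 2 \<le> Im w" and "norm w \<le> 3 / 2 * y"
proof -
  show Im: "y / 2 \<le> Im w"
    using abs_Im_le_cmod[of "w - \<i> * complex_of_real y"] assms by simp
  show nw: "norm w \<le> 3 / 2 * y"
    using norm_triangle_ineq[of "w - \<i> * complex_of_real y" "\<i> * complex_of_real y"] assms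
    by (simp add: norm_mult)
  have d: "y / 2 \<le> norm (w - complex_of_real t)"
    using Im abs_Im_le_cmod[of "w - complex_of_real t"] by simp
  have dpos: "0 < norm (w - complex_of_real t)" using d assms(1) by linarith
  have "\<bar>t\<bar> = norm (w - (w - complex_of_real t))" by simp
  also have "\<dots> \<le> norm w + norm (w - complex_of_real t)" by (rule norm_triangle_ineq4)
  \<comment> \<open>The distance is at least \<open>y / 2\<close>, so \<open>3 / 2 * y\<close> is at
    most three times the distance.\<close>
  also have "\<dots> \<le> 4 * norm (w - complex_of_real t)" using nw d by linarith
  finally show "norm (complex_of_real t / (w - complex_of_real t)) \<le> 4"
    using dpos by (simp add: norm_divide divide_simps)
  have "\<bar>t\<bar> / norm (w - complex_of_real t) \<le> \<bar>t\<bar> / (y / 2)"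
    using d assms(1) by (intro divide_left_mono mult_pos_pos dpos) auto
  then show "norm (complex_of_real t / (w - complex_of_real t)) \<le> 2 * \<bar>t\<bar> / y"
    by (simp add: norm_divide mult.commute)
qed

text \<open>\<open>K = w (w G - 1) / (w G)\<close>, and \<open>w G - 1\<close> is the integral of
  \<open>t / (w - t)\<close>. The part \<open>|t| \<le> T\<close> contributes at most
  \<open>2 T / y \<le> \<eta> / 2\<close>, the tail at most \<open>4 * \<eta> / 8\<close>;
  \<open>\<eta> \<le> 1/2\<close> then gives \<open>|w G| \<ge> 1/2\<close>, and
  \<open>3/2 * 2\<close> is the final factor 3. The measure enters only through its tail, so the
  bound is uniform over tight families.\<close>

lemma (in real_distribution) K_small:
  assumes \<eta>: "0 < \<eta>" "\<eta> \<le> 1 / 2" and T: "0 \<le> T" and tail: "measure M {t. T < \<bar>t\<bar>} \<le> \<eta> / 8"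
    and y: "0 < y" "4 * T / \<eta> \<le> y" and w: "norm (w - \<i> * complex_of_real y) \<le> y / 2"
  shows "norm (K_transform M w) \<le> 3 * \<eta> * y"
proof -
  note r = norm_ratio_le[OF y(1) w]
  have w0: "0 < Im w" using r(3) y by linarith
  define G where "G = cauchy_transform M w"
  have G0: "G \<noteq> 0" using cauchy_nz[OF w0] by (simp add: G_def)
  have S[measurable]: "{t. T < \<bar>t\<bar>} \<in> sets M" by (auto simp: M_is_borel)
  have eq: "w * G - 1 = (\<integral>t. complex_of_real t / (w - complex_of_real t) \<partial>M)"
  proof -
    have "w * G - 1 = (\<integral>t. w * (1 / (w - complex_of_real t)) - 1 \<partial>M)"
      using resolvent_integrable[OF w0]
      by (simp add: G_def cauchy_transform_def del: times_divide_eq_right)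
    also have "\<dots> = (\<integral>t. complex_of_real t / (w - complex_of_real t) \<partial>M)"
      using upper_minus_real_nz[OF w0]
      by (intro Bochner_Integration.integral_cong) (auto simp: divide_simps)
    finally show ?thesis .
  qed
  have "norm (w * G - 1) \<le> (\<integral>t. 2 * T / y + 4 * indicator {t. T < \<bar>t\<bar>} t \<partial>M)"
    unfolding eq
  proof (rule Bochner_Integration.integral_norm_bound_integral)
    show "integrable M (\<lambda>t. complex_of_real t / (w - complex_of_real t))"
      by (rule integrable_const_bound[of _ 4]) (use r(1) in auto)
    fix t
    show "norm (complex_of_real t / (w - complex_of_real t)) \<le> 2 * T / y + 4 * indicator {t. T < \<bar>t\<bar>} t"
    proof (cases "T < \<bar>t\<bar>")
      case True
      have "0 \<le> 2 * T / y" using T y by simp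
      then show ?thesis using r(1)[of t] True by simp
    next
      case False
      then have "2 * \<bar>t\<bar> / y \<le> 2 * T / y" using y by (intro divide_right_mono) auto
      then show ?thesis using r(2)[of t] False by simp
    qed
  next
    show "integrable M (\<lambda>t. 2 * T / y + 4 * indicator {t. T < \<bar>t\<bar>} t)"
      by (intro Bochner_Integration.integrable_add integrable_const integrable_mult_right
          integrable_real_indicator S) (simp add: emeasure_eq_measure)
  qed
  also have "\<dots> = 2 * T / y + 4 * measure M {t. T < \<bar>t\<bar>}"
    using S by (simp add: emeasure_eq_measure)
  also have "2 * T / y \<le> \<eta> / 2"
    using y \<eta> by (simp add: divide_simps mult.commute)
  finally have d: "norm (w * G - 1) \<le> \<eta>" using tail by linarith
  have "1 - norm (w * G - 1) \<le> norm (w * G)"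
    using norm_triangle_ineq4[of "w * G" "w * G - 1"] by simp
  then have half: "1 / 2 \<le> norm (w * G)" using d \<eta> by linarith
  have w_nz: "w \<noteq> 0" using w0 by auto
  have "w * ((w * G - 1) / (w * G)) = (w * G - 1) / G" using w_nz by simp
  also have "\<dots> = K_transform M w"
    using G0 by (simp add: K_transform_def G_def[symmetric] diff_divide_distrib)
  finally have "K_transform M w = w * ((w * G - 1) / (w * G))" ..
  then have "norm (K_transform M w) = norm w * (norm (w * G - 1) / norm (w * G))"
    by (simp add: norm_mult norm_divide)
  also have "\<dots> \<le> (3 / 2 * y) * (\<eta> / (1 / 2))"
    using r(4) d half \<eta> y by (intro mult_mono frac_le) auto
  finally show ?thesis by simp
qed

text \<open>\<open>1 + y Im G(\<i> y)\<close> is the integral of \<open>t^2 / (t^2 + y^2)\<close>,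
  and this integrand is at least 1/2 where \<open>|t| \<ge> y\<close>.\<close>

lemma (in real_distribution) tail_le_Im_cauchy:
  assumes y: "0 < y"
  shows "measure M {t. y \<le> \<bar>t\<bar>} \<le> 2 * (1 + y * Im (cauchy_transform M (\<i> * complex_of_real y)))"
proof -
  define z where "z = \<i> * complex_of_real y"
  have z: "Im z = y" "Re z = 0" "0 < Im z"
    using y by (auto simp: z_def)
  have S[measurable]: "{t. y \<le> \<bar>t\<bar>} \<in> sets M" by (auto simp: M_is_borel)
  let ?f = "\<lambda>t. y / ((0 - t)\<^sup>2 + y\<^sup>2)"
  have int: "integrable M ?f" using Im_cauchy(2)[OF z(3)] by (simp add: z)
  have "(\<integral>t. 1 / 2 * indicator {t. y \<le> \<bar>t\<bar>} t \<partial>M) \<le> (\<integral>t. 1 - y * ?f t \<partial>M)"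
  proof (rule integral_mono)
    show "1 / 2 * indicator {t. y \<le> \<bar>t\<bar>} t \<le> 1 - y * ?f t" for t
    proof -
      have pos: "0 < t\<^sup>2 + y\<^sup>2" using y by (simp add: add_nonneg_pos)
      have eq: "1 - y * ?f t = t\<^sup>2 / (t\<^sup>2 + y\<^sup>2)"
      proof -
        have "1 - y * ?f t = (t\<^sup>2 + y\<^sup>2) / (t\<^sup>2 + y\<^sup>2) - y\<^sup>2 / (t\<^sup>2 + y\<^sup>2)"
          using pos by (simp del: div_self add: divide_self[of "t\<^sup>2 + y\<^sup>2"] power2_eq_square[of y])
        then show ?thesis by (simp only: diff_divide_distrib[symmetric]) simp
      qed
      show ?thesis
      proof (cases "y \<le> \<bar>t\<bar>")
        case True
        then have "y\<^sup>2 \<le> t\<^sup>2" using y by (simp add: abs_le_square_iff[symmetric])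
        then show ?thesis using True pos unfolding eq by (simp add: divide_simps)
      qed (use eq in simp)
    qed
    show "integrable M (\<lambda>t. 1 / 2 * (indicator {t. y \<le> \<bar>t\<bar>} t :: real))"
      by (intro integrable_mult_right integrable_real_indicator S) (simp add: emeasure_eq_measure)
    show "integrable M (\<lambda>t. 1 - y * ?f t)"
      by (intro Bochner_Integration.integrable_diff integrable_const integrable_mult_right int)
  qed
  also have "\<dots> = 1 + y * Im (cauchy_transform M z)"
    using int Im_cauchy(1)[OF z(3)] by (simp add: z del: times_divide_eq_right)
  finally show ?thesis by (simp add: z_def)
qed

text \<open>With \<open>q = k / z\<close> the quantity is the real part of
  \<open>- q / (1 - q)\<close>, and \<open>|1 - q| \<ge> 1/2\<close>. Here \<open>k\<close> is a
  bare number, so the estimate also serves for a function not yet known to be a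
  \<open>K\<close>-transform.\<close>

lemma one_plus_Im_resolvent_le:
  assumes y: "0 < y" and k: "norm k \<le> \<delta> * y" and \<delta>: "\<delta> \<le> 1 / 2"
  shows "\<bar>1 + y * Im (1 / (\<i> * complex_of_real y - k))\<bar> \<le> 2 * \<delta>"
proof -
  define z where "z = \<i> * complex_of_real y"
  define q where "q = k / z"
  have z: "norm z = y" "z \<noteq> 0"
    using y by (auto simp: z_def norm_mult)
  have q: "norm q \<le> \<delta>"
    using k y by (simp add: q_def norm_divide z divide_simps)
  have q1: "1 / 2 \<le> norm (1 - q)"
    using norm_triangle_ineq2[of 1 q] q \<delta> by simp
  then have q0: "1 - q \<noteq> 0" by auto
  have "z - k = z * (1 - q)" using z by (simp add: q_def algebra_simps)
  then have zG: "z * (1 / (z - k)) = 1 / (1 - q)"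
    using z by simp
  have "1 - z * (1 / (z - k)) = - q / (1 - q)" unfolding zG using q0 by (simp add: divide_simps)
  then have "norm (1 - z * (1 / (z - k))) = norm q / norm (1 - q)"
    by (simp only: norm_divide norm_minus_cancel)
  also have "\<dots> \<le> \<delta> / (1 / 2)" using q q1 order_trans[OF norm_ge_zero q] by (intro frac_le) auto
  finally have "\<bar>Re (1 - z * (1 / (z - k)))\<bar> \<le> \<delta> / (1 / 2)"
    by (rule order_trans[OF abs_Re_le_cmod])
  moreover have "\<delta> / (1 / 2) = 2 * \<delta>" by simp
  moreover have "Re (1 - z * w) = 1 + y * Im w" for w by (simp add: z_def)
  ultimately show ?thesis by (simp only: z_def)
qed

lemma (in real_distribution) tail_le_K:
  assumes y: "0 < y" and K: "norm (K_transform M (\<i> * complex_of_real y)) \<le> \<delta> * y" and \<delta>: "\<delta> \<le> 1 / 2"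
  shows "measure M {t. y \<le> \<bar>t\<bar>} \<le> 4 * \<delta>"
  using tail_le_Im_cauchy[OF y] one_plus_Im_resolvent_le[OF y K \<delta>] y
  by (simp add: cauchy_eq_K)

lemma tight_if_tails:
  assumes X: "\<And>n. real_distribution (X n)"
    and tails: "\<And>\<epsilon>. 0 < \<epsilon> \<Longrightarrow> \<exists>T>0. \<forall>n. measure (X n) {t. T \<le> \<bar>t\<bar>} \<le> \<epsilon>"
  shows "tight X"
  unfolding tight_def
proof (intro conjI allI impI X)
  fix \<epsilon> :: real assume "0 < \<epsilon>"
  \<comment> \<open>Half of \<epsilon> leaves room for the strict inequality in
    \<open>tight\<close>.\<close>
  then obtain T where T: "0 < T" "\<And>n. measure (X n) {t. T \<le> \<bar>t\<bar>} \<le> \<epsilon> / 2"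
    using tails[of "\<epsilon> / 2"] by auto
  show "\<exists>a b. a < b \<and> (\<forall>n. 1 - \<epsilon> < measure (X n) {a<..b})"
  proof (rule exI[of _ "- T"], rule exI[of _ T], intro conjI allI)
    fix n
    interpret X: real_distribution "X n" by (rule X)
    have S: "{t. T \<le> \<bar>t\<bar>} \<in> sets (X n)" by (auto simp: X.M_is_borel)
    have "1 - \<epsilon> / 2 \<le> 1 - measure (X n) {t. T \<le> \<bar>t\<bar>}" using T(2) by simp
    also have "\<dots> = measure (X n) (space (X n) - {t. T \<le> \<bar>t\<bar>})"
      using X.prob_compl[OF S] by simp
    also have "\<dots> \<le> measure (X n) {- T<..T}"
      by (rule X.finite_measure_mono) (auto simp: X.M_is_borel)
    finally show "1 - \<epsilon> < measure (X n) {- T<..T}" using \<open>0 < \<epsilon>\<close> by linarith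
  qed (use T in simp)
qed

lemma weak_conv_tail:
  assumes X: "\<And>n. real_distribution (X n)" and L: "real_distribution L" and conv: "weak_conv_m X L"
    and e: "0 < e"
  shows "\<exists>T\<ge>0. \<forall>\<^sub>F n in sequentially. measure (X n) {t. T < \<bar>t\<bar>} \<le> e"
proof -
  interpret L: real_distribution L by fact
  have S[measurable]: "{t. c < \<bar>t\<bar>} \<in> sets borel" for c :: real by simp
  have "(\<lambda>n. measure L {t. real n < \<bar>t\<bar>}) \<longlonglongrightarrow> measure L (\<Inter>n. {t. real n < \<bar>t\<bar>})"
    by (rule L.finite_Lim_measure_decseq) (auto simp: decseq_def L.M_is_borel)
  moreover have "(\<Inter>n. {t. real n < \<bar>t\<bar>}) = {}"
  proof (rule equals0I)
    fix x assume x: "x \<in> (\<Inter>n. {t. real n < \<bar>t\<bar>})"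
    obtain n where "\<bar>x\<bar> < real n" using reals_Archimedean2 by auto
    moreover have "real n < \<bar>x\<bar>" using x by blast
    ultimately show False by simp
  qed
  ultimately have "(\<lambda>n. measure L {t. real n < \<bar>t\<bar>}) \<longlonglongrightarrow> 0" by simp
  then have "\<forall>\<^sub>F n in sequentially. measure L {t. real n < \<bar>t\<bar>} < e"
    using e by (rule order_tendstoD(2))
  then obtain N where N: "measure L {t. real N < \<bar>t\<bar>} < e"
    by (auto simp: eventually_sequentially)
  \<comment> \<open>A continuous function between the indicators of \<open>|t| > N + 1\<close> and
    \<open>|t| > N\<close>: weak convergence controls only such test functions, at the price of one
    unit in the threshold.\<close>
  define f where "f t = min 1 (max 0 (\<bar>t\<bar> - real N))" for t :: real
  have cont: "isCont f t" for t unfolding f_def by (intro continuous_intros)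
  have f01: "0 \<le> f t" "f t \<le> 1" for t by (auto simp: f_def)
  have fm[measurable]: "f \<in> borel_measurable borel" unfolding f_def by measurable
  have int: "integrable M f" if "real_distribution M" for M
  proof -
    interpret M: real_distribution M by fact
    show ?thesis by (rule M.integrable_const_bound[of _ 1]) (use f01 in auto)
  qed
  have ind: "integrable M (\<lambda>t. indicator {t. c < \<bar>t\<bar>} t :: real)" if "real_distribution M" for M c
  proof -
    interpret M: real_distribution M by fact
    show ?thesis by (rule M.integrable_const_bound[of _ 1]) (auto simp: indicator_def)
  qed
  have "(\<lambda>n. integral\<^sup>L (X n) f) \<longlonglongrightarrow> integral\<^sup>L L f"
    by (rule weak_conv_imp_integral_bdd_continuous_conv[where B = 1]) (use assms cont f01 in auto)
  moreover have "integral\<^sup>L L f < e"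
  proof -
    have "integral\<^sup>L L f \<le> (\<integral>t. indicator {t. real N < \<bar>t\<bar>} t \<partial>L)"
      by (rule integral_mono[OF int[OF L] ind[OF L]]) (auto simp: f_def indicator_def)
    then show ?thesis using N by (simp add: L.M_is_borel)
  qed
  ultimately have ev: "\<forall>\<^sub>F n in sequentially. integral\<^sup>L (X n) f < e"
    by (rule order_tendstoD(2))
  show ?thesis
  proof (intro exI[of _ "real N + 1"] conjI)
    show "\<forall>\<^sub>F n in sequentially. measure (X n) {t. real N + 1 < \<bar>t\<bar>} \<le> e"
      using ev
    proof eventually_elim
      case (elim n)
      interpret X: real_distribution "X n" by (rule X)
      have "measure (X n) {t. real N + 1 < \<bar>t\<bar>} = (\<integral>t. indicator {t. real N + 1 < \<bar>t\<bar>} t \<partial>X n)"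
        by (simp add: X.M_is_borel)
      also have "\<dots> \<le> integral\<^sup>L (X n) f"
        by (rule integral_mono[OF ind[OF X] int[OF X]]) (auto simp: f_def indicator_def)
      finally show ?case using elim by simp
    qed
  qed auto
qed

lemma weak_conv_K_small:
  assumes X: "\<And>n. real_distribution (X n)" and L: "real_distribution L" and conv: "weak_conv_m X L"
    and \<delta>: "0 < \<delta>"
  shows "\<exists>R>0. \<forall>\<^sub>F n in sequentially. \<forall>y\<ge>R. \<forall>w. norm (w - \<i> * complex_of_real y) \<le> y / 2 \<longrightarrow>
           norm (K_transform (X n) w) \<le> \<delta> * y"
proof -
  define \<eta> where "\<eta> = min (1 / 2) (\<delta> / 3)"
  have \<eta>: "0 < \<eta>" "\<eta> \<le> 1 / 2" "3 * \<eta> \<le> \<delta>" using \<delta> by (auto simp: \<eta>_def)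
  obtain T where T: "0 \<le> T" and ev: "\<forall>\<^sub>F n in sequentially. measure (X n) {t. T < \<bar>t\<bar>} \<le> \<eta> / 8"
    using weak_conv_tail[OF X L conv, of "\<eta> / 8"] \<eta> by auto
  show ?thesis
  proof (intro exI[of _ "max 1 (4 * T / \<eta>)"] conjI)
    show "\<forall>\<^sub>F n in sequentially. \<forall>y\<ge>max 1 (4 * T / \<eta>). \<forall>w. norm (w - \<i> * complex_of_real y) \<le> y / 2 \<longrightarrow>
           norm (K_transform (X n) w) \<le> \<delta> * y"
    proof (rule eventually_mono[OF ev], intro allI impI)
      fix n y w
      assume tail: "measure (X n) {t. T < \<bar>t\<bar>} \<le> \<eta> / 8" and "max 1 (4 * T / \<eta>) \<le> y"
        and w: "norm (w - \<i> * complex_of_real y) \<le> y / 2"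
      then have y: "0 < y" "4 * T / \<eta> \<le> y" by auto
      have "norm (K_transform (X n) w) \<le> 3 * \<eta> * y"
        using real_distribution.K_small[OF X \<eta>(1,2) T tail y w] .
      also have "\<dots> \<le> \<delta> * y" using \<eta>(3) y by (intro mult_right_mono) auto
      finally show "norm (K_transform (X n) w) \<le> \<delta> * y" .
    qed
  qed auto
qed

lemma (in real_distribution) K_small_ex:
  assumes "0 < \<delta>"
  shows "\<exists>R>0. \<forall>y\<ge>R. \<forall>w. norm (w - \<i> * complex_of_real y) \<le> y / 2 \<longrightarrow> norm (K_transform M w) \<le> \<delta> * y"
proof -
  have "real_distribution M" by unfold_locales
  moreover have "weak_conv_m (\<lambda>_. M) M"
    by (simp add: weak_conv_m_def weak_conv_def)
  ultimately show ?thesis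
    using weak_conv_K_small[of "\<lambda>_. M" M \<delta>] assms by simp
qed

section \<open>Stieltjes inversion\<close>

lemma has_real_derivative_arctan_affine:
  assumes "0 < (y::real)"
  shows "((\<lambda>x. arctan ((x - t) / y)) has_real_derivative (y / ((x - t)\<^sup>2 + y\<^sup>2))) (at x)"
proof -
  have "((\<lambda>x. arctan ((x - t) / y)) has_real_derivative (1 / y) * inverse (1 + ((x - t) / y)\<^sup>2)) (at x)"
    using assms by (auto intro!: derivative_eq_intros simp: divide_simps)
  moreover have "(1 / y) * inverse (1 + ((x - t) / y)\<^sup>2) = y / ((x - t)\<^sup>2 + y\<^sup>2)"
  proof -
    have "0 < (x - t)\<^sup>2 + y\<^sup>2" "0 < y\<^sup>2 + (x - t)\<^sup>2" using assms by (simp_all add: add_nonneg_pos add_pos_nonneg)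
    then show ?thesis using assms by (simp add: divide_simps power2_eq_square)
  qed
  ultimately show ?thesis by simp
qed

text \<open>\<open>- Im G\<close> at height \<open>y\<close> is the integral of the Poisson kernel,
  whose primitive in \<open>x\<close> is an arctangent. The kernel is nonnegative, so the order of
  integration may be exchanged in the extended reals without checking integrability.\<close>

lemma (in real_distribution) Stieltjes_Fubini:
  assumes "a \<le> b" and y: "0 < y"
  shows "(\<integral>\<^sup>+x. ennreal (- Im (cauchy_transform M (Complex x y))) * indicator {a..b} x \<partial>lborel)
       = ennreal (\<integral>t. arctan ((b - t) / y) - arctan ((a - t) / y) \<partial>M)"
proof -
  let ?k = "\<lambda>x t. y / ((x - t)\<^sup>2 + y\<^sup>2)"
  have k0: "0 \<le> ?k x t" for x t using y by simp
  have mono: "arctan ((a - t) / y) \<le> arctan ((b - t) / y)" for t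
    using assms by (auto intro!: arctan_monotone' divide_right_mono)
  interpret pair_sigma_finite M lborel
    by (intro pair_sigma_finite.intro sigma_finite_measure_axioms lborel.sigma_finite_measure_axioms)
  have "(\<integral>\<^sup>+x. ennreal (- Im (cauchy_transform M (Complex x y))) * indicator {a..b} x \<partial>lborel)
      = (\<integral>\<^sup>+x. (\<integral>\<^sup>+t. ennreal (?k x t) * indicator {a..b} x \<partial>M) \<partial>lborel)"
  proof (rule nn_integral_cong)
    fix x
    have "ennreal (- Im (cauchy_transform M (Complex x y))) = (\<integral>\<^sup>+t. ennreal (?k x t) \<partial>M)"
      using Im_cauchy[of "Complex x y"] y k0 by (simp add: nn_integral_eq_integral)
    then show "ennreal (- Im (cauchy_transform M (Complex x y))) * indicator {a..b} x
      = (\<integral>\<^sup>+t. ennreal (?k x t) * indicator {a..b} x \<partial>M)"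
      by (simp add: nn_integral_multc)
  qed
  also have "\<dots> = (\<integral>\<^sup>+t. (\<integral>\<^sup>+x. ennreal (?k x t) * indicator {a..b} x \<partial>lborel) \<partial>M)"
    by (rule Fubini') measurable
  also have "\<dots> = (\<integral>\<^sup>+t. ennreal (arctan ((b - t) / y) - arctan ((a - t) / y)) \<partial>M)"
    by (intro nn_integral_cong nn_integral_FTC_Icc)
      (use assms k0 has_real_derivative_arctan_affine in \<open>auto simp: has_real_derivative_iff_has_vector_derivative[symmetric] intro: has_field_derivative_at_within\<close>)
  also have "\<dots> = ennreal (\<integral>t. arctan ((b - t) / y) - arctan ((a - t) / y) \<partial>M)"
  proof (rule nn_integral_eq_integral)
    show "integrable M (\<lambda>t. arctan ((b - t) / y) - arctan ((a - t) / y))"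
    proof (rule integrable_const_bound[of _ pi])
      show "AE t in M. norm (arctan ((b - t) / y) - arctan ((a - t) / y)) \<le> pi"
      proof (rule AE_I2)
        fix t
        show "norm (arctan ((b - t) / y) - arctan ((a - t) / y)) \<le> pi"
          using arctan_bounded[of "(b - t) / y"] arctan_bounded[of "(a - t) / y"]
          by (simp add: abs_le_iff)
      qed
    qed measurable
  qed (use mono in auto)
  finally show ?thesis .
qed

text \<open>Shifting the end points by \<open>s\<close> while smoothing at the finer scale \<open>s\<^sup>2\<close> gives a half-open interval in
  the limit, so that atoms at the end points need no attention.\<close>

lemma arctan_tendsto_indicator:
  fixes a b t :: real
  assumes "a \<le> b"
  defines "s \<equiv> \<lambda>n. inverse (real (Suc n))"
  shows "(\<lambda>n. arctan ((b + s n - t) / (s n)\<^sup>2) - arctan ((a + s n - t) / (s n)\<^sup>2))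
           \<longlonglongrightarrow> pi * indicator {a<..b} t"
proof -
  have s: "0 < s n" for n by (simp add: s_def)
  have s0: "s \<longlonglongrightarrow> 0" unfolding s_def by (rule LIMSEQ_inverse_real_of_nat)
  have inv: "filterlim (\<lambda>n. 1 / s n) at_top sequentially"
    using filterlim_compose[OF filterlim_real_sequentially filterlim_Suc]
    by (simp add: s_def inverse_eq_divide)
  have inv2: "filterlim (\<lambda>n. 1 / (s n)\<^sup>2) at_top sequentially"
    using filterlim_at_top_mult_at_top[OF inv inv] by (simp add: power2_eq_square)
  have *: "(\<lambda>n. arctan ((c + s n - t) / (s n)\<^sup>2)) \<longlonglongrightarrow> (if t \<le> c then pi / 2 else - (pi / 2))" for c
  proof (cases "t \<le> c")
    case True
    have "filterlim (\<lambda>n. (c + s n - t) / (s n)\<^sup>2) at_top sequentially"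
    proof (rule filterlim_at_top_mono[OF inv], intro always_eventually allI)
      fix n
      have "s n / (s n)\<^sup>2 \<le> (c + s n - t) / (s n)\<^sup>2"
        using True s[of n] by (intro divide_right_mono) auto
      then show "1 / s n \<le> (c + s n - t) / (s n)\<^sup>2" using s[of n] by (simp add: power2_eq_square)
    qed
    then have "(\<lambda>n. arctan ((c + s n - t) / (s n)\<^sup>2)) \<longlonglongrightarrow> pi / 2"
      by (rule filterlim_compose[OF tendsto_arctan_at_top])
    then show ?thesis using True by simp
  next
    case False
    have "(\<lambda>n. c + s n - t) \<longlonglongrightarrow> c + 0 - t" by (intro tendsto_intros s0)
    then have "filterlim (\<lambda>n. (c + s n - t) * (1 / (s n)\<^sup>2)) at_bot sequentially"
      using False by (intro filterlim_tendsto_neg_mult_at_bot[OF _ _ inv2]) auto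
    then have "(\<lambda>n. arctan ((c + s n - t) * (1 / (s n)\<^sup>2))) \<longlonglongrightarrow> - (pi / 2)"
      by (rule filterlim_compose[OF tendsto_arctan_at_bot])
    then show ?thesis using False by simp
  qed
  have "(\<lambda>n. arctan ((b + s n - t) / (s n)\<^sup>2) - arctan ((a + s n - t) / (s n)\<^sup>2)) \<longlonglongrightarrow>
     (if t \<le> b then pi / 2 else - (pi / 2)) - (if t \<le> a then pi / 2 else - (pi / 2))"
    by (intro tendsto_diff *)
  moreover have "(if t \<le> b then pi / 2 else - (pi / 2)) - (if t \<le> a then pi / 2 else - (pi / 2))
      = pi * indicator {a<..b} t" using assms(1) by (auto simp: indicator_def)
  ultimately show ?thesis by simp
qed

text \<open>The smoothed interval masses depend only on \<open>Im G\<close>; dominated convergence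
  with bound \<open>pi\<close> recovers the masses of half-open intervals. Sending the left end
  point to minus infinity gives equal distribution functions.\<close>

lemma cauchy_transform_unique:
  assumes M: "real_distribution M" and N: "real_distribution N"
    and eq: "\<And>z. 0 < Im z \<Longrightarrow> cauchy_transform M z = cauchy_transform N z"
  shows "M = N"
proof -
  interpret M: real_distribution M by fact
  interpret N: real_distribution N by fact
  define s where "s n = inverse (real (Suc n))" for n
  have s: "0 < s n" for n by (simp add: s_def)
  define f where "f a b n t = arctan ((b + s n - t) / (s n)\<^sup>2) - arctan ((a + s n - t) / (s n)\<^sup>2)" for a b n t
  have fm[measurable]: "f a b n \<in> borel_measurable borel" for a b n unfolding f_def by measurable
  have lim: "(\<lambda>n. integral\<^sup>L Q (f a b n)) \<longlonglongrightarrow> pi * measure Q {a<..b}"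
    if "a \<le> b" "real_distribution Q" for a b Q
  proof -
    interpret Q: real_distribution Q by fact
    have "(\<lambda>n. integral\<^sup>L Q (f a b n)) \<longlonglongrightarrow> (\<integral>t. pi * indicator {a<..b} t \<partial>Q)"
    proof (rule integral_dominated_convergence[where w = "\<lambda>_. pi"])
      show "AE t in Q. (\<lambda>n. f a b n t) \<longlonglongrightarrow> pi * indicator {a<..b} t"
        unfolding f_def s_def using arctan_tendsto_indicator[OF that(1)] by simp
      show "AE t in Q. norm (f a b n t) \<le> pi" for n
      proof (rule AE_I2)
        fix t
        show "norm (f a b n t) \<le> pi"
          using arctan_bounded[of "(b + s n - t) / (s n)\<^sup>2"] arctan_bounded[of "(a + s n - t) / (s n)\<^sup>2"]
          by (simp add: abs_le_iff f_def)
      qed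
    qed auto
    then show ?thesis by simp
  qed
  have same: "integral\<^sup>L M (f a b n) = integral\<^sup>L N (f a b n)" if "a \<le> b" for a b n
  proof -
    have nn: "0 \<le> integral\<^sup>L Q (f a b n)" for Q
      unfolding f_def using that s
      by (intro integral_nonneg_AE AE_I2) (auto intro!: arctan_monotone' divide_right_mono)
    have y: "0 < (s n)\<^sup>2" using s[of n] by simp
    have "ennreal (integral\<^sup>L M (f a b n)) = ennreal (integral\<^sup>L N (f a b n))"
      unfolding f_def
      using M.Stieltjes_Fubini[of "a + s n" "b + s n" "(s n)\<^sup>2"] N.Stieltjes_Fubini[of "a + s n" "b + s n" "(s n)\<^sup>2"]
        that y eq by simp
    then show ?thesis using nn by simp
  qed
  have meas: "measure M {a<..b} = measure N {a<..b}" if "a \<le> b" for a b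
  proof -
    have "pi * measure M {a<..b} = pi * measure N {a<..b}"
      using LIMSEQ_unique[OF lim[OF that M]] lim[OF that N] same[OF that] by simp
    then show ?thesis by simp
  qed
  have "cdf M b = cdf N b" for b
  proof -
    have lm: "(\<lambda>n. cdf Q b - cdf Q (- real n)) \<longlonglongrightarrow> cdf Q b - 0" if "real_distribution Q" for Q
    proof -
      interpret Q: real_distribution Q by fact
      show ?thesis by (intro tendsto_intros Q.cdf_lim_neg_infty)
    qed
    have ev: "\<forall>\<^sub>F n in sequentially. cdf M b - cdf M (- real n) = cdf N b - cdf N (- real n)"
    proof -
      have "\<forall>\<^sub>F n in sequentially. - b < real n"
        using filterlim_real_sequentially by (rule filterlim_at_top_dense[THEN iffD1, rule_format])
      then show ?thesis
      proof eventually_elim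
        case (elim n)
        then have "- real n < b" by simp
        then show ?case using M.cdf_diff_eq N.cdf_diff_eq meas by simp
      qed
    qed
    have "(\<lambda>n. cdf N b - cdf N (- real n)) \<longlonglongrightarrow> cdf M b - 0"
      using tendsto_cong[OF ev] lm[OF M] by blast
    then show ?thesis using LIMSEQ_unique lm[OF N] by fastforce
  qed
  then show ?thesis using cdf_unique[OF M N] by auto
qed

lemma K_transform_unique:
  assumes M: "real_distribution M" and N: "real_distribution N"
    and eq: "\<And>z. 0 < Im z \<Longrightarrow> K_transform M z = K_transform N z"
  shows "M = N"
  using real_distribution.cauchy_eq_K[OF M] real_distribution.cauchy_eq_K[OF N] eq
  by (intro cauchy_transform_unique[OF M N]) simp

text \<open>Identity theorem: a ray accumulates at its own end point. Starting it at
  \<open>|R| + 1\<close> keeps that point in the upper half plane for every real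
  \<open>R\<close>.\<close>

lemma K_transform_unique_imaginary_axis:
  assumes M: "real_distribution M" and N: "real_distribution N"
    and eq: "\<And>y. R \<le> y \<Longrightarrow> K_transform M (\<i> * complex_of_real y) = K_transform N (\<i> * complex_of_real y)"
  shows "M = N"
proof (rule K_transform_unique[OF M N])
  fix z assume z: "0 < Im z"
  define c where "c = \<i> * complex_of_real (\<bar>R\<bar> + 1)"
  let ?U = "(\<lambda>y. \<i> * complex_of_real y) ` {\<bar>R\<bar> + 1..}"
  have "K_transform M z - K_transform N z = 0"
  proof (rule analytic_continuation[where S = upper and U = ?U and \<xi> = c and f = "\<lambda>z. K_transform M z - K_transform N z"])
    show "(\<lambda>z. K_transform M z - K_transform N z) holomorphic_on upper"
      by (intro holomorphic_intros real_distribution.K_holomorphic M N)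
    show "connected upper" by (rule convex_connected[OF convex_upper])
    show "c islimpt ?U"
      unfolding islimpt_approachable
    proof (intro allI impI)
      fix e :: real assume e: "0 < e"
      define p where "p = \<i> * complex_of_real (\<bar>R\<bar> + 1 + e / 2)"
      have "p - c = \<i> * complex_of_real (e / 2)"
        by (simp add: p_def c_def algebra_simps)
      then have d: "dist p c = e / 2"
        unfolding dist_norm using e by (simp only: norm_mult norm_of_real norm_ii mult_1 abs_of_pos half_gt_zero)
      have "p \<in> ?U" unfolding p_def using e by (intro imageI) simp
      then show "\<exists>x'\<in>?U. x' \<noteq> c \<and> dist x' c < e"
        by (rule bexI[rotated]) (use d e in auto)
    qed
    show "K_transform M w - K_transform N w = 0" if "w \<in> ?U" for w
      using that eq by auto
  qed (use z open_upper in \<open>auto simp: upper_def c_def\<close>)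
  then show "K_transform M z = K_transform N z" by simp
qed

section \<open>Nevanlinna representation\<close>

lemma has_integral_Poisson_kernel:
  assumes y: "0 < (y::real)"
  shows "has_bochner_integral lborel (\<lambda>x. y / ((a - x)\<^sup>2 + y\<^sup>2)) pi"
proof -
  have "has_bochner_integral lborel (\<lambda>x::real. inverse (1 + x\<^sup>2)) pi"
    using integrable_inverse_1_plus_square LBINT_inverse_1_plus_square
    by (simp add: has_bochner_integral_iff set_integrable_def interval_lebesgue_integral_def
        set_lebesgue_integral_def einterval_eq)
  then have "has_bochner_integral lborel (\<lambda>x. inverse (1 + (- a / y + 1 / y * x)\<^sup>2)) (pi /\<^sub>R \<bar>1 / y\<bar>)"
    using y by (subst (asm) lborel_has_bochner_integral_real_affine_iff[of "1 / y" _ _ "- a / y"]) simp_all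
  then have "has_bochner_integral lborel (\<lambda>x. 1 / y * inverse (1 + (- a / y + 1 / y * x)\<^sup>2)) (1 / y * (pi /\<^sub>R \<bar>1 / y\<bar>))"
    by (rule has_bochner_integral_mult_right)
  moreover have "1 / y * inverse (1 + (- a / y + 1 / y * x)\<^sup>2) = y / ((a - x)\<^sup>2 + y\<^sup>2)" for x
  proof -
    have "- a / y + 1 / y * x = (x - a) / y" by (simp add: diff_divide_distrib)
    moreover have "1 + ((x - a) / y)\<^sup>2 = ((a - x)\<^sup>2 + y\<^sup>2) / y\<^sup>2"
      using y by (simp add: add_divide_distrib power_divide power2_commute)
    ultimately show ?thesis using y by (simp add: power2_eq_square)
  qed
  ultimately show ?thesis using y by simp
qed

text \<open>Dividing by \<open>w - cnj z\<close> makes the integrand decay quadratically, so that the arcs of the half discs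
  contribute nothing in the limit; subtracting \<open>g z\<close> removes the pole at \<open>z\<close>.\<close>

lemma Poisson_half_plane:
  assumes c: "0 < c" and holg: "g holomorphic_on {w. - c < Im w}"
    and B: "\<And>w. 0 \<le> Im w \<Longrightarrow> norm (g w) \<le> B" and z: "0 < Im z"
  shows "has_bochner_integral lborel
    (\<lambda>x. (Im z / ((Re z - x)\<^sup>2 + (Im z)\<^sup>2)) *\<^sub>R g (complex_of_real x)) (pi *\<^sub>R g z)"
proof -
  \<comment> \<open>The depth \<open>min c (Im z)\<close> keeps the half plane inside the domain of
    \<open>g\<close> and leaves \<open>cnj z\<close>, the remaining pole, outside.\<close>
  define S where "S = {w. - min c (Im z) < Im w}"
  define q where "q w = (if w = z then deriv g z else (g w - g z) / (w - z))" for w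
  define f where "f w = q w / (w - cnj z)" for w
  have S: "open S" "convex S"
    unfolding S_def by (auto intro: open_halfspace_Im_gt convex_halfspace_Im_gt)
  have B0: "0 \<le> B" using B[OF less_imp_le[OF z]] norm_ge_zero order_trans by blast
  have "g holomorphic_on S" using holg by (rule holomorphic_on_subset) (auto simp: S_def)
  then have "q holomorphic_on S"
    unfolding q_def using S(1) by (rule pole_lemma_open)
  moreover have "w - cnj z \<noteq> 0" if "w \<in> S" for w
    using that by (auto simp: S_def complex_eq_iff)
  ultimately have holf: "f holomorphic_on S"
    unfolding f_def by (intro holomorphic_intros)
  have fle: "norm (f w) \<le> 2 * B / (norm w - norm z)\<^sup>2" if "0 \<le> Im w" "norm z < norm w" for w
  proof -
    have wz: "w \<noteq> z" using that by auto
    have n1: "norm w - norm z \<le> norm (w - z)" by (rule norm_triangle_ineq2)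
    have n2: "norm w - norm z \<le> norm (w - cnj z)" using norm_triangle_ineq2[of w "cnj z"] by simp
    have "norm (f w) = norm (g w - g z) / (norm (w - z) * norm (w - cnj z))"
      using wz by (simp add: f_def q_def norm_divide norm_mult)
    also have "\<dots> \<le> 2 * B / ((norm w - norm z) * (norm w - norm z))"
    proof (rule frac_le)
      show "norm (g w - g z) \<le> 2 * B"
        using norm_triangle_ineq4[of "g w" "g z"] B[OF that(1)] B[of z] z by simp
      show "(norm w - norm z) * (norm w - norm z) \<le> norm (w - z) * norm (w - cnj z)"
        using n1 n2 that by (intro mult_mono) auto
    qed (use that B0 in auto)
    finally show ?thesis by (simp add: power2_eq_square)
  qed
  define h where "h x = f (complex_of_real x)" for x
  have real_bound: "norm (integral {- R..R} h) \<le> 2 * B / (R - norm z)\<^sup>2 * R * pi" if R: "norm z < R" for R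
  proof -
    have R0: "0 < R" using R norm_ge_zero[of z] by linarith
    let ?\<gamma> = "linepath (- complex_of_real R) (complex_of_real R)"
    let ?\<alpha> = "part_circlepath 0 R 0 pi"
    have line_sub: "path_image ?\<gamma> \<subseteq> S"
      using R0 c z by (auto simp: S_def closed_segment_def min_def)
    have arc_pt: "0 \<le> Im w \<and> norm w = R" if "w \<in> path_image ?\<alpha>" for w
      using that R0
      by (auto simp: path_image_part_circlepath' closed_segment_eq_real_ivl norm_mult sin_ge_zero)
    have arc_sub: "path_image ?\<alpha> \<subseteq> S"
      using arc_pt c z by (fastforce simp: S_def min_def)
    have "(f has_contour_integral 0) (?\<gamma> +++ ?\<alpha>)"
      using line_sub arc_sub
      by (intro Cauchy_theorem_convex_simple[OF holf S(2)] valid_path_join)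
        (auto simp: exp_Euler path_image_join)
    moreover have fl: "f contour_integrable_on ?\<gamma>"
      using holf line_sub S(2)
      by (intro contour_integrable_continuous_linepath holomorphic_on_imp_continuous_on)
        (auto intro: holomorphic_on_subset)
    moreover have fa: "f contour_integrable_on ?\<alpha>"
      using holf arc_sub
      by (intro contour_integrable_continuous_part_circlepath holomorphic_on_imp_continuous_on)
        (auto intro: holomorphic_on_subset)
    ultimately have sum0: "contour_integral ?\<gamma> f + contour_integral ?\<alpha> f = 0"
      by (metis contour_integral_join contour_integral_unique valid_path_linepath valid_path_part_circlepath)
    have arc: "norm (contour_integral ?\<alpha> f) \<le> 2 * B / (R - norm z)\<^sup>2 * R * (pi - 0)"
    proof (rule has_contour_integral_bound_part_circlepath[OF has_contour_integral_integral[OF fa]])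
      show "norm (f w) \<le> 2 * B / (R - norm z)\<^sup>2" if "w \<in> path_image ?\<alpha>" for w
        using fle[of w] arc_pt[OF that] R by simp
    qed (use B0 R0 in auto)
    have "contour_integral ?\<gamma> f = integral {- R..R} h"
      unfolding h_def using R0 by (subst contour_integral_linepath_Reals_eq) auto
    then show "norm (integral {- R..R} h) \<le> 2 * B / (R - norm z)\<^sup>2 * R * pi"
      using sum0 arc by (simp add: add_eq_0_iff2 norm_minus_commute)
  qed
  let ?P = "\<lambda>x. Im z / ((Re z - x)\<^sup>2 + (Im z)\<^sup>2)"
  have den: "(complex_of_real x - z) * (complex_of_real x - cnj z) = complex_of_real ((Re z - x)\<^sup>2 + (Im z)\<^sup>2)" for x
    by (simp add: complex_eq_iff power2_eq_square algebra_simps)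
  have xz: "complex_of_real x \<noteq> z" for x using z by (auto simp: complex_eq_iff)
  have h_eq: "h x = (?P x / Im z) *\<^sub>R (g (complex_of_real x) - g z)" for x
  proof -
    have "h x = (g (complex_of_real x) - g z) / ((complex_of_real x - z) * (complex_of_real x - cnj z))"
      by (simp add: h_def f_def q_def xz)
    also have "\<dots> = (g (complex_of_real x) - g z) / complex_of_real ((Re z - x)\<^sup>2 + (Im z)\<^sup>2)"
      by (simp only: den)
    finally show ?thesis using z by (simp add: scaleR_conv_of_real)
  qed
  note P = has_integral_Poisson_kernel[OF z, of "Re z"]
  have P0: "0 \<le> ?P x" for x using z by simp
  have hcont: "continuous_on UNIV h"
    unfolding h_def
    by (rule continuous_on_compose2[OF holomorphic_on_imp_continuous_on[OF holf]])
      (use c z in \<open>auto simp: S_def intro!: continuous_intros\<close>)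
  have hm[measurable]: "h \<in> borel_measurable borel"
    using hcont by (rule borel_measurable_continuous_onI)
  have hbound: "norm (h x) \<le> ?P x * (2 * B / Im z)" for x
  proof -
    have "norm (g (complex_of_real x) - g z) \<le> 2 * B"
      using norm_triangle_ineq4[of "g (complex_of_real x)" "g z"] B[of "complex_of_real x"] B[of z] z by simp
    then have "?P x / Im z * norm (g (complex_of_real x) - g z) \<le> ?P x / Im z * (2 * B)"
      using P0[of x] z by (intro mult_left_mono) auto
    then show ?thesis unfolding h_eq norm_scaleR using P0[of x] z by simp
  qed
  have Pint: "integrable lborel (\<lambda>x. ?P x * (2 * B / Im z))"
    using P by (intro integrable_mult_left) (auto simp: has_bochner_integral_iff)
  have hint: "integrable lborel h"
    by (rule Bochner_Integration.integrable_bound[OF Pint]) (simp, intro AE_I2 order_trans[OF hbound], simp only: real_norm_def abs_ge_self)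
  have lim1: "(\<lambda>n. integral\<^sup>L lborel (\<lambda>x. indicator {- real n..real n} x *\<^sub>R h x)) \<longlonglongrightarrow> integral\<^sup>L lborel h"
  proof (rule integral_dominated_convergence[OF _ _ integrable_norm[OF hint]])
    show "AE x in lborel. (\<lambda>n. indicator {- real n..real n} x *\<^sub>R h x) \<longlonglongrightarrow> h x"
    proof (rule AE_I2)
      fix x :: real
      have "\<forall>\<^sub>F n in sequentially. \<bar>x\<bar> \<le> real n"
        using filterlim_real_sequentially by (simp add: filterlim_at_top)
      then have "\<forall>\<^sub>F n in sequentially. indicator {- real n..real n} x *\<^sub>R h x = h x"
        by eventually_elim (auto simp: indicator_def)
      then show "(\<lambda>n. indicator {- real n..real n} x *\<^sub>R h x) \<longlonglongrightarrow> h x"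
        by (rule tendsto_eventually)
    qed
  qed (auto simp: indicator_def)
  have eq: "integral\<^sup>L lborel (\<lambda>x. indicator {- real n..real n} x *\<^sub>R h x) = integral {- real n..real n} h" for n
  proof -
    have "set_integrable lborel {- real n..real n} h"
      unfolding set_integrable_def using hint by (intro integrable_mult_indicator) auto
    from set_borel_integral_eq_integral(2)[OF this] show ?thesis
      by (simp add: set_lebesgue_integral_def)
  qed
  have lim2: "(\<lambda>n. integral {- real n..real n} h) \<longlonglongrightarrow> 0"
  proof (rule Lim_null_comparison)
    have "\<forall>\<^sub>F n in sequentially. norm z < real n"
      using filterlim_real_sequentially by (simp add: filterlim_at_top_dense)
    then show "\<forall>\<^sub>F n in sequentially. norm (integral {- real n..real n} h) \<le> 2 * B / (real n - norm z)\<^sup>2 * real n * pi"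
      by eventually_elim (rule real_bound)
    show "(\<lambda>n. 2 * B / (real n - norm z)\<^sup>2 * real n * pi) \<longlonglongrightarrow> 0"
      by real_asymp
  qed
  have h0: "integral\<^sup>L lborel h = 0"
    using LIMSEQ_unique[OF lim1] lim2 unfolding eq by blast
  \<comment> \<open>\<open>h\<close> is the Poisson kernel over \<open>Im z\<close> times
    \<open>g x - g z\<close> and integrates to 0. Adding back \<open>g z\<close> times the kernel,
    whose mass is \<open>pi\<close>, gives the formula.\<close>
  have "has_bochner_integral lborel (\<lambda>x. Im z *\<^sub>R h x + ?P x *\<^sub>R g z) (Im z *\<^sub>R 0 + pi *\<^sub>R g z)"
    using hint h0 P
    by (intro has_bochner_integral_add has_bochner_integral_scaleR_right has_bochner_integral_scaleR_left)
      (auto simp: has_bochner_integral_iff)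
  moreover have "Im z *\<^sub>R h x + ?P x *\<^sub>R g z = ?P x *\<^sub>R g (complex_of_real x)" for x
    unfolding h_eq using z by (simp add: scaleR_diff_right)
  ultimately show ?thesis by simp
qed

text \<open>Open mapping theorem: the image of a nonconstant function would contain a disc about
  \<open>f \<i>\<close>, hence a point off the real line.\<close>

lemma Im_zero_imp_constant:
  assumes "f holomorphic_on upper" and Im: "\<And>z. z \<in> upper \<Longrightarrow> Im (f z) = 0"
  shows "\<exists>c. \<forall>z\<in>upper. f z = c"
proof (rule ccontr)
  assume "\<not> ?thesis"
  then have "\<not> f constant_on upper" by (simp add: constant_on_def)
  then have op: "open (f ` upper)"
    using assms(1) open_upper convex_connected[OF convex_upper]
    by (intro open_mapping_thm[of f upper]) auto
  have i: "\<i> \<in> upper" by (simp add: upper_def)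
  then obtain e where e: "0 < e" "ball (f \<i>) e \<subseteq> f ` upper"
    using op by (meson image_eqI open_contains_ball)
  have "f \<i> + \<i> * complex_of_real (e / 2) \<in> ball (f \<i>) e"
    using e(1) by (simp add: dist_norm norm_mult)
  then obtain w where "w \<in> upper" "f w = f \<i> + \<i> * complex_of_real (e / 2)"
    using e(2) by (metis imageE subsetD)
  then show False using Im[of w] Im[OF i] e(1) by simp
qed

text \<open>The candidate Cauchy transform is \<open>G = 1 / (z - K z)\<close>. Its translates
  \<open>G (z + \<i> e)\<close> have imaginary parts that are Poisson integrals of probability
  densities; these are tight, and a weak limit has a Cauchy transform with the same imaginary part
  as \<open>G\<close>. The difference is a constant, which vanishes because both functions decay up
  the axis.\<close>

theorem K_transform_exists:
  assumes hol: "K holomorphic_on upper"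
    and Im: "\<And>z. 0 < Im z \<Longrightarrow> Im (K z) \<le> 0"
    and small: "\<And>\<delta>. 0 < \<delta> \<Longrightarrow> \<exists>R. \<forall>y\<ge>R. norm (K (\<i> * complex_of_real y)) \<le> \<delta> * y"
  shows "\<exists>M. real_distribution M \<and> (\<forall>z. 0 < Im z \<longrightarrow> K_transform M z = K z)"
proof -
  define G where "G z = 1 / (z - K z)" for z
  have ImF: "Im z \<le> Im (z - K z)" if "0 < Im z" for z using Im[OF that] by simp
  have F0: "z - K z \<noteq> 0" if "0 < Im z" for z using ImF[OF that] that by auto
  have holG: "G holomorphic_on upper"
    unfolding G_def using F0 by (intro holomorphic_intros hol) (auto simp: upper_def)
  have normG: "norm (G z) \<le> 1 / Im z" if "0 < Im z" for z
  proof -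
    have "Im z \<le> norm (z - K z)"
      using ImF[OF that] abs_Im_le_cmod[of "z - K z"] by linarith
    then show ?thesis using that F0[OF that] by (simp add: G_def norm_divide divide_simps)
  qed
  have ImG: "Im (G z) \<le> 0" if "0 < Im z" for z
    using ImF[OF that] that unfolding G_def by (simp add: Im_divide divide_nonpos_nonneg)
  \<comment> \<open>The growth condition on \<open>K\<close> in the form used below:
    \<open>y Im G(\<i> y)\<close> tends to -1. This normalises the total mass and, being uniform
    under bounded shifts of \<open>y\<close>, gives tightness.\<close>
  have axis: "\<exists>R. \<forall>y\<ge>R. \<bar>1 + y * Im (G (\<i> * complex_of_real y))\<bar> \<le> \<delta>" if "0 < \<delta>" for \<delta>
  proof -
    define \<delta>' where "\<delta>' = min (1 / 2) (\<delta> / 2)"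
    have d: "0 < \<delta>'" "\<delta>' \<le> 1 / 2" "2 * \<delta>' \<le> \<delta>" using that by (auto simp: \<delta>'_def)
    obtain R where R: "\<And>y. R \<le> y \<Longrightarrow> norm (K (\<i> * complex_of_real y)) \<le> \<delta>' * y"
      using small[OF d(1)] by auto
    show ?thesis
    proof (intro exI[of _ "max 1 R"] allI impI)
      fix y assume y: "max 1 R \<le> y"
      then show "\<bar>1 + y * Im (G (\<i> * complex_of_real y))\<bar> \<le> \<delta>"
        using one_plus_Im_resolvent_le[OF _ R d(2), of y] d(3) unfolding G_def by simp
    qed
  qed
  \<comment> \<open>\<open>G\<close> need not extend to the real line. Raised by \<open>e n\<close>
    it is holomorphic across the line and bounded by \<open>1 / e n\<close> on the closed half
    plane, as the Poisson formula requires.\<close>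
  define e where "e n = inverse (real (Suc n))" for n
  have e: "0 < e n" "e n \<le> 1" for n by (auto simp: e_def divide_simps)
  have e0: "e \<longlonglongrightarrow> 0" unfolding e_def by (rule LIMSEQ_inverse_real_of_nat)
  define g where "g n w = G (w + \<i> * complex_of_real (e n))" for n w
  define d where "d n x = - Im (g n (complex_of_real x)) / pi" for n x
  define m where "m n = density lborel (\<lambda>x. ennreal (d n x))" for n
  have d0: "0 \<le> d n x" for n x
    using ImG[of "complex_of_real x + \<i> * complex_of_real (e n)"] e[of n] by (simp add: d_def g_def divide_nonpos_pos)
  have holg: "g n holomorphic_on {w. - e n < Im w}" for n
    unfolding g_def
    by (rule holomorphic_on_compose_gen[OF _ holG, unfolded o_def])
      (auto simp: upper_def intro!: holomorphic_intros)
  have gbound: "norm (g n w) \<le> 1 / e n" if "0 \<le> Im w" for n w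
  proof -
    have "norm (g n w) \<le> 1 / (Im w + e n)"
      using normG[of "w + \<i> * complex_of_real (e n)"] that e[of n] by (simp add: g_def)
    also have "\<dots> \<le> 1 / e n" using that e[of n] by (intro divide_left_mono) (auto intro!: mult_pos_pos)
    finally show ?thesis .
  qed
  have gcont: "continuous_on UNIV (\<lambda>x. g n (complex_of_real x))" for n
    by (rule continuous_on_compose2[OF holomorphic_on_imp_continuous_on[OF holg[of n]]])
      (use e[of n] in \<open>auto intro!: continuous_intros\<close>)
  have dm[measurable]: "d n \<in> borel_measurable borel" for n
    unfolding d_def
    by (intro borel_measurable_continuous_onI continuous_intros gcont) simp
  have Poisson: "has_bochner_integral lborel (\<lambda>x. d n x * (Im z / ((Re z - x)\<^sup>2 + (Im z)\<^sup>2))) (- Im (g n z))"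
    if "0 < Im z" for n z
  proof -
    have "has_bochner_integral lborel
        (\<lambda>x. Im ((Im z / ((Re z - x)\<^sup>2 + (Im z)\<^sup>2)) *\<^sub>R g n (complex_of_real x))) (Im (pi *\<^sub>R g n z))"
      by (intro has_bochner_integral_Im Poisson_half_plane[OF e(1) holg gbound that])
    then have "has_bochner_integral lborel
        (\<lambda>x. Im ((Im z / ((Re z - x)\<^sup>2 + (Im z)\<^sup>2)) *\<^sub>R g n (complex_of_real x)) * (- 1 / pi)) (Im (pi *\<^sub>R g n z) * (- 1 / pi))"
      by (rule has_bochner_integral_mult_left)
    then show ?thesis by (simp add: d_def mult.commute)
  qed
  have mass: "(\<integral>\<^sup>+x. ennreal (d n x) \<partial>lborel) = 1" for n
  proof -
    \<comment> \<open>\<open>d n\<close> times \<open>y^2 / (x^2 + y^2)\<close> with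
      \<open>y = i + 1\<close>, that is, \<open>y\<close> times the Poisson integrand at
      \<open>\<i> y\<close>. It increases to \<open>d n\<close> and its integral is known, so
      monotone convergence yields the mass.\<close>
    define k where "k i x = d n x * ((real (Suc i))\<^sup>2 / (x\<^sup>2 + (real (Suc i))\<^sup>2))" for i x
    have k_eq: "k i x = real (Suc i) * (d n x * (Im (\<i> * complex_of_real (real (Suc i))) /
        ((Re (\<i> * complex_of_real (real (Suc i))) - x)\<^sup>2 + (Im (\<i> * complex_of_real (real (Suc i))))\<^sup>2)))" for i x
      by (simp add: k_def power2_eq_square)
    have int_k: "has_bochner_integral lborel (k i) (real (Suc i) * (- Im (g n (\<i> * complex_of_real (real (Suc i))))))" for i
      unfolding k_eq[abs_def] by (intro has_bochner_integral_mult_right Poisson) simp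
    have k0: "0 \<le> k i x" for i x using d0 by (simp add: k_def)
    have val: "(\<integral>\<^sup>+x. ennreal (k i x) \<partial>lborel) = ennreal (real (Suc i) * (- Im (g n (\<i> * complex_of_real (real (Suc i))))))" for i
      using int_k[of i] k0 by (simp add: nn_integral_eq_integral has_bochner_integral_iff)
    have "(\<lambda>i. \<integral>\<^sup>+x. ennreal (k i x) \<partial>lborel) \<longlonglongrightarrow> (\<integral>\<^sup>+x. ennreal (d n x) \<partial>lborel)"
    proof (rule nn_integral_LIMSEQ)
      have km: "k i \<in> borel_measurable borel" for i unfolding k_def by measurable
      then show "(\<lambda>x. ennreal (k i x)) \<in> borel_measurable lborel" for i by simp
      show "incseq (\<lambda>i x. ennreal (k i x))"
      proof (intro incseq_SucI le_funI ennreal_leI)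
        fix i x
        have "x\<^sup>2 * (real (Suc i))\<^sup>2 \<le> x\<^sup>2 * (real (Suc (Suc i)))\<^sup>2"
          by (intro mult_left_mono power_mono) auto
        moreover have "0 < x\<^sup>2 + (real (Suc i))\<^sup>2" "0 < x\<^sup>2 + (real (Suc (Suc i)))\<^sup>2"
          by (simp_all add: add_nonneg_pos del: of_nat_Suc)
        ultimately have "(real (Suc i))\<^sup>2 / (x\<^sup>2 + (real (Suc i))\<^sup>2) \<le> (real (Suc (Suc i)))\<^sup>2 / (x\<^sup>2 + (real (Suc (Suc i)))\<^sup>2)"
          by (simp add: frac_le_eq divide_le_0_iff algebra_simps del: of_nat_Suc)
        then show "k i x \<le> k (Suc i) x"
          unfolding k_def by (rule mult_left_mono[OF _ d0])
      qed
      fix x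
      have "(\<lambda>i. (real (Suc i))\<^sup>2 / (x\<^sup>2 + (real (Suc i))\<^sup>2)) \<longlonglongrightarrow> 1" by real_asymp
      then have "(\<lambda>i. d n x * ((real (Suc i))\<^sup>2 / (x\<^sup>2 + (real (Suc i))\<^sup>2))) \<longlonglongrightarrow> d n x * 1"
        by (intro tendsto_intros)
      then show "(\<lambda>i. ennreal (k i x)) \<longlonglongrightarrow> ennreal (d n x)"
        by (intro tendsto_ennrealI) (simp add: k_def)
    qed
    moreover have "(\<lambda>i. real (Suc i) * (- Im (g n (\<i> * complex_of_real (real (Suc i)))))) \<longlonglongrightarrow> 1"
    proof -
      have "((\<lambda>y. - (y * Im (G (\<i> * complex_of_real y)))) \<longlongrightarrow> 1) at_top"
      proof (rule tendstoI)
        fix \<epsilon> :: real assume "0 < \<epsilon>"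
        then obtain R where R: "\<And>y. R \<le> y \<Longrightarrow> \<bar>1 + y * Im (G (\<i> * complex_of_real y))\<bar> \<le> \<epsilon> / 2"
          using axis[of "\<epsilon> / 2"] by auto
        have "\<forall>\<^sub>F y in at_top. R \<le> y" by (rule eventually_ge_at_top)
        then show "\<forall>\<^sub>F y in at_top. dist (- (y * Im (G (\<i> * complex_of_real y)))) 1 < \<epsilon>"
        proof eventually_elim
          case (elim y)
          show ?case using R[OF elim] \<open>0 < \<epsilon>\<close> unfolding dist_real_def by linarith
        qed
      qed
      moreover have "filterlim (\<lambda>i. real (Suc i) + e n) at_top sequentially"
        by real_asymp
      ultimately have "(\<lambda>i. - ((real (Suc i) + e n) * Im (G (\<i> * complex_of_real (real (Suc i) + e n))))) \<longlonglongrightarrow> 1"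
        by (rule filterlim_compose)
      \<comment> \<open>The normalisation is known at height \<open>y + e n\<close>, whereas the
        kernel carries the factor \<open>y\<close>; their quotient tends to 1.\<close>
      moreover have "(\<lambda>i. real (Suc i) / (real (Suc i) + e n)) \<longlonglongrightarrow> 1" by real_asymp
      ultimately have "(\<lambda>i. real (Suc i) / (real (Suc i) + e n) * (- ((real (Suc i) + e n) * Im (G (\<i> * complex_of_real (real (Suc i) + e n)))))) \<longlonglongrightarrow> 1 * 1"
        by (intro tendsto_mult)
      moreover have "real (Suc i) / (real (Suc i) + e n) * (- ((real (Suc i) + e n) * Im (G (\<i> * complex_of_real (real (Suc i) + e n)))))
          = real (Suc i) * (- Im (g n (\<i> * complex_of_real (real (Suc i)))))" for i
      proof -
        have "real (Suc i) + e n \<noteq> 0" using e(1)[of n] by (simp add: add_nonneg_eq_0_iff del: of_nat_Suc)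
        then show ?thesis by (simp add: g_def distrib_left)
      qed
      ultimately show ?thesis by simp
    qed
    then have "(\<lambda>i. \<integral>\<^sup>+x. ennreal (k i x) \<partial>lborel) \<longlonglongrightarrow> ennreal 1"
      unfolding val by (rule tendsto_ennrealI)
    ultimately show ?thesis using LIMSEQ_unique by fastforce
  qed
  have rd: "real_distribution (m n)" for n
  proof -
    have "prob_space (m n)"
      by (rule prob_spaceI) (simp add: m_def emeasure_density mass)
    then show ?thesis
      by (simp add: real_distribution_def real_distribution_axioms_def m_def)
  qed
  have Im_m: "Im (cauchy_transform (m n) z) = Im (g n z)" if "0 < Im z" for n z
  proof -
    have "(\<integral>x. Im z / ((Re z - x)\<^sup>2 + (Im z)\<^sup>2) \<partial>m n) = (\<integral>x. d n x *\<^sub>R (Im z / ((Re z - x)\<^sup>2 + (Im z)\<^sup>2)) \<partial>lborel)"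
      unfolding m_def by (rule integral_density) (auto simp: d0)
    also have "\<dots> = - Im (g n z)"
      using Poisson[OF that, of n] by (simp add: has_bochner_integral_iff)
    finally show ?thesis using real_distribution.Im_cauchy(1)[OF rd that] by simp
  qed
  have "tight m"
  proof (rule tight_if_tails[OF rd])
    fix \<epsilon> :: real assume \<epsilon>: "0 < \<epsilon>"
    define \<delta> where "\<delta> = min 1 (\<epsilon> / 4)"
    have \<delta>: "0 < \<delta>" "\<delta> \<le> 1" "4 * \<delta> \<le> \<epsilon>" using \<epsilon> by (auto simp: \<delta>_def)
    obtain R where R: "\<And>y. R \<le> y \<Longrightarrow> \<bar>1 + y * Im (G (\<i> * complex_of_real y))\<bar> \<le> \<delta>"
      using axis[OF \<delta>(1)] by auto
    \<comment> \<open>\<open>y \<ge> 1 / \<delta>\<close> makes every shift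
      \<open>e n \<le> 1\<close> at most \<open>\<delta> y\<close>, so that passing from
      \<open>y + e n\<close> to \<open>y\<close> costs a factor at least
      \<open>1 - \<delta>\<close>, for all \<open>n\<close> at once.\<close>
    define y where "y = max R (1 / \<delta>)"
    have y: "R \<le> y" "1 / \<delta> \<le> y" "0 < y" using \<delta> by (auto simp: y_def less_max_iff_disj)
    show "\<exists>T>0. \<forall>n. measure (m n) {t. T \<le> \<bar>t\<bar>} \<le> \<epsilon>"
    proof (intro exI[of _ y] conjI allI y(3))
      fix n
      interpret m: real_distribution "m n" by (rule rd)
      define b where "b = - ((y + e n) * Im (G (\<i> * complex_of_real (y + e n))))"
      have b: "1 - \<delta> \<le> b"
        using R[of "y + e n"] y e(1)[of n] by (auto simp: b_def)
      have q: "1 - \<delta> \<le> y / (y + e n)"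
      proof -
        have "1 \<le> \<delta> * y" using y(2) \<delta> by (simp add: divide_simps mult.commute)
        moreover have "0 \<le> \<delta> * e n" using \<delta> e[of n] by simp
        ultimately have "e n \<le> \<delta> * (y + e n)" using e(2)[of n] unfolding distrib_left by linarith
        then show ?thesis using y(3) e(1)[of n] by (simp add: divide_simps algebra_simps)
      qed
      have "g n (\<i> * complex_of_real y) = G (\<i> * complex_of_real (y + e n))"
        by (simp add: g_def distrib_left)
      then have "y * Im (cauchy_transform (m n) (\<i> * complex_of_real y)) = - (y / (y + e n) * b)"
        using y(3) e(1)[of n] by (simp add: Im_m b_def)
      moreover have "(1 - \<delta>) * (1 - \<delta>) \<le> y / (y + e n) * b"
        using b q \<delta> y(3) e(1)[of n] by (intro mult_mono) auto
      moreover have "1 - 2 * \<delta> \<le> (1 - \<delta>) * (1 - \<delta>)" by (simp add: algebra_simps)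
      moreover have "2 * (1 + A) \<le> 4 * \<delta>" if "A = - Q" "P \<le> Q" "1 - 2 * \<delta> \<le> P" for A P Q :: real
        using that by argo
      ultimately have "2 * (1 + y * Im (cauchy_transform (m n) (\<i> * complex_of_real y))) \<le> 4 * \<delta>"
        by blast
      then show "measure (m n) {t. y \<le> \<bar>t\<bar>} \<le> \<epsilon>"
        using m.tail_le_Im_cauchy[OF y(3)] \<delta>(3) by linarith
    qed
  qed
  then obtain r M where r: "strict_mono (r :: nat \<Rightarrow> nat)" and M: "real_distribution M"
    and conv: "weak_conv_m (m \<circ> id \<circ> r) M"
    using tight_imp_convergent_subsubsequence[of m id] by (auto simp: strict_mono_id)
  interpret M: real_distribution M by fact
  have Im_eq: "Im (cauchy_transform M z) = Im (G z)" if z: "0 < Im z" for z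
  proof -
    have "(\<lambda>k. Im (cauchy_transform ((m \<circ> id \<circ> r) k) z)) \<longlonglongrightarrow> Im (cauchy_transform M z)"
      by (intro tendsto_Im weak_conv_cauchy[OF _ M conv z]) (simp add: rd)
    moreover have "(\<lambda>k. Im (G (z + \<i> * complex_of_real (e (r k))))) \<longlonglongrightarrow> Im (G z)"
    proof (intro tendsto_Im)
      have "(\<lambda>k. z + \<i> * complex_of_real (e (r k))) \<longlonglongrightarrow> z + \<i> * complex_of_real 0"
        using LIMSEQ_subseq_LIMSEQ[OF e0 r] by (intro tendsto_intros) (simp add: o_def)
      moreover have "isCont G z"
        using holomorphic_on_imp_continuous_on[OF holG] z continuous_on_eq_continuous_at[OF open_upper]
        by (auto simp: upper_def)
      ultimately show "(\<lambda>k. G (z + \<i> * complex_of_real (e (r k)))) \<longlonglongrightarrow> G z"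
        by (intro isCont_tendsto_compose[of _ G]) simp_all
    qed
    ultimately show ?thesis
      using LIMSEQ_unique by (simp add: Im_m z g_def) blast
  qed
  obtain c where c: "\<And>z. 0 < Im z \<Longrightarrow> cauchy_transform M z - G z = c"
    using Im_zero_imp_constant[of "\<lambda>z. cauchy_transform M z - G z"] M.cauchy_holomorphic holG Im_eq
    by (auto simp: upper_def intro!: holomorphic_intros)
  \<comment> \<open>Both terms of the difference are at most \<open>1 / y\<close> at
    \<open>\<i> y\<close>, so the constant is 0.\<close>
  have "norm c \<le> 2 / y" if "0 < y" for y
  proof -
    have p: "0 < Im (\<i> * complex_of_real y)" using that by simp
    have "norm c \<le> norm (cauchy_transform M (\<i> * complex_of_real y)) + norm (G (\<i> * complex_of_real y))"
      using c[OF p] norm_triangle_ineq4 by metis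
    then show ?thesis using M.norm_cauchy_le[OF p] normG[OF p] by simp
  qed
  then have "norm c \<le> 0"
    by (intro tendsto_lowerbound[of "\<lambda>y::real. 2 / y" 0 at_top])
      (real_asymp, auto intro: eventually_mono[OF eventually_gt_at_top[of 0]])
  then have c0: "c = 0" by simp
  show ?thesis
  proof (intro exI[of _ M] conjI M allI impI)
    fix z assume z: "0 < Im z"
    then show "K_transform M z = K z"
      using c[OF z] c0 F0[OF z] by (simp add: K_transform_def G_def)
  qed
qed

section \<open>Boolean powers and G-free convolutions\<close>

lemma boolean_power:
  assumes M: "real_distribution M" and t: "0 \<le> t"
  shows "real_distribution (boolean_power M t)"
    and "0 < Im z \<Longrightarrow> K_transform (boolean_power M t) z = complex_of_real t * K_transform M z"
proof -
  interpret M: real_distribution M by fact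
  let ?P = "\<lambda>N. real_distribution N \<and> (\<forall>z. 0 < Im z \<longrightarrow> K_transform N z = complex_of_real t * K_transform M z)"
  have "\<exists>N. ?P N"
  proof (rule K_transform_exists)
    show "(\<lambda>z. complex_of_real t * K_transform M z) holomorphic_on upper"
      by (intro holomorphic_intros M.K_holomorphic)
    show "Im (complex_of_real t * K_transform M z) \<le> 0" if "0 < Im z" for z
      using M.Im_K_le[OF that] t by (simp add: mult_nonneg_nonpos)
    show "\<exists>R. \<forall>y\<ge>R. norm (complex_of_real t * K_transform M (\<i> * complex_of_real y)) \<le> \<delta> * y" if "0 < \<delta>" for \<delta>
    proof -
      \<comment> \<open>Dividing by \<open>t + 1\<close> in place of \<open>t\<close> covers
        \<open>t = 0\<close> as well.\<close>
      have "0 < \<delta> / (t + 1)" using that t by simp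
      from M.K_small_ex[OF this] obtain R where R: "0 < R"
        "\<forall>y\<ge>R. \<forall>w. norm (w - \<i> * complex_of_real y) \<le> y / 2 \<longrightarrow> norm (K_transform M w) \<le> \<delta> / (t + 1) * y"
        by auto
      show ?thesis
      proof (intro exI[of _ R] allI impI)
        fix y assume y: "R \<le> y"
        then have "norm (K_transform M (\<i> * complex_of_real y)) \<le> \<delta> / (t + 1) * y"
          using R by simp
        then have "t * norm (K_transform M (\<i> * complex_of_real y)) \<le> t * (\<delta> / (t + 1) * y)"
          by (rule mult_left_mono[OF _ t])
        also have "\<dots> = t / (t + 1) * (\<delta> * y)" by simp
        also have "\<dots> \<le> 1 * (\<delta> * y)"
          using t that R y by (intro mult_right_mono) (auto simp: divide_simps)
        finally show "norm (complex_of_real t * K_transform M (\<i> * complex_of_real y)) \<le> \<delta> * y"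
          using t by (simp add: norm_mult)
      qed
    qed
  qed
  then have "\<exists>!N. ?P N"
    by (metis K_transform_unique)
  then have "?P (boolean_power M t)"
    unfolding boolean_power_def by (rule theI')
  then show "real_distribution (boolean_power M t)"
    and "0 < Im z \<Longrightarrow> K_transform (boolean_power M t) z = complex_of_real t * K_transform M z"
    by auto
qed

section \<open>Uniform thresholds, weak limits and the contraction estimate\<close>

lemma weak_conv_K_small_all:
  assumes X: "\<And>n. real_distribution (X n)" and L: "real_distribution L" and conv: "weak_conv_m X L"
    and \<delta>: "0 < \<delta>"
  shows "\<exists>R>0. \<forall>n. \<forall>y\<ge>R. \<forall>w. norm (w - \<i> * complex_of_real y) \<le> y / 2 \<longrightarrow>
           norm (K_transform (X n) w) \<le> \<delta> * y"
proof -
  let ?Q = "\<lambda>n R. \<forall>y\<ge>R. \<forall>w. norm (w - \<i> * complex_of_real y) \<le> y / 2 \<longrightarrow> norm (K_transform (X n) w) \<le> \<delta> * y"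
  obtain R0 n0 where R0: "0 < R0" "\<And>n. n0 \<le> n \<Longrightarrow> ?Q n R0"
    using weak_conv_K_small[OF assms] unfolding eventually_sequentially by blast
  have "\<forall>n. \<exists>R>0. ?Q n R" using real_distribution.K_small_ex[OF X \<delta>] by blast
  then obtain r where r: "\<And>n. 0 < r n" "\<And>n. ?Q n (r n)" by metis
  \<comment> \<open>The sum of the thresholds of the finitely many exceptional indices dominates
    each of them, the terms being positive.\<close>
  show ?thesis
  proof (rule exI[of _ "R0 + (\<Sum>n<n0. r n)"], rule conjI, rule_tac [2] allI)
    show "0 < R0 + (\<Sum>n<n0. r n)" using R0(1) r(1) by (intro add_pos_nonneg sum_nonneg) (auto intro: less_imp_le)
    fix n
    have nonneg: "0 \<le> (\<Sum>n<n0. r n)" using r(1) by (intro sum_nonneg) (auto intro: less_imp_le)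
    have "\<exists>R \<le> R0 + (\<Sum>n<n0. r n). ?Q n R"
    proof (cases "n0 \<le> n")
      case True
      then show ?thesis using R0(2) nonneg by (intro exI[of _ R0]) auto
    next
      case False
      then have "r n \<le> (\<Sum>n<n0. r n)"
        using r(1) by (intro member_le_sum) (auto intro: less_imp_le)
      then show ?thesis using R0(1) r(2)[of n] by (intro exI[of _ "r n"]) auto
    qed
    then show "?Q n (R0 + (\<Sum>n<n0. r n))"
      by (meson order_trans)
  qed
qed

text \<open>A continuity theorem for \<open>K\<close>: smallness at one height per \<delta>, uniform
  in \<open>n\<close>, gives tightness, and the values on a ray identify all subsequential limits
  with each other. The pointwise limit \<kappa> is an arbitrary function, not assumed to be a
  \<open>K\<close>-transform.\<close>

lemma weak_limit_exists:
  assumes X: "\<And>n. real_distribution (X n)"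
    and small: "\<And>\<delta>. 0 < \<delta> \<Longrightarrow> \<exists>y>0. \<forall>n. norm (K_transform (X n) (\<i> * complex_of_real y)) \<le> \<delta> * y"
    and conv: "\<And>y. R \<le> y \<Longrightarrow> (\<lambda>n. K_transform (X n) (\<i> * complex_of_real y)) \<longlonglongrightarrow> \<kappa> y"
  shows "\<exists>L. real_distribution L \<and> weak_conv_m X L"
proof -
  have tight: "tight X"
  proof (rule tight_if_tails[OF X])
    fix \<epsilon> :: real assume \<epsilon>: "0 < \<epsilon>"
    define \<delta> where "\<delta> = min (1 / 2) (\<epsilon> / 4)"
    have \<delta>: "0 < \<delta>" "\<delta> \<le> 1 / 2" "4 * \<delta> \<le> \<epsilon>" using \<epsilon> by (auto simp: \<delta>_def)
    obtain y where y: "0 < y" "\<And>n. norm (K_transform (X n) (\<i> * complex_of_real y)) \<le> \<delta> * y"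
      using small[OF \<delta>(1)] by auto
    have "measure (X n) {t. y \<le> \<bar>t\<bar>} \<le> 4 * \<delta>" for n
      by (rule real_distribution.tail_le_K[OF X y \<delta>(2)])
    then show "\<exists>T>0. \<forall>n. measure (X n) {t. T \<le> \<bar>t\<bar>} \<le> \<epsilon>"
      using y(1) \<delta>(3) by (meson order_trans)
  qed
  then obtain r L where "strict_mono (r :: nat \<Rightarrow> nat)" and L: "real_distribution L"
    and convL: "weak_conv_m (X \<circ> id \<circ> r) L"
    using tight_imp_convergent_subsubsequence[of X id] by (auto simp: strict_mono_id)
  have K_limit: "K_transform Q (\<i> * complex_of_real y) = \<kappa> y"
    if "strict_mono s" "real_distribution Q" "weak_conv_m (X \<circ> s) Q" "max 1 R \<le> y" for s :: "nat \<Rightarrow> nat" and Q y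
  proof -
    have "(\<lambda>n. K_transform ((X \<circ> s) n) (\<i> * complex_of_real y)) \<longlonglongrightarrow> K_transform Q (\<i> * complex_of_real y)"
      by (rule weak_conv_K[OF _ that(2,3)]) (use X that(4) in auto)
    moreover have "(\<lambda>n. K_transform ((X \<circ> s) n) (\<i> * complex_of_real y)) \<longlonglongrightarrow> \<kappa> y"
      using LIMSEQ_subseq_LIMSEQ[OF conv that(1), of y] that(4) by (simp add: o_def)
    ultimately show ?thesis by (rule LIMSEQ_unique)
  qed
  have "weak_conv_m X L"
  proof (rule tight_subseq_weak_converge[OF X L tight])
    fix s Q assume s: "strict_mono (s :: nat \<Rightarrow> nat)" and Q: "real_distribution Q" and conv': "weak_conv_m (X \<circ> s) Q"
    have "Q = L"
    proof (rule K_transform_unique_imaginary_axis[OF Q L])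
      fix y assume "max 1 R \<le> y"
      then show "K_transform Q (\<i> * complex_of_real y) = K_transform L (\<i> * complex_of_real y)"
        using K_limit[OF s Q conv'] K_limit[OF \<open>strict_mono r\<close> L] convL by simp
    qed
    then show "weak_conv_m (X \<circ> s) L" using conv' by simp
  qed
  then show ?thesis using L by blast
qed

text \<open>Around each point of the ball of radius \<open>y / 4\<close> a disc of radius
  \<open>y / 4\<close> still lies in the ball of radius \<open>y / 2\<close> where the bound holds;
  Cauchy's estimate on it bounds the derivative by \<open>B / (y / 4)\<close>.\<close>

lemma Lipschitz_near_axis:
  assumes hol: "k holomorphic_on upper" and y: "0 < y"
    and bound: "\<And>w. norm (w - \<i> * complex_of_real y) \<le> y / 2 \<Longrightarrow> norm (k w) \<le> B"
    and a: "norm (a - \<i> * complex_of_real y) \<le> y / 4" and b: "norm (b - \<i> * complex_of_real y) \<le> y / 4"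
  shows "norm (k a - k b) \<le> 4 * B / y * norm (a - b)"
proof (rule field_differentiable_bound[where S = "cball (\<i> * complex_of_real y) (y / 4)"])
  fix w assume "w \<in> cball (\<i> * complex_of_real y) (y / 4)"
  then have w: "norm (w - \<i> * complex_of_real y) \<le> y / 4" by (simp add: dist_norm norm_minus_commute)
  have near: "norm (x - \<i> * complex_of_real y) \<le> y / 2" if "x \<in> cball w (y / 4)" for x
    using that w norm_triangle_ineq[of "x - w" "w - \<i> * complex_of_real y"]
    by (simp add: dist_norm norm_minus_commute)
  have up: "x \<in> upper" if "norm (x - \<i> * complex_of_real y) \<le> y / 2" for x
    using norm_ratio_le(3)[OF y that] y by (simp add: upper_def)
  have sub: "cball w (y / 4) \<subseteq> upper" using near up by blast
  have "norm ((deriv ^^ 1) k w) \<le> fact 1 * B / (y / 4) ^ 1"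
  proof (rule Cauchy_inequality)
    show "k holomorphic_on ball w (y / 4)"
      using hol sub ball_subset_cball by (meson holomorphic_on_subset order_trans)
    show "continuous_on (cball w (y / 4)) k"
      using hol sub by (meson holomorphic_on_imp_continuous_on holomorphic_on_subset)
    show "norm (k x) \<le> B" if "norm (w - x) = y / 4" for x
      using that by (intro bound near) (simp add: dist_norm)
  qed (use y in simp)
  then show "norm (deriv k w) \<le> 4 * B / y" by (simp add: mult.commute)
  have "w \<in> upper" using sub y by auto
  from has_field_derivative_at_within[OF holomorphic_derivI[OF hol open_upper this]]
  show "(k has_field_derivative deriv k w) (at w within cball (\<i> * complex_of_real y) (y / 4))" .
qed (use a b in \<open>auto simp: dist_norm norm_minus_commute\<close>)

section \<open>Solving the fixed point equation of the G-free family\<close>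

lemma norm_nbr_sum_le:
  assumes V: "finite V" and f: "\<And>w. w \<in> V \<Longrightarrow> real (card V) * norm (f w) \<le> C" and C: "0 \<le> C"
  shows "norm (\<Sum>w\<in>{w\<in>V. P w}. f w) \<le> (C :: real)"
proof (cases "V = {}")
  case False
  then have N: "0 < real (card V)" using V by (simp add: card_gt_0_iff)
  have "norm (\<Sum>w\<in>{w\<in>V. P w}. f w) \<le> (\<Sum>w\<in>{w\<in>V. P w}. C / real (card V))"
    using f N by (intro sum_norm_le) (auto simp: pos_le_divide_eq mult.commute)
  also have "\<dots> \<le> (\<Sum>w\<in>V. C / real (card V))"
    using V C by (intro sum_mono2) auto
  also have "\<dots> = C" using N by simp
  finally show ?thesis .
qed (use C in simp)

text \<open>High on the axis, \<open>1 / (4 N)\<close> keeps neighbour sums below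
  \<open>y / 4\<close>, and \<open>1 / (20 N)\<close> gives \<open>K\<close> the Lipschitz constant
  \<open>1 / (5 N)\<close>; with at most \<open>N\<close> neighbours the largest discrepancy
  \<open>m\<close> satisfies \<open>m \<le> m / 5\<close>. The height needed depends on the two
  families, which is harmless since agreement on any ray forces equality.\<close>

lemma gfree_family_unique:
  assumes V: "finite V" and M: "real_distribution M"
    and \<nu>: "gfree_family V E (\<lambda>_. M) \<nu>" and \<nu>': "gfree_family V E (\<lambda>_. M) \<nu>'" and v: "v \<in> V"
  shows "\<nu> v = \<nu>' v"
proof -
  interpret M: real_distribution M by fact
  define N where "N = real (card V)"
  have N: "0 < N" using V v by (auto simp: N_def card_gt_0_iff)
  have rd: "real_distribution (\<nu> w)" "real_distribution (\<nu>' w)" if "w \<in> V" for w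
    using \<nu> \<nu>' that by (auto simp: gfree_family_def)
  let ?i = "\<lambda>y. \<i> * complex_of_real y"
  have "\<exists>R>0. \<forall>y\<ge>R. norm (K_transform Q (?i y)) \<le> 1 / (4 * N) * y" if "real_distribution Q" for Q
    using real_distribution.K_small_ex[OF that, of "1 / (4 * N)"] N by auto
  then have "\<forall>w\<in>V. \<exists>R>0. \<forall>y\<ge>R. norm (K_transform (\<nu> w) (?i y)) \<le> 1 / (4 * N) * y"
    and "\<forall>w\<in>V. \<exists>R>0. \<forall>y\<ge>R. norm (K_transform (\<nu>' w) (?i y)) \<le> 1 / (4 * N) * y"
    using rd by blast+
  then obtain r r' where r: "\<And>w. w \<in> V \<Longrightarrow> 0 < r w" "\<And>w y. w \<in> V \<Longrightarrow> r w \<le> y \<Longrightarrow> norm (K_transform (\<nu> w) (?i y)) \<le> 1 / (4 * N) * y"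
    and r': "\<And>w. w \<in> V \<Longrightarrow> 0 < r' w" "\<And>w y. w \<in> V \<Longrightarrow> r' w \<le> y \<Longrightarrow> norm (K_transform (\<nu>' w) (?i y)) \<le> 1 / (4 * N) * y"
    by metis
  obtain R0 where R0: "0 < R0" "\<forall>y\<ge>R0. \<forall>w. norm (w - ?i y) \<le> y / 2 \<longrightarrow> norm (K_transform M w) \<le> 1 / (20 * N) * y"
    using M.K_small_ex[of "1 / (20 * N)"] N by auto
  define R where "R = Max (insert R0 (r ` V \<union> r' ` V))"
  have fin: "finite (insert R0 (r ` V \<union> r' ` V))" using V by simp
  have R: "R0 \<le> R" "\<And>w. w \<in> V \<Longrightarrow> r w \<le> R" "\<And>w. w \<in> V \<Longrightarrow> r' w \<le> R"
    unfolding R_def by (rule Max_ge[OF fin], simp)+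
  show ?thesis
  proof (rule K_transform_unique_imaginary_axis[OF rd(1)[OF v] rd(2)[OF v]])
    fix y assume y: "R \<le> y"
    have y0: "0 < y" using y R(1) R0(1) by linarith
    define D where "D w = norm (K_transform (\<nu> w) (?i y) - K_transform (\<nu>' w) (?i y))" for w
    define m where "m = Max (D ` V)"
    have Dm: "D w \<le> m" if "w \<in> V" for w
      unfolding m_def using V that by (intro Max_ge) auto
    have m0: "0 \<le> m" using Dm[OF v] norm_ge_zero D_def order_trans by metis
    have step: "D w \<le> m / 5" if w: "w \<in> V" for w
    proof -
      let ?S = "\<lambda>\<sigma>. \<Sum>u\<in>{u\<in>V. (w, u) \<in> E}. K_transform (\<sigma> u) (?i y)"
      have S: "norm (?S \<sigma>) \<le> y / 4" if h: "\<And>u. u \<in> V \<Longrightarrow> norm (K_transform (\<sigma> u) (?i y)) \<le> 1 / (4 * N) * y" for \<sigma>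
      proof (rule norm_nbr_sum_le[OF V])
        show "real (card V) * norm (K_transform (\<sigma> u) (?i y)) \<le> y / 4" if "u \<in> V" for u
          using h[OF that] N y0 by (simp add: N_def[symmetric] field_simps)
      qed (use y0 in simp)
      have S1: "norm (?S \<nu>) \<le> y / 4" using r(2) R(2) y by (intro S) (meson order_trans)
      have S2: "norm (?S \<nu>') \<le> y / 4" using r'(2) R(3) y by (intro S) (meson order_trans)
      have Sd: "norm (?S \<nu> - ?S \<nu>') \<le> N * m"
        unfolding sum_subtractf[symmetric]
      proof (rule norm_nbr_sum_le[OF V])
        show "real (card V) * norm (K_transform (\<nu> u) (?i y) - K_transform (\<nu>' u) (?i y)) \<le> N * m" if "u \<in> V" for u
          using Dm[OF that] N unfolding D_def by (simp add: N_def[symmetric])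
      qed (use N m0 in simp)
      have "D w = norm (K_transform M (?i y - ?S \<nu>) - K_transform M (?i y - ?S \<nu>'))"
        using \<nu> \<nu>' w y0 by (simp add: D_def gfree_family_def)
      also have "\<dots> \<le> 4 * (1 / (20 * N) * y) / y * norm ((?i y - ?S \<nu>) - (?i y - ?S \<nu>'))"
        using R0(2) R(1) y S1 S2 by (intro Lipschitz_near_axis[OF M.K_holomorphic y0]) auto
      also have "\<dots> = 1 / (5 * N) * norm (?S \<nu> - ?S \<nu>')"
        using y0 by (simp add: norm_minus_commute)
      also have "\<dots> \<le> 1 / (5 * N) * (N * m)"
        using N by (intro mult_left_mono Sd) auto
      finally show ?thesis using N by simp
    qed
    have "m \<in> D ` V" unfolding m_def using V v by (intro Max_in) auto
    then obtain x where "x \<in> V" "m = D x" by blast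
    then have "m \<le> m / 5" using step[of x] by simp
    then have "D v = 0" using Dm[OF v] m0 D_def[of v] by (simp add: antisym)
    then show "K_transform (\<nu> v) (?i y) = K_transform (\<nu>' v) (?i y)" by (simp add: D_def)
  qed
qed

text \<open>Picard iteration from 0. Each iterate satisfies the conditions of
  \<open>K_transform_exists\<close>, hence belongs to a measure, and convergence on the axis gives
  weak limits. The second conjunct passes a bound from \<open>N K\<close> of the given measure to
  the solution with the same \<delta>, whatever the graph; tightness of the G-free convolutions
  rests on it.\<close>

lemma gfree_family_exists:
  assumes V: "finite V" "V \<noteq> {}" and M: "real_distribution M"
  shows "\<exists>\<nu>. gfree_family V E (\<lambda>_. M) \<nu> \<and>
    (\<forall>v\<in>V. \<forall>y>0. \<forall>\<delta>\<le>1/20.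
       (\<forall>w. norm (w - \<i> * complex_of_real y) \<le> y / 2 \<longrightarrow> real (card V) * norm (K_transform M w) \<le> \<delta> * y) \<longrightarrow>
       real (card V) * norm (K_transform (\<nu> v) (\<i> * complex_of_real y)) \<le> \<delta> * y)"
proof -
  interpret M: real_distribution M by fact
  define N where "N = real (card V)"
  have N: "0 < N" using V by (auto simp: N_def card_gt_0_iff)
  let ?i = "\<lambda>y. \<i> * complex_of_real y"
  define u where "u = rec_nat (\<lambda>_ _. 0) (\<lambda>_ f v z. K_transform M (z - (\<Sum>w\<in>{w\<in>V. (v, w) \<in> E}. f w z)))"
  have u0: "u 0 v z = 0" and uSuc: "u (Suc m) v z = K_transform M (z - (\<Sum>w\<in>{w\<in>V. (v, w) \<in> E}. u m w z))" for m v z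
    by (simp_all add: u_def)
  have Imu: "Im (u m v z) \<le> 0" if "0 < Im z" for m v z
    using that
  proof (induction m arbitrary: v)
    case (Suc m)
    have "Im (\<Sum>w\<in>{w\<in>V. (v, w) \<in> E}. u m w z) \<le> 0"
      using Suc by (simp add: sum_nonpos)
    then show ?case using Suc.prems unfolding uSuc by (intro M.Im_K_le) simp
  qed (simp add: u0)
  have arg: "0 < Im (z - (\<Sum>w\<in>{w\<in>V. (v, w) \<in> E}. u m w z))" if "0 < Im z" for m v z
  proof -
    have "Im (\<Sum>w\<in>{w\<in>V. (v, w) \<in> E}. u m w z) \<le> 0"
      using Imu[OF that] by (simp add: sum_nonpos)
    then show ?thesis using that by simp
  qed
  have holu: "u m v holomorphic_on upper" for m v
  proof (induction m arbitrary: v)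
    case (Suc m)
    have "(\<lambda>z. K_transform M (z - (\<Sum>w\<in>{w\<in>V. (v, w) \<in> E}. u m w z))) holomorphic_on upper"
      by (rule holomorphic_on_compose_gen[OF _ M.K_holomorphic, unfolded o_def])
        (use arg in \<open>auto simp: upper_def intro!: holomorphic_intros Suc[unfolded upper_def]\<close>)
    then show ?case by (simp add: uSuc[abs_def])
  qed (simp add: u0[abs_def])
  \<comment> \<open>With \<open>\<delta> \<le> 1/20\<close> neighbour sums are at most
    \<open>y / 20\<close>, so each iterate evaluates \<open>K\<close> inside the ball where the
    bound is assumed and the bound reproduces itself.\<close>
  define good where "good \<delta> y \<longleftrightarrow> 0 < y \<and> \<delta> \<le> 1/20 \<and>
     (\<forall>w. norm (w - ?i y) \<le> y / 2 \<longrightarrow> N * norm (K_transform M w) \<le> \<delta> * y)" for \<delta> y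
  have good0: "0 \<le> \<delta> * y" if "good \<delta> y" for \<delta> y
  proof -
    have "norm (?i y - ?i y) \<le> y / 2" using that by (simp add: good_def)
    then have "N * norm (K_transform M (?i y)) \<le> \<delta> * y" using that unfolding good_def by blast
    then show ?thesis using N by (meson mult_nonneg_nonneg less_imp_le norm_ge_zero order_trans)
  qed
  have small_nbr: "norm (\<Sum>w\<in>{w\<in>V. (v, w) \<in> E}. f w) \<le> y / 4"
    if "good \<delta> y" "\<And>w. w \<in> V \<Longrightarrow> N * norm (f w) \<le> \<delta> * y" for \<delta> y v f
  proof -
    have "norm (\<Sum>w\<in>{w\<in>V. (v, w) \<in> E}. f w) \<le> \<delta> * y"
      using that(2) good0[OF that(1)] by (intro norm_nbr_sum_le V(1)) (auto simp: N_def)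
    also have "\<dots> \<le> 1 / 20 * y" using that(1) by (intro mult_right_mono) (auto simp: good_def)
    finally show ?thesis using that(1) by (simp add: good_def)
  qed
  have bound: "N * norm (u m v (?i y)) \<le> \<delta> * y" if "good \<delta> y" for \<delta> y m v
  proof (induction m arbitrary: v)
    case 0 then show ?case using good0[OF that] by (simp add: u0)
  next
    case (Suc m)
    have "norm (\<Sum>w\<in>{w\<in>V. (v, w) \<in> E}. u m w (?i y)) \<le> y / 4" by (rule small_nbr[OF that Suc])
    then have "norm ((?i y - (\<Sum>w\<in>{w\<in>V. (v, w) \<in> E}. u m w (?i y))) - ?i y) \<le> y / 2"
      using that by (simp add: good_def)
    then show ?case using that unfolding uSuc good_def by blast
  qed
  have good_ex: "\<exists>R>0. \<forall>y\<ge>R. good \<delta> y" if \<delta>: "0 < \<delta>" "\<delta> \<le> 1/20" for \<delta>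
  proof -
    obtain R where R: "0 < R" "\<forall>y\<ge>R. \<forall>w. norm (w - ?i y) \<le> y / 2 \<longrightarrow> norm (K_transform M w) \<le> \<delta> / N * y"
      using M.K_small_ex[of "\<delta> / N"] N \<delta> by auto
    have "good \<delta> y" if y: "R \<le> y" for y
    proof -
      have "N * norm (K_transform M w) \<le> \<delta> * y" if "norm (w - ?i y) \<le> y / 2" for w
      proof -
        have "N * norm (K_transform M w) \<le> N * (\<delta> / N * y)"
          using R(2) y that N by (intro mult_left_mono) auto
        then show ?thesis using N by simp
      qed
      then show ?thesis using R(1) y \<delta> by (auto simp: good_def)
    qed
    then show ?thesis using R(1) by blast
  qed
  have "\<exists>Q. real_distribution Q \<and> (\<forall>z. 0 < Im z \<longrightarrow> K_transform Q z = u m v z)" for m v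
  proof (rule K_transform_exists[OF holu Imu])
    fix \<delta> :: real assume \<delta>: "0 < \<delta>"
    define \<delta>' where "\<delta>' = min (1/20) (N * \<delta>)"
    have \<delta>': "0 < \<delta>'" "\<delta>' \<le> 1/20" "\<delta>' \<le> N * \<delta>" using \<delta> N by (auto simp: \<delta>'_def)
    obtain R where R: "0 < R" "\<And>y. R \<le> y \<Longrightarrow> good \<delta>' y" using good_ex[OF \<delta>'(1,2)] by blast
    have "norm (u m v (?i y)) \<le> \<delta> * y" if y: "R \<le> y" for y
    proof -
      have "N * norm (u m v (?i y)) \<le> \<delta>' * y" by (rule bound[OF R(2)[OF y]])
      also have "\<dots> \<le> N * \<delta> * y" using \<delta>'(3) y R(1) by (intro mult_right_mono) auto
      finally show ?thesis using N by (simp add: mult.assoc)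
    qed
    then show "\<exists>R. \<forall>y\<ge>R. norm (u m v (?i y)) \<le> \<delta> * y" by blast
  qed
  then obtain \<tau> where \<tau>: "\<And>m v. real_distribution (\<tau> m v)"
    and K\<tau>: "\<And>m v z. 0 < Im z \<Longrightarrow> K_transform (\<tau> m v) z = u m v z"
    by metis
  \<comment> \<open>The actual contraction factor is \<open>1/5\<close>; \<open>1/2\<close> is a
    weaker one that suffices for summability.\<close>
  have diff: "N * norm (u (Suc m) v (?i y) - u m v (?i y)) \<le> (1/2) ^ m * y" if g: "good (1/20) y" for m v y
  proof (induction m arbitrary: v)
    case 0
    have "N * norm (u (Suc 0) v (?i y)) \<le> 1/20 * y" by (rule bound[OF g])
    then show ?case using g by (simp add: u0 good_def)
  next
    case (Suc m)
    have y: "0 < y" using g by (simp add: good_def)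
    let ?S = "\<lambda>m. \<Sum>w\<in>{w\<in>V. (v, w) \<in> E}. u m w (?i y)"
    have S: "norm (?S m) \<le> y / 4" for m by (rule small_nbr[OF g bound[OF g]])
    have Sd: "norm (?S (Suc m) - ?S m) \<le> (1/2) ^ m * y"
      unfolding sum_subtractf[symmetric]
      using Suc y by (intro norm_nbr_sum_le V(1)) (auto simp: N_def)
    have "norm (u (Suc (Suc m)) v (?i y) - u (Suc m) v (?i y))
        = norm (K_transform M (?i y - ?S (Suc m)) - K_transform M (?i y - ?S m))"
      by (simp only: uSuc)
    also have "\<dots> \<le> 4 * (1/20 * y / N) / y * norm ((?i y - ?S (Suc m)) - (?i y - ?S m))"
    proof (rule Lipschitz_near_axis[OF M.K_holomorphic y])
      show "norm (K_transform M w) \<le> 1/20 * y / N" if "norm (w - ?i y) \<le> y / 2" for w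
      proof -
        have "N * norm (K_transform M w) \<le> 1/20 * y" using g that unfolding good_def by blast
        then show ?thesis using N by (simp only: pos_le_divide_eq mult.commute)
      qed
    qed (use S[of m] S[of "Suc m"] in simp_all)
    also have "\<dots> = 1 / (5 * N) * norm (?S (Suc m) - ?S m)"
      using y by (simp add: norm_minus_commute)
    also have "\<dots> \<le> 1 / (5 * N) * ((1/2) ^ m * y)"
      using N by (intro mult_left_mono Sd) auto
    finally have "N * norm (u (Suc (Suc m)) v (?i y) - u (Suc m) v (?i y)) \<le> N * (1 / (5 * N) * ((1/2) ^ m * y))"
      by (rule mult_left_mono[OF _ less_imp_le[OF N]])
    also have "\<dots> = 1/5 * ((1/2) ^ m * y)" using N by simp
    also have "\<dots> \<le> 1/2 * ((1/2) ^ m * y)" using y by (intro mult_right_mono) auto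
    finally show ?case by (simp add: mult.assoc)
  qed
  have conv: "convergent (\<lambda>m. u m v (?i y))" if g: "good (1/20) y" for v y
  proof -
    have y: "0 < y" using g by (simp add: good_def)
    have "summable (\<lambda>m. u (Suc m) v (?i y) - u m v (?i y))"
    proof (rule summable_comparison_test')
      show "summable (\<lambda>m. (1/2) ^ m * (y / N))" by (intro summable_mult2 summable_geometric) simp
      show "norm (u (Suc m) v (?i y) - u m v (?i y)) \<le> (1/2) ^ m * (y / N)" for m
        using diff[OF g, of m v] N by (simp add: pos_le_divide_eq mult.commute)
    qed
    then show ?thesis
      by (simp add: summable_iff_convergent sum_lessThan_telescope[of "\<lambda>m. u m v (?i y)"] u0)
  qed
  obtain R where R: "0 < R" "\<And>y. R \<le> y \<Longrightarrow> good (1/20) y" using good_ex[of "1/20"] by auto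
  have "\<exists>L. real_distribution L \<and> weak_conv_m (\<lambda>m. \<tau> m v) L" for v
  proof (rule weak_limit_exists[where R = R and \<kappa> = "\<lambda>y. lim (\<lambda>m. u m v (?i y))", OF \<tau>])
    show "(\<lambda>m. K_transform (\<tau> m v) (?i y)) \<longlonglongrightarrow> lim (\<lambda>m. u m v (?i y))" if "R \<le> y" for y
      using conv[OF R(2)[OF that]] R(1) that by (simp add: K\<tau> convergent_LIMSEQ_iff)
    fix \<delta> :: real assume \<delta>: "0 < \<delta>"
    define \<delta>' where "\<delta>' = min (1/20) (N * \<delta>)"
    have \<delta>': "0 < \<delta>'" "\<delta>' \<le> 1/20" "\<delta>' \<le> N * \<delta>" using \<delta> N by (auto simp: \<delta>'_def)
    obtain y where y: "0 < y" "good \<delta>' y" using good_ex[OF \<delta>'(1,2)] by blast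
    have "norm (u m v (?i y)) \<le> \<delta> * y" for m
    proof -
      have "N * norm (u m v (?i y)) \<le> \<delta>' * y" by (rule bound[OF y(2)])
      also have "\<dots> \<le> N * \<delta> * y" using \<delta>'(3) y(1) by (intro mult_right_mono) auto
      finally show ?thesis using N by (simp add: mult.assoc)
    qed
    then show "\<exists>y>0. \<forall>m. norm (K_transform (\<tau> m v) (?i y)) \<le> \<delta> * y"
      using y(1) by (intro exI[of _ y]) (simp add: K\<tau>)
  qed
  then obtain \<nu> where \<nu>: "\<And>v. real_distribution (\<nu> v)" and \<nu>conv: "\<And>v. weak_conv_m (\<lambda>m. \<tau> m v) (\<nu> v)"
    by metis
  \<comment> \<open>Convergence was proved on a ray only; weak convergence of the measures extends
    it to the whole upper half plane, where the equation has to hold.\<close>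
  have lim: "(\<lambda>m. u m v z) \<longlonglongrightarrow> K_transform (\<nu> v) z" if "0 < Im z" for v z
    using weak_conv_K[OF \<tau> \<nu> \<nu>conv that] by (simp add: K\<tau>[OF that])
  have fam: "gfree_family V E (\<lambda>_. M) \<nu>"
    unfolding gfree_family_def
  proof (intro conjI ballI allI impI \<nu>)
    fix v z assume z: "0 < Im (z :: complex)"
    let ?a = "z - (\<Sum>w\<in>{w\<in>V. (v, w) \<in> E}. K_transform (\<nu> w) z)"
    have "Im (\<Sum>w\<in>{w\<in>V. (v, w) \<in> E}. K_transform (\<nu> w) z) \<le> 0"
      using real_distribution.Im_K_le[OF \<nu> z] by (simp add: sum_nonpos)
    then have "?a \<in> upper" using z by (simp add: upper_def)
    then have "isCont (K_transform M) ?a"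
      using holomorphic_on_imp_continuous_on[OF M.K_holomorphic] continuous_on_eq_continuous_at[OF open_upper] by blast
    then have "(\<lambda>m. u (Suc m) v z) \<longlonglongrightarrow> K_transform M ?a"
      unfolding uSuc by (rule isCont_tendsto_compose) (intro tendsto_intros lim z)
    moreover have "(\<lambda>m. u (Suc m) v z) \<longlonglongrightarrow> K_transform (\<nu> v) z"
      using lim[OF z] by (rule LIMSEQ_Suc)
    ultimately show "K_transform (\<nu> v) z = K_transform M ?a" using LIMSEQ_unique by blast
  qed
  have "N * norm (K_transform (\<nu> v) (?i y)) \<le> \<delta> * y" if "good \<delta> y" for v y \<delta>
  proof (rule tendsto_upperbound)
    show "(\<lambda>m. N * norm (u m v (?i y))) \<longlonglongrightarrow> N * norm (K_transform (\<nu> v) (?i y))"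
      using that by (intro tendsto_intros lim) (simp add: good_def)
  qed (use bound[OF that] in auto)
  with fam show ?thesis
    by (intro exI[of _ \<nu>]) (simp add: N_def[symmetric] good_def)
qed

text \<open>The description also quantifies over the family; since the family is determined on
  \<open>V\<close>, so is \<rho>. The bound is carried along because later estimates reach
  \<open>gfree_conv\<close> through this \<nu>.\<close>

lemma gfree_conv:
  assumes V: "finite V" "V \<noteq> {}" and M: "real_distribution M"
  shows "real_distribution (gfree_conv V E (\<lambda>_. M)) \<and> (\<exists>\<nu>. gfree_family V E (\<lambda>_. M) \<nu> \<and>
    (\<forall>z. 0 < Im z \<longrightarrow> K_transform (gfree_conv V E (\<lambda>_. M)) z = (\<Sum>v\<in>V. K_transform (\<nu> v) z)) \<and>
    (\<forall>v\<in>V. \<forall>y>0. \<forall>\<delta>\<le>1/20.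
       (\<forall>w. norm (w - \<i> * complex_of_real y) \<le> y / 2 \<longrightarrow> real (card V) * norm (K_transform M w) \<le> \<delta> * y) \<longrightarrow>
       real (card V) * norm (K_transform (\<nu> v) (\<i> * complex_of_real y)) \<le> \<delta> * y))"
proof -
  obtain \<nu> where \<nu>: "gfree_family V E (\<lambda>_. M) \<nu>" and bound: "\<forall>v\<in>V. \<forall>y>0. \<forall>\<delta>\<le>1/20.
       (\<forall>w. norm (w - \<i> * complex_of_real y) \<le> y / 2 \<longrightarrow> real (card V) * norm (K_transform M w) \<le> \<delta> * y) \<longrightarrow>
       real (card V) * norm (K_transform (\<nu> v) (\<i> * complex_of_real y)) \<le> \<delta> * y"
    using gfree_family_exists[OF assms] by blast
  have rd: "real_distribution (\<nu> v)" if "v \<in> V" for v using \<nu> that by (simp add: gfree_family_def)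
  have N: "0 < real (card V)" using V by (simp add: card_gt_0_iff)
  have "\<exists>\<rho>. is_boolean_conv V \<nu> \<rho>"
    unfolding is_boolean_conv_def
  proof (rule K_transform_exists)
    show "(\<lambda>z. \<Sum>v\<in>V. K_transform (\<nu> v) z) holomorphic_on upper"
      by (intro holomorphic_intros real_distribution.K_holomorphic rd)
    show "Im (\<Sum>v\<in>V. K_transform (\<nu> v) z) \<le> 0" if "0 < Im z" for z
      using real_distribution.Im_K_le[OF rd that] by (simp add: sum_nonpos)
    fix \<delta> :: real assume \<delta>: "0 < \<delta>"
    have "\<forall>v\<in>V. \<exists>R>0. \<forall>y\<ge>R. norm (K_transform (\<nu> v) (\<i> * complex_of_real y)) \<le> \<delta> / real (card V) * y"
    proof
      fix v assume "v \<in> V"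
      from real_distribution.K_small_ex[OF rd[OF this], of "\<delta> / real (card V)"]
      show "\<exists>R>0. \<forall>y\<ge>R. norm (K_transform (\<nu> v) (\<i> * complex_of_real y)) \<le> \<delta> / real (card V) * y"
        using \<delta> N by auto
    qed
    then obtain r where r: "\<And>v y. v \<in> V \<Longrightarrow> r v \<le> y \<Longrightarrow>
        norm (K_transform (\<nu> v) (\<i> * complex_of_real y)) \<le> \<delta> / real (card V) * y"
      by metis
    show "\<exists>R. \<forall>y\<ge>R. norm (\<Sum>v\<in>V. K_transform (\<nu> v) (\<i> * complex_of_real y)) \<le> \<delta> * y"
    proof (intro exI[of _ "Max (r ` V)"] allI impI)
      fix y assume y: "Max (r ` V) \<le> y"
      have "norm (\<Sum>v\<in>V. K_transform (\<nu> v) (\<i> * complex_of_real y)) \<le> (\<Sum>v\<in>V. \<delta> / real (card V) * y)"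
        using y V by (intro sum_norm_le r) auto
      then show "norm (\<Sum>v\<in>V. K_transform (\<nu> v) (\<i> * complex_of_real y)) \<le> \<delta> * y"
        using N by simp
    qed
  qed
  then obtain \<rho> where \<rho>: "is_boolean_conv V \<nu> \<rho>" by blast
  have "gfree_conv V E (\<lambda>_. M) = \<rho>"
    unfolding gfree_conv_def
  proof (rule the_equality)
    show "\<exists>\<nu>. gfree_family V E (\<lambda>_. M) \<nu> \<and> is_boolean_conv V \<nu> \<rho>" using \<nu> \<rho> by blast
    fix \<rho>' assume "\<exists>\<nu>. gfree_family V E (\<lambda>_. M) \<nu> \<and> is_boolean_conv V \<nu> \<rho>'"
    then obtain \<nu>' where \<nu>': "gfree_family V E (\<lambda>_. M) \<nu>'" "is_boolean_conv V \<nu>' \<rho>'" by blast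
    have "\<nu>' v = \<nu> v" if "v \<in> V" for v
      by (rule gfree_family_unique[OF V(1) M \<nu>'(1) \<nu> that])
    then show "\<rho>' = \<rho>"
      using \<nu>'(2) \<rho> by (intro K_transform_unique) (auto simp: is_boolean_conv_def)
  qed
  then show ?thesis using \<nu> \<rho> bound by (auto simp: is_boolean_conv_def)
qed

section \<open>Rooted trees\<close>

text \<open>\<open>Graft t s\<close> attaches \<open>s\<close> as a further child of the root of \<open>t\<close>; the vertices of \<open>s\<close> are numbered after
  those of \<open>t\<close>, so that the root is \<open>0\<close> and edges increase.\<close>

datatype btree = Leaf | Graft btree btree

primrec bsize :: "btree \<Rightarrow> nat" where
  "bsize Leaf = 1"
| "bsize (Graft t s) = bsize t + bsize s"

primrec bedges :: "btree \<Rightarrow> (nat \<times> nat) set" where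
  "bedges Leaf = {}"
| "bedges (Graft t s) = insert (0, bsize t)
     (bedges t \<union> (\<lambda>(i, j). (i + bsize t, j + bsize t)) ` bedges s)"

lemma bsize_pos [simp]: "0 < bsize t"
  by (induction t) auto

lemma bedges_bounds: "(i, j) \<in> bedges t \<Longrightarrow> i < j \<and> j < bsize t"
  by (induction t arbitrary: i j) fastforce+

text \<open>A vertex of \<open>t\<close> keeps its parent, the root of \<open>s\<close> gets parent
  0, and the other vertices of \<open>s\<close> keep theirs up to the shift. Read backwards, a walk
  from the root is therefore forced.\<close>

lemma bedges_unique_parent:
  "0 < j \<Longrightarrow> j < bsize t \<Longrightarrow> \<exists>!i. (i, j) \<in> bedges t"
proof (induction t arbitrary: j)
  case (Graft t s)
  let ?shift = "(\<lambda>(i, j). (i + bsize t, j + bsize t)) ` bedges s"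
  consider "j < bsize t" | "j = bsize t" | j' where "j = j' + bsize t" "0 < j'" "j' < bsize s"
    using Graft.prems(2) by (metis add.commute add_diff_inverse_nat bsize.simps(2) linorder_neqE_nat
        nat_add_left_cancel_less not_less_iff_gr_or_eq zero_less_diff)
  then show ?case
  proof cases
    case 1
    then have "(i, j) \<in> bedges (Graft t s) \<longleftrightarrow> (i, j) \<in> bedges t" for i by auto
    then show ?thesis using Graft.IH(1)[OF Graft.prems(1) 1] by simp
  next
    case 2
    have "(i, j) \<notin> bedges t" for i using bedges_bounds[of i j t] 2 by auto
    moreover have "(i, j) \<notin> ?shift" for i using bedges_bounds[of _ 0 s] 2 by force
    ultimately have "(i, j) \<in> bedges (Graft t s) \<longleftrightarrow> i = 0" for i using 2 by auto
    then show ?thesis by simp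
  next
    case 3
    have nt: "(i, j) \<notin> bedges t" for i using bedges_bounds[of i j t] 3 by auto
    obtain k where k: "(k, j') \<in> bedges s" "\<And>i. (i, j') \<in> bedges s \<Longrightarrow> i = k"
      using Graft.IH(2)[OF 3(2,3)] by auto
    have "(i, j) \<in> bedges (Graft t s) \<longleftrightarrow> i = k + bsize t" for i
    proof
      assume "(i, j) \<in> bedges (Graft t s)"
      then obtain i' where "(i', j') \<in> bedges s" "i = i' + bsize t"
        using nt[of i] 3 by auto
      then show "i = k + bsize t" using k(2) by simp
    next
      assume "i = k + bsize t"
      then have "(i, j) = (\<lambda>(i, j). (i + bsize t, j + bsize t)) (k, j')" using 3 by simp
      then have "(i, j) \<in> ?shift" using k(1) by (rule image_eqI)
      then show "(i, j) \<in> bedges (Graft t s)" by simp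
    qed
    then show ?thesis by simp
  qed
qed auto

lemma dwalk_snoc:
  assumes "xs \<noteq> []"
  shows "dwalk F (xs @ [w]) \<longleftrightarrow> dwalk F xs \<and> (last xs, w) \<in> F"
proof
  assume l: "dwalk F (xs @ [w])"
  have "(xs ! i, xs ! Suc i) \<in> F" if "Suc i < length xs" for i
    using l that unfolding dwalk_def
    by (metis Suc_lessD length_append_singleton less_SucI nth_append)
  moreover have "((xs @ [w]) ! (length xs - 1), (xs @ [w]) ! Suc (length xs - 1)) \<in> F"
    using l assms unfolding dwalk_def by (metis One_nat_def diff_less length_append_singleton length_greater_0_conv
        Suc_mono zero_less_one)
  ultimately show "dwalk F xs \<and> (last xs, w) \<in> F"
    using assms by (simp add: dwalk_def nth_append last_conv_nth)
next
  assume r: "dwalk F xs \<and> (last xs, w) \<in> F"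
  show "dwalk F (xs @ [w])"
    unfolding dwalk_def
  proof (intro conjI allI impI)
    fix i assume i: "Suc i < length (xs @ [w])"
    show "((xs @ [w]) ! i, (xs @ [w]) ! Suc i) \<in> F"
    proof (cases "Suc i < length xs")
      case True
      then show ?thesis using r by (simp add: dwalk_def nth_append)
    next
      case False
      then have "Suc i = length xs" using i by simp
      then have "xs ! i = last xs" using assms by (metis diff_Suc_1 last_conv_nth)
      then show ?thesis using r \<open>Suc i = length xs\<close> by (simp add: nth_append)
    qed
  qed simp
qed

text \<open>Each step raises the label, so a walk ending at its starting label has no steps. This
  gives uniqueness of the walk from the root to itself.\<close>

lemma dwalk_increasing:
  assumes F: "\<And>i j. (i, j) \<in> F \<Longrightarrow> i < (j :: nat)" and w: "dwalk F xs"
  shows "hd xs \<le> last xs \<and> (last xs = hd xs \<longrightarrow> xs = [hd xs])"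
  using w
proof (induction xs rule: rev_induct)
  case (snoc x xs)
  show ?case
  proof (cases "xs = []")
    case False
    have "dwalk F xs" "(last xs, x) \<in> F" using snoc.prems False by (simp_all add: dwalk_snoc)
    then show ?thesis using snoc.IH F[of "last xs" x] False by simp
  qed simp
qed (simp add: dwalk_def)

text \<open>Strong induction on the end point: the last step of a walk to \<open>w > 0\<close> must
  come from the unique parent, which has a smaller label. This makes the coefficients \<beta>
  available for every encoded tree.\<close>

lemma finite_rooted_tree_bedges: "finite_rooted_tree {..<bsize t} (bedges t)"
proof -
  let ?F = "bedges t"
  have inc: "\<And>i j. (i, j) \<in> ?F \<Longrightarrow> i < j" using bedges_bounds by blast
  have dg: "finite_digraph {..<bsize t} ?F"
    unfolding finite_digraph_def digraph_def using bedges_bounds by (force dest: order_less_trans)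
  have "\<exists>!xs. dwalk ?F xs \<and> hd xs = 0 \<and> last xs = w" if "w < bsize t" for w
    using that
  proof (induction w rule: less_induct)
    case (less w)
    show ?case
    proof (cases "w = 0")
      case True
      show ?thesis
      proof (rule ex1I[of _ "[0]"])
        show "dwalk ?F [0] \<and> hd [0] = 0 \<and> last [0] = w" using True by (simp add: dwalk_def)
        show "xs = [0]" if "dwalk ?F xs \<and> hd xs = 0 \<and> last xs = w" for xs
          using dwalk_increasing[OF inc, where xs = xs] that True by metis
      qed
    next
      case False
      then obtain p where p: "(p, w) \<in> ?F" "\<And>i. (i, w) \<in> ?F \<Longrightarrow> i = p"
        using bedges_unique_parent[of w t] less.prems by auto
      have pw: "p < w" using p(1) inc by blast
      then obtain ys where ys: "dwalk ?F ys" "hd ys = 0" "last ys = p"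
        and uniq: "\<And>zs. dwalk ?F zs \<and> hd zs = 0 \<and> last zs = p \<Longrightarrow> zs = ys"
        using less.IH[of p] less.prems by (metis order_less_trans)
      have ne: "ys \<noteq> []" using ys(1) by (simp add: dwalk_def)
      show ?thesis
      proof (rule ex1I[of _ "ys @ [w]"])
        show "dwalk ?F (ys @ [w]) \<and> hd (ys @ [w]) = 0 \<and> last (ys @ [w]) = w"
          using ys p(1) ne by (simp add: dwalk_snoc)
        fix xs assume xs: "dwalk ?F xs \<and> hd xs = 0 \<and> last xs = w"
        then have "xs \<noteq> []" by (simp add: dwalk_def)
        then obtain zs where zs: "xs = zs @ [w]" using xs by (metis append_butlast_last_id)
        have "zs \<noteq> []" using zs xs False by auto
        then show "xs = ys @ [w]"
          using xs zs p(2) uniq by (simp add: dwalk_snoc)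
      qed
    qed
  qed
  then show ?thesis
    unfolding finite_rooted_tree_def using dg by (intro conjI bexI[of _ 0]) auto
qed

text \<open>The number of homomorphisms sending the root to \<open>v\<close>, with one factor
  \<open>1 / card V\<close> for each vertex other than the root.\<close>

primrec rooted_density :: "'v set \<Rightarrow> ('v \<times> 'v) set \<Rightarrow> btree \<Rightarrow> 'v \<Rightarrow> real" where
  "rooted_density V E Leaf v = 1"
| "rooted_density V E (Graft t s) v = rooted_density V E t v *
     ((\<Sum>w\<in>{w\<in>V. (v, w) \<in> E}. rooted_density V E s w) / real (card V))"

definition rooted_homs :: "btree \<Rightarrow> 'v set \<Rightarrow> ('v \<times> 'v) set \<Rightarrow> 'v \<Rightarrow> (nat \<Rightarrow> 'v) set" where
  "rooted_homs t V E v = {\<phi> \<in> Hom {..<bsize t} (bedges t) V E. \<phi> 0 = v}"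

section \<open>Counting homomorphisms by the image of the root\<close>

lemma finite_Hom: "finite A \<Longrightarrow> finite V \<Longrightarrow> finite (Hom A F V E)"
  unfolding Hom_def by (rule finite_subset[OF _ finite_PiE[of A "\<lambda>_. V"]]) auto

lemma restrict_in_Hom_iff:
  assumes "\<And>i j. (i, j) \<in> F \<Longrightarrow> i \<in> A \<and> j \<in> A"
  shows "restrict \<phi> A \<in> Hom A F V E \<longleftrightarrow> (\<forall>i\<in>A. \<phi> i \<in> V) \<and> (\<forall>i j. (i, j) \<in> F \<longrightarrow> (\<phi> i, \<phi> j) \<in> E)"
proof -
  have "((i, j) \<in> F \<longrightarrow> (restrict \<phi> A i, restrict \<phi> A j) \<in> E) \<longleftrightarrow> ((i, j) \<in> F \<longrightarrow> (\<phi> i, \<phi> j) \<in> E)" for i j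
    using assms[of i j] by auto
  moreover have "restrict \<phi> A \<in> A \<rightarrow>\<^sub>E V \<longleftrightarrow> (\<forall>i\<in>A. \<phi> i \<in> V)"
    by (auto simp: PiE_def Pi_iff split: if_splits)
  ultimately show ?thesis unfolding Hom_def by simp
qed

lemma finite_rooted_homs: "finite V \<Longrightarrow> finite (rooted_homs t V E v)"
  unfolding rooted_homs_def by (simp add: finite_Hom)

lemma card_UN_rooted_homs:
  assumes "finite V" "finite A"
  shows "card (\<Union>w\<in>A. rooted_homs t V E w) = (\<Sum>w\<in>A. card (rooted_homs t V E w))"
  using assms by (intro card_UN_disjoint) (simp_all add: finite_rooted_homs, auto simp: rooted_homs_def)

text \<open>\<open>Hom\<close> consists of functions equal to \<open>undefined\<close> off the
  vertex set, so both parts must be cut back by \<open>restrict\<close>, and extensionality of the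
  whole map is stated separately.\<close>

lemma Hom_Graft_iff:
  "\<phi> \<in> Hom {..<bsize (Graft t s)} (bedges (Graft t s)) V E \<longleftrightarrow>
     \<phi> \<in> extensional {..<bsize t + bsize s} \<and>
     restrict \<phi> {..<bsize t} \<in> Hom {..<bsize t} (bedges t) V E \<and>
     (\<lambda>i\<in>{..<bsize s}. \<phi> (i + bsize t)) \<in> Hom {..<bsize s} (bedges s) V E \<and>
     (\<phi> 0, \<phi> (bsize t)) \<in> E"  (is "?L \<longleftrightarrow> ?R")
proof -
  let ?a = "bsize t" and ?b = "bsize s"
  have range: "(\<forall>i<?a + ?b. \<phi> i \<in> V) \<longleftrightarrow> (\<forall>i<?a. \<phi> i \<in> V) \<and> (\<forall>i<?b. \<phi> (i + ?a) \<in> V)"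
  proof (intro iffI conjI allI impI)
    fix i assume h: "(\<forall>i<?a. \<phi> i \<in> V) \<and> (\<forall>i<?b. \<phi> (i + ?a) \<in> V)" and i: "i < ?a + ?b"
    show "\<phi> i \<in> V"
    proof (cases "i < ?a")
      case False
      then have "\<phi> ((i - ?a) + ?a) \<in> V" using h i by (metis add.commute less_diff_conv2 not_less)
      then show ?thesis using False by simp
    qed (use h in simp)
  qed auto
  have t: "restrict \<phi> {..<?a} \<in> Hom {..<?a} (bedges t) V E \<longleftrightarrow>
      (\<forall>i<?a. \<phi> i \<in> V) \<and> (\<forall>i j. (i, j) \<in> bedges t \<longrightarrow> (\<phi> i, \<phi> j) \<in> E)"
    by (subst restrict_in_Hom_iff) (auto dest: bedges_bounds)
  have s: "(\<lambda>i\<in>{..<?b}. \<phi> (i + ?a)) \<in> Hom {..<?b} (bedges s) V E \<longleftrightarrow>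
      (\<forall>i<?b. \<phi> (i + ?a) \<in> V) \<and> (\<forall>i j. (i, j) \<in> bedges s \<longrightarrow> (\<phi> (i + ?a), \<phi> (j + ?a)) \<in> E)"
    by (subst restrict_in_Hom_iff) (auto dest: bedges_bounds)
  have e: "(\<forall>i j. (i, j) \<in> bedges (Graft t s) \<longrightarrow> (\<phi> i, \<phi> j) \<in> E) \<longleftrightarrow>
     (\<forall>i j. (i, j) \<in> bedges t \<longrightarrow> (\<phi> i, \<phi> j) \<in> E) \<and>
     (\<forall>i j. (i, j) \<in> bedges s \<longrightarrow> (\<phi> (i + ?a), \<phi> (j + ?a)) \<in> E) \<and> (\<phi> 0, \<phi> ?a) \<in> E"
  proof -
    have ball: "(\<forall>i j. (i, j) \<in> R \<longrightarrow> (\<phi> (i + n), \<phi> (j + n)) \<in> E) \<longleftrightarrow> (\<forall>p\<in>R. (\<phi> (fst p + n), \<phi> (snd p + n)) \<in> E)" for R n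
      by auto
    show ?thesis
      using ball[of "bedges (Graft t s)" 0] ball[of "bedges t" 0] ball[of "bedges s" ?a]
      by (simp add: ball_Un case_prod_unfold conj_ac)
  qed
  have "?L \<longleftrightarrow> \<phi> \<in> extensional {..<?a + ?b} \<and> (\<forall>i<?a + ?b. \<phi> i \<in> V) \<and>
      (\<forall>i j. (i, j) \<in> bedges (Graft t s) \<longrightarrow> (\<phi> i, \<phi> j) \<in> E)"
    unfolding Hom_def by (auto simp: PiE_def Pi_def simp del: bedges.simps)
  then show ?thesis unfolding range e t s by blast
qed

text \<open>Splitting a homomorphism into its two parts is a bijection onto pairs; the root of
  \<open>s\<close> may go to any out-neighbour of \<open>v\<close>, independently of the rest of
  \<open>t\<close>.\<close>

lemma card_rooted_homs_Graft:
  assumes V: "finite V" "E \<subseteq> V \<times> V"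
  shows "card (rooted_homs (Graft t s) V E v) =
    card (rooted_homs t V E v) * (\<Sum>w\<in>{w\<in>V. (v, w) \<in> E}. card (rooted_homs s V E w))"
proof -
  let ?a = "bsize t" and ?b = "bsize s"
  let ?B = "\<Union>w\<in>{w\<in>V. (v, w) \<in> E}. rooted_homs s V E w"
  let ?f = "\<lambda>\<phi>. (restrict \<phi> {..<?a}, \<lambda>i\<in>{..<?b}. \<phi> (i + ?a))"
  let ?g = "\<lambda>(\<phi>, \<psi>). \<lambda>i\<in>{..<?a + ?b}. if i < ?a then \<phi> i else \<psi> (i - ?a)"
  have gr1: "restrict (?g (\<phi>, \<psi>)) {..<?a} = \<phi>" if "\<phi> \<in> extensional {..<?a}" for \<phi> \<psi> :: "nat \<Rightarrow> 'a"
    using that by (auto simp: fun_eq_iff restrict_def extensional_def)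
  have gr2: "(\<lambda>i\<in>{..<?b}. ?g (\<phi>, \<psi>) (i + ?a)) = \<psi>" if "\<psi> \<in> extensional {..<?b}" for \<phi> \<psi> :: "nat \<Rightarrow> 'a"
    using that by (auto simp: fun_eq_iff restrict_def extensional_def)
  have fg: "?g (?f \<phi>) = \<phi>" if "\<phi> \<in> extensional {..<?a + ?b}" for \<phi> :: "nat \<Rightarrow> 'a"
    using that by (auto simp: fun_eq_iff restrict_def extensional_def)
  have ext: "\<phi> \<in> extensional {..<bsize u}" if "\<phi> \<in> rooted_homs u V E w" for \<phi> u w
    using that by (auto simp: rooted_homs_def Hom_def PiE_def)
  have E0: "\<psi> 0 \<in> V" if "\<psi> \<in> Hom {..<?b} (bedges s) V E" for \<psi>
    using that by (auto simp: Hom_def)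
  have "bij_betw ?f (rooted_homs (Graft t s) V E v) (rooted_homs t V E v \<times> ?B)"
  proof (rule bij_betw_byWitness[where f' = ?g])
    show "\<forall>\<phi>\<in>rooted_homs (Graft t s) V E v. ?g (?f \<phi>) = \<phi>"
      using fg by (simp add: rooted_homs_def Hom_Graft_iff del: bedges.simps bsize.simps)
    show "\<forall>p\<in>rooted_homs t V E v \<times> ?B. ?f (?g p) = p"
    proof
      fix p assume "p \<in> rooted_homs t V E v \<times> ?B"
      then obtain \<phi> \<psi> w where p: "p = (\<phi>, \<psi>)" and "\<phi> \<in> rooted_homs t V E v" "\<psi> \<in> rooted_homs s V E w"
        by blast
      then have "\<phi> \<in> extensional {..<?a}" "\<psi> \<in> extensional {..<?b}" using ext by blast+
      then show "?f (?g p) = p" unfolding p by (intro prod_eqI) (simp_all only: gr1 gr2 fst_conv snd_conv)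
    qed
    show "?f ` rooted_homs (Graft t s) V E v \<subseteq> rooted_homs t V E v \<times> ?B"
    proof
      fix p assume "p \<in> ?f ` rooted_homs (Graft t s) V E v"
      then obtain \<phi> where \<phi>: "p = ?f \<phi>" "\<phi> 0 = v"
        "\<phi> \<in> Hom {..<bsize (Graft t s)} (bedges (Graft t s)) V E"
        by (auto simp: rooted_homs_def simp del: bedges.simps bsize.simps)
      then show "p \<in> rooted_homs t V E v \<times> ?B"
        using V(2) unfolding Hom_Graft_iff by (auto simp: rooted_homs_def)
    qed
    show "?g ` (rooted_homs t V E v \<times> ?B) \<subseteq> rooted_homs (Graft t s) V E v"
    proof
      fix p assume "p \<in> ?g ` (rooted_homs t V E v \<times> ?B)"
      then obtain \<phi> \<psi> where p: "p = ?g (\<phi>, \<psi>)" and \<phi>: "\<phi> \<in> rooted_homs t V E v"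
        and \<psi>: "\<psi> \<in> rooted_homs s V E (\<psi> 0)" "(v, \<psi> 0) \<in> E"
        by (auto simp: rooted_homs_def)
      have "p \<in> extensional {..<?a + ?b}" unfolding p by simp
      moreover have "p 0 = v" using \<phi> by (simp add: p rooted_homs_def)
      moreover have "p ?a = \<psi> 0" by (simp add: p)
      ultimately show "p \<in> rooted_homs (Graft t s) V E v"
        using \<phi> \<psi> gr1[OF ext[OF \<phi>], of \<psi>] gr2[OF ext[OF \<psi>(1)], of \<phi>]
        unfolding rooted_homs_def mem_Collect_eq Hom_Graft_iff p[symmetric] by simp
    qed
  qed
  then have "card (rooted_homs (Graft t s) V E v) = card (rooted_homs t V E v \<times> ?B)"
    by (rule bij_betw_same_card)
  also have "\<dots> = card (rooted_homs t V E v) * card ?B" by (rule card_cartesian_product)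
  also have "card ?B = (\<Sum>w\<in>{w\<in>V. (v, w) \<in> E}. card (rooted_homs s V E w))"
    using V(1) by (simp add: card_UN_rooted_homs)
  finally show ?thesis .
qed

text \<open>The additional factor \<open>card V\<close> in the numerator expresses the exponent
  \<open>bsize t - 1\<close> without subtraction on the naturals.\<close>

lemma rooted_density_eq_card:
  assumes V: "finite V" "E \<subseteq> V \<times> V" and v: "v \<in> V"
  shows "rooted_density V E t v = real (card V) * real (card (rooted_homs t V E v)) / real (card V) ^ bsize t"
  using v
proof (induction t arbitrary: v)
  case Leaf
  have "rooted_homs Leaf V E v = {\<lambda>i\<in>{..<1}. v}"
    using Leaf by (auto simp: rooted_homs_def Hom_def PiE_def extensional_def fun_eq_iff)
  then show ?case using V(1) Leaf by auto
next
  case (Graft t s)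
  have N: "real (card V) \<noteq> 0" using V(1) Graft.prems by auto
  have "(\<Sum>w\<in>{w\<in>V. (v, w) \<in> E}. rooted_density V E s w) =
      real (card V) * (\<Sum>w\<in>{w\<in>V. (v, w) \<in> E}. real (card (rooted_homs s V E w))) / real (card V) ^ bsize s"
    unfolding sum_distrib_left sum_divide_distrib by (rule sum.cong) (use Graft.IH(2) in auto)
  then show ?case
    using Graft.IH(1)[OF Graft.prems] N by (simp add: card_rooted_homs_Graft[OF V] power_add)
qed

text \<open>Homomorphisms are sorted by the image of the root; averaging over \<open>v\<close>
  supplies the power of \<open>card V\<close> that belongs to the root.\<close>

lemma hom_density_eq_mean:
  assumes V: "finite V" "E \<subseteq> V \<times> V" "V \<noteq> {}"
  shows "hom_density {..<bsize t} (bedges t) V E = (\<Sum>v\<in>V. rooted_density V E t v) / real (card V)"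
proof -
  have N: "real (card V) \<noteq> 0" using V by auto
  have "\<phi> 0 \<in> V" if "\<phi> \<in> Hom {..<bsize t} (bedges t) V E" for \<phi>
    using that PiE_mem[of \<phi> "{..<bsize t}" "\<lambda>_. V" 0] by (simp add: Hom_def)
  then have "Hom {..<bsize t} (bedges t) V E = (\<Union>v\<in>V. rooted_homs t V E v)"
    by (auto simp: rooted_homs_def)
  moreover have "card (\<Union>v\<in>V. rooted_homs t V E v) = (\<Sum>v\<in>V. card (rooted_homs t V E v))"
    using V(1) by (simp add: card_UN_rooted_homs)
  ultimately have "hom_density {..<bsize t} (bedges t) V E
      = (\<Sum>v\<in>V. real (card (rooted_homs t V E v)) / real (card V) ^ bsize t)"
    by (simp add: hom_density_def sum_divide_distrib)
  also have "\<dots> = (\<Sum>v\<in>V. rooted_density V E t v / real (card V))"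
    by (intro sum.cong) (use N rooted_density_eq_card[OF V(1,2)] in auto)
  finally show ?thesis by (simp add: sum_divide_distrib)
qed

text \<open>Formal linear combinations of trees, closed under the operations of the fixed point iteration.
  They carry no reference to a graph, so that the same one can be evaluated in two sequences of graphs.\<close>

type_synonym forest = "(complex \<times> btree) list"

definition feval :: "'v set \<Rightarrow> ('v \<times> 'v) set \<Rightarrow> forest \<Rightarrow> 'v \<Rightarrow> complex" where
  "feval V E p v = (\<Sum>(c, t)\<leftarrow>p. c * complex_of_real (rooted_density V E t v))"

definition nbr_avg :: "'v set \<Rightarrow> ('v \<times> 'v) set \<Rightarrow> ('v \<Rightarrow> complex) \<Rightarrow> 'v \<Rightarrow> complex" where
  "nbr_avg V E f v = (\<Sum>w\<in>{w\<in>V. (v, w) \<in> E}. f w) / of_nat (card V)"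

text \<open>Gluing at the roots. Maps of the two parts with a common root image are independent, so
  rooted densities multiply.\<close>

primrec merge :: "btree \<Rightarrow> btree \<Rightarrow> btree" where
  "merge t Leaf = t"
| "merge t (Graft s u) = Graft (merge t s) u"

definition fmul :: "forest \<Rightarrow> forest \<Rightarrow> forest" where
  "fmul p q = concat (map (\<lambda>(c, t). map (\<lambda>(d, s). (c * d, merge t s)) q) p)"

text \<open>A new root above each tree: the counterpart of averaging over out-neighbours.\<close>

definition fgraft :: "forest \<Rightarrow> forest" where
  "fgraft p = map (\<lambda>(c, t). (c, Graft Leaf t)) p"

primrec fhorner :: "complex list \<Rightarrow> forest \<Rightarrow> forest" where
  "fhorner [] q = []"
| "fhorner (a # as) q = (a, Leaf) # fmul q (fhorner as q)"

text \<open>Picard iteration with a polynomial, given by its coefficient list, in place of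
  \<open>K\<close>; the empty forest is the starting value 0.\<close>

primrec fiter :: "complex list \<Rightarrow> nat \<Rightarrow> forest" where
  "fiter as 0 = []"
| "fiter as (Suc m) = fhorner as (fgraft (fiter as m))"

lemma rooted_density_merge:
  "rooted_density V E (merge t s) v = rooted_density V E t v * rooted_density V E s v"
  by (induction s) auto

lemma feval_simps [simp]:
  "feval V E [] v = 0"
  "feval V E ((c, t) # p) v = c * complex_of_real (rooted_density V E t v) + feval V E p v"
  "feval V E (p @ q) v = feval V E p v + feval V E q v"
  by (simp_all add: feval_def)

lemma feval_fmul: "feval V E (fmul p q) v = feval V E p v * feval V E q v"
proof (induction p)
  case (Cons x p)
  obtain c t where x: "x = (c, t)" by (cases x)
  have "feval V E (map (\<lambda>(d, s). (c * d, merge t s)) q) v = c * complex_of_real (rooted_density V E t v) * feval V E q v"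
    by (induction q) (auto simp: rooted_density_merge algebra_simps)
  then show ?case using Cons by (simp add: fmul_def x algebra_simps)
qed (simp add: fmul_def)

lemma feval_fgraft: "feval V E (fgraft p) v = nbr_avg V E (feval V E p) v"
  by (induction p)
    (auto simp: fgraft_def nbr_avg_def sum.distrib add_divide_distrib sum_distrib_left[symmetric])

lemma feval_fhorner: "feval V E (fhorner as q) v = horner_sum id (feval V E q v) as"
  by (induction as) (auto simp: feval_fmul)

lemma feval_fiter_Suc:
  "feval V E (fiter as (Suc m)) v = horner_sum id (nbr_avg V E (feval V E (fiter as m)) v) as"
  by (simp add: feval_fhorner feval_fgraft)

lemma mean_feval:
  assumes "finite V" "E \<subseteq> V \<times> V" "V \<noteq> {}"
  shows "(\<Sum>v\<in>V. feval V E p v) / of_nat (card V) =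
    (\<Sum>(c, t)\<leftarrow>p. c * complex_of_real (hom_density {..<bsize t} (bedges t) V E))"
  by (induction p)
    (auto simp: sum.distrib add_divide_distrib hom_density_eq_mean[OF assms] sum_distrib_left[symmetric])

section \<open>Convergence\<close>

text \<open>A truncated Taylor series at \<open>c\<close>, written in \<open>h\<close> since the
  fixed point equation evaluates at \<open>c - h\<close>; hence the signs in \<open>b\<close>. One
  coefficient list serves all \<open>h\<close>.\<close>

lemma holomorphic_approx_horner:
  assumes hol: "f holomorphic_on ball c r" and s: "0 \<le> s" "s < r" and \<epsilon>: "0 < (\<epsilon> :: real)"
  shows "\<exists>as. \<forall>h. norm h \<le> s \<longrightarrow> norm (f (c - h) - horner_sum id h as) \<le> \<epsilon>"
proof -
  define b where "b n = (deriv ^^ n) f c / fact n * (- 1) ^ n" for n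
  have sums: "(\<lambda>n. b n * h ^ n) sums f (c - h)" if "norm h < r" for h
  proof -
    have "(\<lambda>n. (deriv ^^ n) f c / fact n * ((c - h) - c) ^ n) sums f (c - h)"
      using that by (intro holomorphic_power_series[OF hol]) (simp add: dist_norm)
    moreover have "(deriv ^^ n) f c / fact n * ((c - h) - c) ^ n = b n * h ^ n" for n
      by (simp add: b_def power_minus[of h])
    ultimately show ?thesis by simp
  qed
  \<comment> \<open>Convergence at a radius strictly beyond \<open>s\<close> gives absolute
    convergence at \<open>s\<close>, and so a tail bound uniform in \<open>h\<close>.\<close>
  define s' where "s' = (s + r) / 2"
  have s': "s < s'" "s' < r" "0 < s'" using s by (auto simp: s'_def)
  have "summable (\<lambda>n. b n * complex_of_real s' ^ n)"
    using sums[of "complex_of_real s'"] s' by (auto simp: sums_iff)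
  then have sm: "summable (\<lambda>n. norm (b n * complex_of_real s ^ n))"
    by (rule powser_insidea) (use s s' in simp)
  then have sm': "summable (\<lambda>n. norm (b n) * s ^ n)"
    using s by (simp add: norm_mult norm_power)
  obtain N where N: "norm (\<Sum>i. norm (b (i + N)) * s ^ (i + N)) < \<epsilon>"
    using suminf_exist_split[OF \<epsilon> sm'] by auto
  show ?thesis
  proof (intro exI[of _ "map b [0..<N]"] allI impI)
    fix h :: complex assume h: "norm h \<le> s"
    have hor: "horner_sum id h (map b [0..<N]) = (\<Sum>n<N. b n * h ^ n)"
      by (simp add: horner_sum_eq_sum lessThan_atLeast0)
    have "(\<lambda>i. b (i + N) * h ^ (i + N)) sums (f (c - h) - (\<Sum>n<N. b n * h ^ n))"
      using sums[of h] h s by (intro sums_split_initial_segment) auto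
    then have "norm (f (c - h) - (\<Sum>n<N. b n * h ^ n)) = norm (\<Sum>i. b (i + N) * h ^ (i + N))"
      by (simp add: sums_iff)
    also have "\<dots> \<le> (\<Sum>i. norm (b (i + N)) * s ^ (i + N))"
    proof (rule norm_suminf_le)
      show "norm (b (i + N) * h ^ (i + N)) \<le> norm (b (i + N)) * s ^ (i + N)" for i
        using h by (simp add: norm_mult norm_power mult_left_mono power_mono)
      show "summable (\<lambda>i. norm (b (i + N)) * s ^ (i + N))"
        using sm' by (rule summable_ignore_initial_segment)
    qed
    also have "\<dots> \<le> \<epsilon>" using N by simp
    finally show "norm (f (c - h) - horner_sum id h (map b [0..<N])) \<le> \<epsilon>" unfolding hor .
  qed
qed

text \<open>Pointwise convergence on a finite \<eta>-net of a compact disc, with the common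
  Lipschitz constant \<open>1/5\<close> filling the gaps:
  \<open>1/5 + 1/5 + 1/2 \<le> 1\<close>.\<close>

lemma weak_conv_K_uniform:
  assumes X: "\<And>n. real_distribution (X n)" and L: "real_distribution L" and conv: "weak_conv_m X L"
    and y: "0 < y"
    and bX: "\<And>n w. norm (w - \<i> * complex_of_real y) \<le> y / 2 \<Longrightarrow> norm (K_transform (X n) w) \<le> 1/20 * y"
    and bL: "\<And>w. norm (w - \<i> * complex_of_real y) \<le> y / 2 \<Longrightarrow> norm (K_transform L w) \<le> 1/20 * y"
    and \<eta>: "0 < \<eta>"
  shows "\<forall>\<^sub>F n in sequentially. \<forall>w. norm (w - \<i> * complex_of_real y) \<le> y / 4 \<longrightarrow>
           norm (K_transform (X n) w - K_transform L w) \<le> \<eta>"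
proof -
  let ?D = "cball (\<i> * complex_of_real y) (y / 4)"
  have mem: "w \<in> ?D \<longleftrightarrow> norm (w - \<i> * complex_of_real y) \<le> y / 4" for w
    by (simp add: dist_norm norm_minus_commute)
  have lip: "norm (K_transform Q a - K_transform Q b) \<le> 1/5 * norm (a - b)"
    if "real_distribution Q" "\<And>w. norm (w - \<i> * complex_of_real y) \<le> y / 2 \<Longrightarrow> norm (K_transform Q w) \<le> 1/20 * y"
      "a \<in> ?D" "b \<in> ?D" for Q a b
    using Lipschitz_near_axis[OF real_distribution.K_holomorphic[OF that(1)] y that(2)] that(3,4) y
    unfolding mem by fastforce
  obtain C where C: "finite C" "C \<subseteq> ?D" "?D \<subseteq> (\<Union>c\<in>C. ball c \<eta>)"
    using seq_compact_imp_totally_bounded[of ?D] \<eta> compact_imp_seq_compact[OF compact_cball] by blast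
  have "\<forall>\<^sub>F n in sequentially. \<forall>c\<in>C. norm (K_transform (X n) c - K_transform L c) < \<eta> / 2"
  proof (rule eventually_ball_finite[OF C(1)], rule ballI)
    fix c assume "c \<in> C"
    then have "norm (c - \<i> * complex_of_real y) \<le> y / 2" using C(2) mem y by fastforce
    then have "0 < Im c" using norm_ratio_le(3)[OF y] y by fastforce
    then have "(\<lambda>n. K_transform (X n) c - K_transform L c) \<longlonglongrightarrow> 0"
      using weak_conv_K[OF X L conv] by (simp add: LIM_zero)
    from order_tendstoD(2)[OF tendsto_norm_zero[OF this], of "\<eta> / 2"]
    show "\<forall>\<^sub>F n in sequentially. norm (K_transform (X n) c - K_transform L c) < \<eta> / 2"
      using \<eta> by simp
  qed
  then show ?thesis
  proof eventually_elim
    case (elim n)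
    show ?case
    proof (intro allI impI)
      fix w assume "norm (w - \<i> * complex_of_real y) \<le> y / 4"
      then have w: "w \<in> ?D" using mem by blast
      then obtain c where c: "c \<in> C" "norm (w - c) < \<eta>" "c \<in> ?D"
        using C by (fastforce simp: dist_norm norm_minus_commute)
      have "norm (K_transform (X n) w - K_transform (X n) c) \<le> 1/5 * norm (w - c)"
        by (rule lip[OF X bX w c(3)])
      moreover have "norm (K_transform L w - K_transform L c) \<le> 1/5 * norm (w - c)"
        by (rule lip[OF L bL w c(3)])
      moreover have "norm (K_transform (X n) c - K_transform L c) < \<eta> / 2"
        using elim c(1) by blast
      moreover have "norm (K_transform (X n) w - K_transform L w) \<le>
          norm (K_transform (X n) w - K_transform (X n) c) + norm (K_transform (X n) c - K_transform L c)
          + norm (K_transform L w - K_transform L c)"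
        using norm_triangle_ineq4[of "(K_transform (X n) w - K_transform (X n) c)
          + (K_transform (X n) c - K_transform L c)" "K_transform L w - K_transform L c"]
          norm_triangle_ineq[of "K_transform (X n) w - K_transform (X n) c" "K_transform (X n) c - K_transform L c"]
        by simp
      ultimately show "norm (K_transform (X n) w - K_transform L w) \<le> \<eta>"
        using c(2) \<eta> by argo
    qed
  qed
qed

section \<open>Error of the tree expansion, uniformly in the graph\<close>

lemma norm_nbr_avg_le:
  assumes V: "finite V" "V \<noteq> {}" and f: "\<And>w. w \<in> V \<Longrightarrow> norm (f w) \<le> C"
  shows "norm (nbr_avg V E f v) \<le> C"
proof -
  have N: "0 < real (card V)" using V by (simp add: card_gt_0_iff)
  have C: "0 \<le> C" using V f norm_ge_zero order_trans by (metis all_not_in_conv)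
  have "norm (\<Sum>w\<in>{w\<in>V. (v, w) \<in> E}. f w / of_nat (card V)) \<le> C"
    using N f C by (intro norm_nbr_sum_le V(1)) (auto simp: norm_divide)
  then show ?thesis by (simp add: nbr_avg_def sum_divide_distrib)
qed

lemma nbr_avg_diff: "nbr_avg V E f v - nbr_avg V E g v = nbr_avg V E (\<lambda>w. f w - g w) v"
  by (simp add: nbr_avg_def sum_subtractf diff_divide_distrib)

text \<open>One iteration turns an error \<open>e\<close> into at most
  \<open>e / 5 + (\<eta> + \<epsilon>)\<close>. The initial part decays since
  \<open>1/5 \<le> 1/2\<close>, and \<open>2 (\<eta> + \<epsilon>)\<close> reproduces itself since
  \<open>2/5 + 1 \<le> 2\<close>.\<close>

lemma fiter_error:
  assumes V: "finite V" "V \<noteq> {}" and y: "0 < y" and \<mu>: "real_distribution \<mu>"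
    and H: "\<And>v. v \<in> V \<Longrightarrow> H v = k (\<i> * complex_of_real y - nbr_avg V E H v)"
    and Hb: "\<And>v. v \<in> V \<Longrightarrow> norm (H v) \<le> 1/20 * y"
    and b\<mu>: "\<And>w. norm (w - \<i> * complex_of_real y) \<le> y / 2 \<Longrightarrow> norm (K_transform \<mu> w) \<le> 1/20 * y"
    and unif: "\<And>w. norm (w - \<i> * complex_of_real y) \<le> y / 4 \<Longrightarrow> norm (k w - K_transform \<mu> w) \<le> \<eta>"
    and approx: "\<And>h. norm h \<le> y / 4 \<Longrightarrow>
        norm (K_transform \<mu> (\<i> * complex_of_real y - h) - horner_sum id h as) \<le> \<epsilon>"
    and \<epsilon>\<eta>: "0 \<le> \<epsilon>" "0 \<le> \<eta>" "\<eta> + \<epsilon> \<le> y / 20" and v: "v \<in> V"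
  shows "norm (H v - feval V E (fiter as m) v) \<le> (1/2) ^ m * (y / 20) + 2 * (\<eta> + \<epsilon>)"
  using v
proof (induction m arbitrary: v)
  case 0
  then show ?case using Hb \<epsilon>\<eta> by (simp add: add_increasing2)
next
  case (Suc m)
  let ?f = "feval V E (fiter as m)"
  let ?z = "\<i> * complex_of_real y"
  define p where "p = (1/2) ^ m * (y / 20)"
  note IH = Suc.IH[folded p_def]
  let ?e = "p + 2 * (\<eta> + \<epsilon>)"
  let ?a = "nbr_avg V E H v" and ?b = "nbr_avg V E ?f v"
  have p: "0 \<le> p" "p \<le> 1 * (y / 20)" "(1/2) ^ Suc m * (y / 20) = p / 2"
    using y unfolding p_def by (simp, intro mult_right_mono power_le_one, auto)
  \<comment> \<open>The purpose of \<open>\<eta> + \<epsilon> \<le> y / 20\<close>: the polynomial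
    iterates stay below \<open>(1 + 1 + 2) * y / 20\<close>, inside the radius \<open>y / 4\<close>
    where \<open>approx\<close> applies.\<close>
  have f: "norm (?f w) \<le> y / 4" if "w \<in> V" for w
  proof -
    have "norm (?f w) \<le> norm (H w) + norm (H w - ?f w)"
      using norm_triangle_ineq4[of "H w" "H w - ?f w"] by simp
    then show ?thesis using Hb[OF that] IH[OF that] p(2) \<epsilon>\<eta> y by argo
  qed
  have a: "norm ?a \<le> y / 4" using Hb y by (intro norm_nbr_avg_le V) fastforce
  have b: "norm ?b \<le> y / 4" using f by (intro norm_nbr_avg_le V)
  have ab: "norm (?a - ?b) \<le> ?e"
    unfolding nbr_avg_diff using IH by (intro norm_nbr_avg_le V)
  have "norm (K_transform \<mu> (?z - ?a) - K_transform \<mu> (?z - ?b)) \<le> 4 * (1/20 * y) / y * norm ((?z - ?a) - (?z - ?b))"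
    using a b by (intro Lipschitz_near_axis[OF real_distribution.K_holomorphic[OF \<mu>] y b\<mu>]) auto
  also have "\<dots> = 1/5 * norm (?a - ?b)" using y by (simp add: norm_minus_commute)
  finally have 1: "norm (K_transform \<mu> (?z - ?a) - K_transform \<mu> (?z - ?b)) \<le> 1/5 * norm (?a - ?b)" .
  have 2: "norm (k (?z - ?a) - K_transform \<mu> (?z - ?a)) \<le> \<eta>" using a by (intro unif) simp
  have 3: "norm (K_transform \<mu> (?z - ?b) - horner_sum id ?b as) \<le> \<epsilon>" by (rule approx[OF b])
  \<comment> \<open>Three errors: replacing \<open>k\<close> by its limit, the inherited error
    contracted by \<open>K\<close>, and the polynomial.\<close>
  have "H v - feval V E (fiter as (Suc m)) v = (k (?z - ?a) - K_transform \<mu> (?z - ?a))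
      + (K_transform \<mu> (?z - ?a) - K_transform \<mu> (?z - ?b)) + (K_transform \<mu> (?z - ?b) - horner_sum id ?b as)"
    unfolding feval_fiter_Suc using H[OF Suc.prems] by simp
  then have "norm (H v - feval V E (fiter as (Suc m)) v) \<le> norm (k (?z - ?a) - K_transform \<mu> (?z - ?a))
      + norm (K_transform \<mu> (?z - ?a) - K_transform \<mu> (?z - ?b)) + norm (K_transform \<mu> (?z - ?b) - horner_sum id ?b as)"
    by (simp only:) (meson add_mono norm_triangle_ineq order_refl order_trans)
  also have "\<dots> \<le> \<eta> + 1/5 * ?e + \<epsilon>" using 1 2 3 ab by argo
  also have "\<dots> \<le> (1/2) ^ Suc m * (y / 20) + 2 * (\<eta> + \<epsilon>)"
    unfolding p(3) using p(1) \<epsilon>\<eta> by argo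
  finally show ?case .
qed

text \<open>The error budget: a quarter of \<open>\<epsilon>\<close> for stopping after \<open>m\<close> iterations, a half for the Taylor polynomial
  and for replacing \<open>k\<close> by its limit, a quarter for the tree densities.\<close>

definition tree_approx :: "real measure \<Rightarrow> real \<Rightarrow> complex list \<Rightarrow> nat \<Rightarrow> real \<Rightarrow> bool" where
  "tree_approx \<mu> y as m \<epsilon> \<longleftrightarrow> 0 < \<epsilon> \<and> \<epsilon> \<le> y / 5 \<and> (1/2) ^ m * (y / 20) \<le> \<epsilon> / 4 \<and>
     (\<forall>h. norm h \<le> y / 4 \<longrightarrow>
        norm (K_transform \<mu> (\<i> * complex_of_real y - h) - horner_sum id h as) \<le> \<epsilon> / 8)"

lemma tree_approx_exists:
  assumes \<mu>: "real_distribution \<mu>" and y: "0 < y" and \<epsilon>: "0 < \<epsilon>" "\<epsilon> \<le> y / 5"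
  shows "\<exists>as m. tree_approx \<mu> y as m \<epsilon>"
proof -
  have "ball (\<i> * complex_of_real y) (y / 2) \<subseteq> upper"
  proof
    fix w assume "w \<in> ball (\<i> * complex_of_real y) (y / 2)"
    then have "norm (w - \<i> * complex_of_real y) \<le> y / 2" by (simp add: dist_norm norm_minus_commute)
    from norm_ratio_le(3)[OF y this] show "w \<in> upper" using y by (simp add: upper_def)
  qed
  then have "K_transform \<mu> holomorphic_on ball (\<i> * complex_of_real y) (y / 2)"
    using real_distribution.K_holomorphic[OF \<mu>] holomorphic_on_subset by blast
  then obtain as where as: "\<forall>h. norm h \<le> y / 4 \<longrightarrow>
      norm (K_transform \<mu> (\<i> * complex_of_real y - h) - horner_sum id h as) \<le> \<epsilon> / 8"
    using holomorphic_approx_horner[of "K_transform \<mu>" _ "y / 2" "y / 4" "\<epsilon> / 8"] y \<epsilon> by auto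
  \<comment> \<open>\<open>5 * \<epsilon> / y\<close> is the value at which
    \<open>(1/2) ^ m * (y / 20)\<close> equals \<open>\<epsilon> / 4\<close>.\<close>
  obtain m where "(1/2) ^ m < 5 * \<epsilon> / y"
    using real_arch_pow_inv[of "5 * \<epsilon> / y" "1/2"] y \<epsilon> by auto
  then have "(1/2) ^ m * y \<le> 5 * \<epsilon>"
    using pos_less_divide_eq[OF y] less_imp_le by blast
  then have "(1/2) ^ m * y / 20 \<le> 5 * \<epsilon> / 20" by (rule divide_right_mono) simp
  then have "(1/2) ^ m * (y / 20) \<le> \<epsilon> / 4" by simp
  then show ?thesis using as \<epsilon> unfolding tree_approx_def by blast
qed

definition forest_limit :: "(nat set \<Rightarrow> (nat \<times> nat) set \<Rightarrow> real) \<Rightarrow> forest \<Rightarrow> complex" where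
  "forest_limit \<beta> p = (\<Sum>(c, t)\<leftarrow>p. c * complex_of_real (\<beta> {..<bsize t} (bedges t)))"

lemma tendsto_forest_limit:
  assumes "\<And>T F. finite_rooted_tree T F \<Longrightarrow> (\<lambda>n. hom_density T F (V n) (E n)) \<longlonglongrightarrow> \<beta> T F"
  shows "(\<lambda>n. \<Sum>(c, t)\<leftarrow>p. c * complex_of_real (hom_density {..<bsize t} (bedges t) (V n) (E n)))
           \<longlonglongrightarrow> forest_limit \<beta> p"
  unfolding forest_limit_def
proof (induction p)
  case (Cons x p)
  obtain c t where x: "x = (c, t)" by (cases x)
  have "(\<lambda>n. hom_density {..<bsize t} (bedges t) (V n) (E n)) \<longlonglongrightarrow> \<beta> {..<bsize t} (bedges t)"
    by (rule assms[OF finite_rooted_tree_bedges])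
  then have "(\<lambda>n. c * complex_of_real (hom_density {..<bsize t} (bedges t) (V n) (E n)) +
        (\<Sum>(c, t)\<leftarrow>p. c * complex_of_real (hom_density {..<bsize t} (bedges t) (V n) (E n))))
      \<longlonglongrightarrow> c * complex_of_real (\<beta> {..<bsize t} (bedges t)) +
        (\<Sum>(c, t)\<leftarrow>p. c * complex_of_real (\<beta> {..<bsize t} (bedges t)))"
    by (intro tendsto_intros Cons.IH)
  then show ?case by (simp add: x)
qed simp

text \<open>The last clause is the link between different sequences: it describes the limit on a ray
  through \<open>tree_approx\<close> and \<open>forest_limit\<close>, which know \<mu> and \<beta>
  but no graph.\<close>

lemma gfree_conv_limit_nonempty:
  fixes V :: "nat \<Rightarrow> 'a set" and E :: "nat \<Rightarrow> ('a \<times> 'a) set"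
  assumes graphs: "\<And>n. finite_digraph (V n) (E n)" and ne: "\<And>n. V n \<noteq> {}"
    and trees: "\<And>T F. finite_rooted_tree T F \<Longrightarrow> (\<lambda>n. hom_density T F (V n) (E n)) \<longlonglongrightarrow> \<beta> T F"
    and mu: "real_distribution \<mu>" and mus: "\<And>n. real_distribution (\<mu>s n)"
    and pow: "weak_conv_m (\<lambda>n. boolean_power (\<mu>s n) (real (card (V n)))) \<mu>"
  shows "\<exists>L. real_distribution L \<and> weak_conv_m (\<lambda>n. gfree_conv (V n) (E n) (\<lambda>_. \<mu>s n)) L \<and>
     (\<exists>R. \<forall>y\<ge>R. \<forall>as m \<epsilon>. tree_approx \<mu> y as m \<epsilon> \<longrightarrow>
        norm (K_transform L (\<i> * complex_of_real y) - forest_limit \<beta> (fiter as m)) \<le> \<epsilon>)"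
proof -
  let ?i = "\<lambda>y. \<i> * complex_of_real y"
  define N where "N n = real (card (V n))" for n
  define \<sigma> where "\<sigma> n = boolean_power (\<mu>s n) (N n)" for n
  define \<rho> where "\<rho> n = gfree_conv (V n) (E n) (\<lambda>_. \<mu>s n)" for n
  have fin: "finite (V n)" and sub: "E n \<subseteq> V n \<times> V n" for n
    using graphs by (auto simp: finite_digraph_def digraph_def)
  have N: "0 < N n" for n using fin ne by (simp add: N_def card_gt_0_iff)
  have \<sigma>: "real_distribution (\<sigma> n)" for n
    unfolding \<sigma>_def using boolean_power(1)[OF mus] N less_imp_le by blast
  have K\<sigma>: "K_transform (\<sigma> n) z = complex_of_real (N n) * K_transform (\<mu>s n) z" if "0 < Im z" for n z
    unfolding \<sigma>_def using boolean_power(2)[OF mus] N less_imp_le that by blast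
  have conv: "weak_conv_m \<sigma> \<mu>" using pow by (simp add: \<sigma>_def[abs_def] N_def)
  have "\<exists>\<nu>. \<forall>n. gfree_family (V n) (E n) (\<lambda>_. \<mu>s n) (\<nu> n) \<and>
    (\<forall>z. 0 < Im z \<longrightarrow> K_transform (\<rho> n) z = (\<Sum>v\<in>V n. K_transform (\<nu> n v) z)) \<and>
    (\<forall>v\<in>V n. \<forall>y>0. \<forall>\<delta>\<le>1/20.
       (\<forall>w. norm (w - ?i y) \<le> y / 2 \<longrightarrow> N n * norm (K_transform (\<mu>s n) w) \<le> \<delta> * y) \<longrightarrow>
       N n * norm (K_transform (\<nu> n v) (?i y)) \<le> \<delta> * y)"
    unfolding \<rho>_def N_def
    by (rule choice, rule allI) (use gfree_conv[OF fin ne mus] in blast)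
  then obtain \<nu> where fam: "\<And>n. gfree_family (V n) (E n) (\<lambda>_. \<mu>s n) (\<nu> n)"
    and K\<rho>: "\<And>n z. 0 < Im z \<Longrightarrow> K_transform (\<rho> n) z = (\<Sum>v\<in>V n. K_transform (\<nu> n v) z)"
    and \<nu>b: "\<And>n v y \<delta>. v \<in> V n \<Longrightarrow> 0 < y \<Longrightarrow> \<delta> \<le> 1/20 \<Longrightarrow>
       (\<And>w. norm (w - ?i y) \<le> y / 2 \<Longrightarrow> N n * norm (K_transform (\<mu>s n) w) \<le> \<delta> * y) \<Longrightarrow>
       N n * norm (K_transform (\<nu> n v) (?i y)) \<le> \<delta> * y"
    by blast
  have \<rho>: "real_distribution (\<rho> n)" for n
    unfolding \<rho>_def using gfree_conv[OF fin ne mus] by blast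
  have \<sigma>_small: "\<exists>R>0. \<forall>n. \<forall>y\<ge>R. \<forall>w. norm (w - ?i y) \<le> y / 2 \<longrightarrow> norm (K_transform (\<sigma> n) w) \<le> \<delta> * y"
    if "0 < \<delta>" for \<delta>
    by (rule weak_conv_K_small_all[OF \<sigma> mu conv that])
  have \<nu>_bound: "N n * norm (K_transform (\<nu> n v) (?i y)) \<le> \<delta> * y"
    if "v \<in> V n" "0 < y" "\<delta> \<le> 1/20" "\<And>w. norm (w - ?i y) \<le> y / 2 \<Longrightarrow> norm (K_transform (\<sigma> n) w) \<le> \<delta> * y"
    for n v y \<delta>
  proof (rule \<nu>b[OF that(1-3)])
    fix w assume w: "norm (w - ?i y) \<le> y / 2"
    then have "0 < Im w" using norm_ratio_le(3)[OF that(2) w] that(2) by linarith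
    then show "N n * norm (K_transform (\<mu>s n) w) \<le> \<delta> * y"
      using that(4)[OF w] K\<sigma> N[of n] by (simp add: norm_mult)
  qed
  have small: "\<exists>y>0. \<forall>n. norm (K_transform (\<rho> n) (?i y)) \<le> \<delta> * y" if \<delta>: "0 < \<delta>" for \<delta>
  proof -
    define \<delta>' where "\<delta>' = min (1/20) \<delta>"
    have \<delta>': "0 < \<delta>'" "\<delta>' \<le> 1/20" "\<delta>' \<le> \<delta>" using \<delta> by (auto simp: \<delta>'_def)
    obtain R where R: "0 < R" "\<forall>n. \<forall>y\<ge>R. \<forall>w. norm (w - ?i y) \<le> y / 2 \<longrightarrow> norm (K_transform (\<sigma> n) w) \<le> \<delta>' * y"
      using \<sigma>_small[OF \<delta>'(1)] by blast
    have "norm (K_transform (\<rho> n) (?i R)) \<le> \<delta> * R" for n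
    proof -
      have "N n * norm (K_transform (\<nu> n v) (?i R)) \<le> \<delta>' * R" if "v \<in> V n" for v
        using R by (intro \<nu>_bound that \<delta>'(2)) auto
      \<comment> \<open>The neighbour estimate with a trivial predicate bounds the sum over all
        vertices.\<close>
      then have "norm (\<Sum>v\<in>{v\<in>V n. True}. K_transform (\<nu> n v) (?i R)) \<le> \<delta>' * R"
        using R(1) \<delta>'(1) by (intro norm_nbr_sum_le fin) (auto simp: N_def)
      also have "\<dots> \<le> \<delta> * R" using \<delta>'(3) R(1) by (intro mult_right_mono) auto
      finally show ?thesis using R(1) by (simp add: K\<rho>)
    qed
    then show ?thesis using R(1) by blast
  qed
  obtain R1 where R1: "0 < R1" "\<forall>n. \<forall>y\<ge>R1. \<forall>w. norm (w - ?i y) \<le> y / 2 \<longrightarrow> norm (K_transform (\<sigma> n) w) \<le> 1/20 * y"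
    using \<sigma>_small[of "1/20"] by auto
  obtain R2 where R2: "\<forall>y\<ge>R2. \<forall>w. norm (w - ?i y) \<le> y / 2 \<longrightarrow> norm (K_transform \<mu> w) \<le> 1/20 * y"
    using real_distribution.K_small_ex[OF mu, of "1/20"] by auto
  define R where "R = max R1 R2"
  have close: "\<forall>\<^sub>F n in sequentially. norm (K_transform (\<rho> n) (?i y) - forest_limit \<beta> (fiter as m)) \<le> \<epsilon>"
    if y: "R \<le> y" and ta: "tree_approx \<mu> y as m \<epsilon>" for y as m \<epsilon>
  proof -
    have y0: "0 < y" and yR: "R1 \<le> y" "R2 \<le> y" using y R1(1) by (auto simp: R_def)
    have \<epsilon>: "0 < \<epsilon>" "\<epsilon> \<le> y / 5" "(1/2) ^ m * (y / 20) \<le> \<epsilon> / 4" using ta by (auto simp: tree_approx_def)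
    have "\<forall>\<^sub>F n in sequentially. \<forall>w. norm (w - ?i y) \<le> y / 4 \<longrightarrow> norm (K_transform (\<sigma> n) w - K_transform \<mu> w) \<le> \<epsilon> / 8"
      using R1(2) R2 yR \<epsilon>(1) by (intro weak_conv_K_uniform[OF \<sigma> mu conv y0]) auto
    moreover have "\<forall>\<^sub>F n in sequentially. norm ((\<Sum>(c, t)\<leftarrow>fiter as m. c * complex_of_real (hom_density {..<bsize t} (bedges t) (V n) (E n)))
        - forest_limit \<beta> (fiter as m)) < \<epsilon> / 4"
    proof -
      have "(\<lambda>n. (\<Sum>(c, t)\<leftarrow>fiter as m. c * complex_of_real (hom_density {..<bsize t} (bedges t) (V n) (E n)))
        - forest_limit \<beta> (fiter as m)) \<longlonglongrightarrow> 0"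
        using tendsto_forest_limit[OF trees] by (rule LIM_zero)
      from order_tendstoD(2)[OF tendsto_norm_zero[OF this], of "\<epsilon> / 4"] show ?thesis
        using \<epsilon>(1) by simp
    qed
    ultimately show ?thesis
    proof eventually_elim
      case (elim n)
      define H where "H v = complex_of_real (N n) * K_transform (\<nu> n v) (?i y)" for v
      have Nc: "complex_of_real (N n) \<noteq> 0" using N[of n] by simp
      \<comment> \<open>The factor \<open>N\<close> in \<open>H\<close> cancels the average, leaving
        the plain neighbour sum of the defining equation.\<close>
      have avg: "nbr_avg (V n) (E n) H v = (\<Sum>w\<in>{w\<in>V n. (v, w) \<in> E n}. K_transform (\<nu> n w) (?i y))" for v
        using Nc by (simp add: nbr_avg_def H_def sum_distrib_left[symmetric] N_def)
      have Heq: "H v = K_transform (\<sigma> n) (?i y - nbr_avg (V n) (E n) H v)" if v: "v \<in> V n" for v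
      proof -
        have rd: "real_distribution (\<nu> n w)" if "w \<in> V n" for w using fam that by (auto simp: gfree_family_def)
        have "Im (nbr_avg (V n) (E n) H v) \<le> 0"
          unfolding avg using real_distribution.Im_K_le[OF rd, of _ "?i y"] y0 by (auto intro: sum_nonpos)
        then have "0 < Im (?i y - nbr_avg (V n) (E n) H v)" using y0 by simp
        moreover have "K_transform (\<nu> n v) (?i y) = K_transform (\<mu>s n) (?i y - nbr_avg (V n) (E n) H v)"
          unfolding avg using fam v y0 by (simp add: gfree_family_def)
        ultimately show ?thesis by (simp add: H_def[of v] K\<sigma>)
      qed
      \<comment> \<open>With both errors equal to \<open>\<epsilon> / 8\<close>, the requirement of
        \<open>fiter_error\<close> that they sum to at most \<open>y / 20\<close> is the clause
        \<open>\<epsilon> \<le> y / 5\<close> of \<open>tree_approx\<close>.\<close>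
      have err: "norm (H v - feval (V n) (E n) (fiter as m) v) \<le> (1/2) ^ m * (y / 20) + 2 * (\<epsilon> / 8 + \<epsilon> / 8)"
        if v: "v \<in> V n" for v
      proof (rule fiter_error[where k = "K_transform (\<sigma> n)" and H = H and \<eta> = "\<epsilon> / 8" and \<epsilon> = "\<epsilon> / 8",
            OF fin ne y0 mu Heq])
        show "norm (H v) \<le> 1/20 * y" if "v \<in> V n" for v
          using \<nu>_bound[OF that y0, of "1/20"] R1(2) yR(1) N[of n] by (simp add: H_def norm_mult)
      qed (use R2 yR(2) elim(1) ta \<epsilon> v in \<open>auto simp: tree_approx_def\<close>)
      have "K_transform (\<rho> n) (?i y) - (\<Sum>(c, t)\<leftarrow>fiter as m. c * complex_of_real (hom_density {..<bsize t} (bedges t) (V n) (E n)))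
          = (\<Sum>v\<in>V n. (H v - feval (V n) (E n) (fiter as m) v) / of_nat (card (V n)))"
        using y0 Nc by (simp add: mean_feval[OF fin sub ne, symmetric] K\<rho> H_def sum_subtractf diff_divide_distrib
            sum_divide_distrib N_def)
      also have "norm \<dots> \<le> (\<Sum>v\<in>V n. (3 / 4 * \<epsilon>) / N n)"
      proof (rule sum_norm_le)
        fix v assume v: "v \<in> V n"
        have "norm (H v - feval (V n) (E n) (fiter as m) v) \<le> 3 / 4 * \<epsilon>"
          using err[OF v] \<epsilon>(3) by argo
        then show "norm ((H v - feval (V n) (E n) (fiter as m) v) / of_nat (card (V n))) \<le> 3 / 4 * \<epsilon> / N n"
          unfolding norm_divide norm_of_nat N_def by (rule divide_right_mono) simp
      qed
      also have "\<dots> = 3 / 4 * \<epsilon>" using N[of n] by (simp add: N_def)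
      finally show ?case
        using elim(2) norm_triangle_ineq[of "K_transform (\<rho> n) (?i y) - (\<Sum>(c, t)\<leftarrow>fiter as m. c * complex_of_real (hom_density {..<bsize t} (bedges t) (V n) (E n)))"
          "(\<Sum>(c, t)\<leftarrow>fiter as m. c * complex_of_real (hom_density {..<bsize t} (bedges t) (V n) (E n))) - forest_limit \<beta> (fiter as m)"]
        by simp
    qed
  qed
  \<comment> \<open>The approximating number changes with \<epsilon>, so only the Cauchy criterion
    is at hand: late terms differ by at most \<open>2 * \<epsilon> \<le> 2/3 * e\<close>.\<close>
  have convergent: "convergent (\<lambda>n. K_transform (\<rho> n) (?i y))" if y: "R \<le> y" for y
  proof -
    have y0: "0 < y" using y R1(1) by (auto simp: R_def)
    have "Cauchy (\<lambda>n. K_transform (\<rho> n) (?i y))"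
    proof (rule metric_CauchyI)
      fix e :: real assume e: "0 < e"
      define \<epsilon> where "\<epsilon> = min (y / 5) (e / 3)"
      have \<epsilon>: "0 < \<epsilon>" "\<epsilon> \<le> y / 5" "\<epsilon> \<le> e / 3" using e y0 by (auto simp: \<epsilon>_def)
      obtain as m where "tree_approx \<mu> y as m \<epsilon>" using tree_approx_exists[OF mu y0 \<epsilon>(1,2)] by blast
      from close[OF y this] obtain n0 where n0: "\<And>n. n0 \<le> n \<Longrightarrow>
          dist (K_transform (\<rho> n) (?i y)) (forest_limit \<beta> (fiter as m)) \<le> \<epsilon>"
        by (auto simp: eventually_sequentially dist_norm)
      have "dist (K_transform (\<rho> a) (?i y)) (K_transform (\<rho> b) (?i y)) < e" if "n0 \<le> a" "n0 \<le> b" for a b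
        using n0[OF that(1)] n0[OF that(2)] \<epsilon> e
          dist_triangle2[of "K_transform (\<rho> a) (?i y)" "K_transform (\<rho> b) (?i y)" "forest_limit \<beta> (fiter as m)"]
        by linarith
      then show "\<exists>n0. \<forall>a\<ge>n0. \<forall>b\<ge>n0. dist (K_transform (\<rho> a) (?i y)) (K_transform (\<rho> b) (?i y)) < e"
        by blast
    qed
    then show ?thesis by (simp add: Cauchy_convergent_iff)
  qed
  obtain L where L: "real_distribution L" "weak_conv_m \<rho> L"
    using weak_limit_exists[where R = R and \<kappa> = "\<lambda>y. lim (\<lambda>n. K_transform (\<rho> n) (?i y))", OF \<rho> small]
      convergent by (auto simp: convergent_LIMSEQ_iff)
  have "norm (K_transform L (?i y) - forest_limit \<beta> (fiter as m)) \<le> \<epsilon>"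
    if y: "R \<le> y" and ta: "tree_approx \<mu> y as m \<epsilon>" for y as m \<epsilon>
  proof (rule tendsto_upperbound[OF _ close[OF y ta]])
    have "0 < Im (?i y)" using y R1(1) by (auto simp: R_def)
    then show "(\<lambda>n. norm (K_transform (\<rho> n) (?i y) - forest_limit \<beta> (fiter as m)))
        \<longlonglongrightarrow> norm (K_transform L (?i y) - forest_limit \<beta> (fiter as m))"
      by (intro tendsto_intros weak_conv_K[OF \<rho> L])
  qed simp
  then show ?thesis using L unfolding \<rho>_def by blast
qed

text \<open>As the sizes tend to infinity, all \<open>V n\<close> from some index on are nonempty;
  shifting the sequences past that index leaves their limits unchanged.\<close>

lemma gfree_conv_limit:
  fixes V :: "nat \<Rightarrow> 'a set" and E :: "nat \<Rightarrow> ('a \<times> 'a) set"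
  assumes graphs: "\<And>n. finite_digraph (V n) (E n)"
    and size: "filterlim (\<lambda>n. card (V n)) at_top sequentially"
    and trees: "\<And>T F. finite_rooted_tree T F \<Longrightarrow> (\<lambda>n. hom_density T F (V n) (E n)) \<longlonglongrightarrow> \<beta> T F"
    and mu: "real_distribution \<mu>" and mus: "\<And>n. real_distribution (\<mu>s n)"
    and pow: "weak_conv_m (\<lambda>n. boolean_power (\<mu>s n) (real (card (V n)))) \<mu>"
  shows "\<exists>L. real_distribution L \<and> weak_conv_m (\<lambda>n. gfree_conv (V n) (E n) (\<lambda>_. \<mu>s n)) L \<and>
     (\<exists>R. \<forall>y\<ge>R. \<forall>as m \<epsilon>. tree_approx \<mu> y as m \<epsilon> \<longrightarrow>
        norm (K_transform L (\<i> * complex_of_real y) - forest_limit \<beta> (fiter as m)) \<le> \<epsilon>)"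
proof -
  obtain n0 where n0: "\<And>n. n0 \<le> n \<Longrightarrow> 1 \<le> card (V n)"
    using size by (auto simp: filterlim_at_top eventually_sequentially)
  have shift: "weak_conv_m (\<lambda>n. X (n + n0)) Q \<longleftrightarrow> weak_conv_m X Q" for X Q
  proof -
    have "(\<lambda>n. f (n + n0)) \<longlonglongrightarrow> l \<longleftrightarrow> f \<longlonglongrightarrow> l" for f :: "nat \<Rightarrow> real" and l
      using LIMSEQ_ignore_initial_segment[of f l n0] LIMSEQ_offset[of f n0 l] by blast
    from this[of "\<lambda>n. cdf (X n) _"] show ?thesis
      unfolding weak_conv_m_def weak_conv_def by simp
  qed
  have "V (n + n0) \<noteq> {}" for n using n0[of "n + n0"] by auto
  from gfree_conv_limit_nonempty[of "\<lambda>n. V (n + n0)" "\<lambda>n. E (n + n0)" \<beta> \<mu> "\<lambda>n. \<mu>s (n + n0)", OF graphs this _ mu mus]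
  show ?thesis
    using LIMSEQ_ignore_initial_segment[OF trees] pow
      shift[of "\<lambda>n. boolean_power (\<mu>s n) (real (card (V n)))"]
      shift[of "\<lambda>n. gfree_conv (V n) (E n) (\<lambda>_. \<mu>s n)"] by simp
qed

theorem theorem1p1:
  fixes V :: "nat \<Rightarrow> 'a set" and E :: "nat \<Rightarrow> ('a \<times> 'a) set"
    and \<mu>s :: "nat \<Rightarrow> real measure"
    and V2 :: "nat \<Rightarrow> 'b set" and E2 :: "nat \<Rightarrow> ('b \<times> 'b) set"
    and \<mu>s2 :: "nat \<Rightarrow> real measure"
    and \<mu> :: "real measure"
    and \<beta> :: "nat set \<Rightarrow> (nat \<times> nat) set \<Rightarrow> real"
  assumes graphs: "\<And>n. finite_digraph (V n) (E n)"
    and size: "filterlim (\<lambda>n. card (V n)) at_top sequentially"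
    and trees: "\<And>T F. finite_rooted_tree T F \<Longrightarrow>
                   (\<lambda>n. hom_density T F (V n) (E n)) \<longlonglongrightarrow> \<beta> T F"
    and mu: "real_distribution \<mu>"
    and mus: "\<And>n. real_distribution (\<mu>s n)"
    and pow: "weak_conv_m (\<lambda>n. boolean_power (\<mu>s n) (real (card (V n)))) \<mu>"
    and graphs2: "\<And>n. finite_digraph (V2 n) (E2 n)"
    and size2: "filterlim (\<lambda>n. card (V2 n)) at_top sequentially"
    and trees2: "\<And>T F. finite_rooted_tree T F \<Longrightarrow>
                   (\<lambda>n. hom_density T F (V2 n) (E2 n)) \<longlonglongrightarrow> \<beta> T F"
    and mus2: "\<And>n. real_distribution (\<mu>s2 n)"
    and pow2: "weak_conv_m (\<lambda>n. boolean_power (\<mu>s2 n) (real (card (V2 n)))) \<mu>"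
  shows "\<exists>L. real_distribution L \<and>
           weak_conv_m (\<lambda>n. gfree_conv (V n) (E n) (\<lambda>_. \<mu>s n)) L \<and>
           weak_conv_m (\<lambda>n. gfree_conv (V2 n) (E2 n) (\<lambda>_. \<mu>s2 n)) L"
proof -
  obtain L R where L: "real_distribution L" "weak_conv_m (\<lambda>n. gfree_conv (V n) (E n) (\<lambda>_. \<mu>s n)) L"
    and KL: "\<And>y as m \<epsilon>. R \<le> y \<Longrightarrow> tree_approx \<mu> y as m \<epsilon> \<Longrightarrow>
        norm (K_transform L (\<i> * complex_of_real y) - forest_limit \<beta> (fiter as m)) \<le> \<epsilon>"
    using gfree_conv_limit[OF graphs size trees mu mus pow] by blast
  obtain L2 R2 where L2: "real_distribution L2" "weak_conv_m (\<lambda>n. gfree_conv (V2 n) (E2 n) (\<lambda>_. \<mu>s2 n)) L2"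
    and KL2: "\<And>y as m \<epsilon>. R2 \<le> y \<Longrightarrow> tree_approx \<mu> y as m \<epsilon> \<Longrightarrow>
        norm (K_transform L2 (\<i> * complex_of_real y) - forest_limit \<beta> (fiter as m)) \<le> \<epsilon>"
    using gfree_conv_limit[OF graphs2 size2 trees2 mu mus2 pow2] by blast
  have "L = L2"
  proof (rule K_transform_unique_imaginary_axis[OF L(1) L2(1)])
    fix y assume y: "max 1 (max R R2) \<le> y"
    then have y0: "0 < y" by simp
    let ?d = "norm (K_transform L (\<i> * complex_of_real y) - K_transform L2 (\<i> * complex_of_real y))"
    have "?d \<le> 0"
    proof (rule field_le_epsilon)
      fix e :: real assume e: "0 < e"
      define \<epsilon> where "\<epsilon> = min (y / 5) (e / 2)"
      have \<epsilon>: "0 < \<epsilon>" "\<epsilon> \<le> y / 5" "\<epsilon> \<le> e / 2" using e y0 by (auto simp: \<epsilon>_def)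
      \<comment> \<open>One choice of polynomial and depth serves both sequences, so both transforms
        lie within \<epsilon> of the same \<open>forest_limit\<close>.\<close>
      obtain as m where ta: "tree_approx \<mu> y as m \<epsilon>" using tree_approx_exists[OF mu y0 \<epsilon>(1,2)] by blast
      show "?d \<le> 0 + e"
        using KL[OF _ ta] KL2[OF _ ta] y \<epsilon>(3)
          norm_triangle_ineq4[of "K_transform L (\<i> * complex_of_real y) - forest_limit \<beta> (fiter as m)"
            "K_transform L2 (\<i> * complex_of_real y) - forest_limit \<beta> (fiter as m)"]
        by simp
    qed
    then show "K_transform L (\<i> * complex_of_real y) = K_transform L2 (\<i> * complex_of_real y)" by simp
  qed
  then show ?thesis using L L2 by blast
qed

end
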